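(* Let $B \subseteq A$ be a subalgebra pair of (finite dimensional) complex semisimple algebras, with $1_B = 1_A$, and let $M$ be its inclusion matrix. Let $n \geq 1$ be an integer. Then $B \subseteq A$ has H-depth $2n-1$ if and only if the symmetric matrix $S = M^tM$ satisfies $$S^n \leq q S^{n-1}$$ for some positive integer $q$.
   Context: Let $V_1, \ldots, V_s$ represent the isomorphism classes of simple right $A$-modules and $W_1, \ldots, W_r$ those of simple right $B$-modules. The inclusion matrix is the $r \times s$ matrix $M = (m_{ij})$ of nonnegative integers, where $m_{ij}$ is the multiplicity of $W_i$ in the restriction of $V_j$ to $B$ (equivalently, the multiplicity of $V_j$ in the induced module $W_i \otimes_B A$). $M^t$ is the transpose of $M$. Matrix inequality $X \leq Y$ is entrywise, and $S^0$ is the identity matrix. For $n \geq 1$, $C_n(A,B) = A \otimes_B \cdots \otimes_B A$ ($n$ factors $A$), an $A$-$A$-bimodule via multiplication on the outer factors. $B \subseteq A$ has H-depth $2n-1$ if for some positive integer $q$, $C_{n+1}(A,B)$ is isomorphic as $A$-$A$-bimodule to a direct summand of $C_n(A,B)^q$ (direct sum of $q$ copies). *)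

theory Defs
  imports
    "HOL-Algebra.Module"
    "HOL-Algebra.Subrings"
    "HOL-Algebra.Free_Abelian_Groups"
    "Jordan_Normal_Form.Matrix"
begin

section \<open>Modules and bimodules over a noncommutative ring\<close>

text \<open>As in the library's record of left modules, a module extends the record of rings, of which
  only the fields for the carrier, zero and addition are meaningful.

  The action is a function on the whole type of ring elements. Hence the restriction of a module
  \<open>M\<close> over \<open>A\<close> to a subring \<open>B\<close> is the same record \<open>M\<close>, regarded as a module over
  \<open>A\<lparr>carrier := B\<rparr>\<close>.\<close>

record ('r, 'm) rmodule = "'m ring" +
  ract :: "'m \<Rightarrow> 'r \<Rightarrow> 'm" (infixl \<open>\<lhd>\<index>\<close> 70)

record ('r, 'm) bimodule = "('r, 'm) rmodule" +
  lact :: "'r \<Rightarrow> 'm \<Rightarrow> 'm" (infixr \<open>\<rhd>\<index>\<close> 70)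

locale right_module = R?: ring R + M?: abelian_group M
  for R :: "('r, 'x) ring_scheme" (structure) and M :: "('r, 'm, 'y) rmodule_scheme" (structure) +
  assumes ract_closed: "\<lbrakk>x \<in> carrier M; a \<in> carrier R\<rbrakk> \<Longrightarrow> x \<lhd>\<^bsub>M\<^esub> a \<in> carrier M"
    and ract_add: "\<lbrakk>x \<in> carrier M; y \<in> carrier M; a \<in> carrier R\<rbrakk> \<Longrightarrow>
      (x \<oplus>\<^bsub>M\<^esub> y) \<lhd>\<^bsub>M\<^esub> a = x \<lhd>\<^bsub>M\<^esub> a \<oplus>\<^bsub>M\<^esub> y \<lhd>\<^bsub>M\<^esub> a"
    and ract_add_scalar: "\<lbrakk>x \<in> carrier M; a \<in> carrier R; b \<in> carrier R\<rbrakk> \<Longrightarrow>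
      x \<lhd>\<^bsub>M\<^esub> (a \<oplus>\<^bsub>R\<^esub> b) = x \<lhd>\<^bsub>M\<^esub> a \<oplus>\<^bsub>M\<^esub> x \<lhd>\<^bsub>M\<^esub> b"
    and ract_mult: "\<lbrakk>x \<in> carrier M; a \<in> carrier R; b \<in> carrier R\<rbrakk> \<Longrightarrow>
      x \<lhd>\<^bsub>M\<^esub> (a \<otimes>\<^bsub>R\<^esub> b) = (x \<lhd>\<^bsub>M\<^esub> a) \<lhd>\<^bsub>M\<^esub> b"
    and ract_one: "x \<in> carrier M \<Longrightarrow> x \<lhd>\<^bsub>M\<^esub> \<one>\<^bsub>R\<^esub> = x"

definition rsubmodule :: "'m set \<Rightarrow> ('r, 'x) ring_scheme \<Rightarrow> ('r, 'm, 'y) rmodule_scheme \<Rightarrow> bool" where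
  "rsubmodule U R M \<longleftrightarrow>
     subgroup U (add_monoid M) \<and> (\<forall>u\<in>U. \<forall>a\<in>carrier R. u \<lhd>\<^bsub>M\<^esub> a \<in> U)"

definition bisubmodule :: "'m set \<Rightarrow> ('r, 'x) ring_scheme \<Rightarrow> ('r, 'm, 'y) bimodule_scheme \<Rightarrow> bool" where
  "bisubmodule U R M \<longleftrightarrow>
     rsubmodule U R M \<and> (\<forall>u\<in>U. \<forall>a\<in>carrier R. a \<rhd>\<^bsub>M\<^esub> u \<in> U)"

definition complementary :: "('m, 'y) ring_scheme \<Rightarrow> 'm set \<Rightarrow> 'm set \<Rightarrow> bool" where
  "complementary M U U' \<longleftrightarrow>
     U \<inter> U' = {\<zero>\<^bsub>M\<^esub>} \<and> carrier M = {u \<oplus>\<^bsub>M\<^esub> u' | u u'. u \<in> U \<and> u' \<in> U'}"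

definition rmod_hom ::
  "('r, 'x) ring_scheme \<Rightarrow> ('r, 'm, 'y) rmodule_scheme \<Rightarrow> ('r, 'n, 'z) rmodule_scheme \<Rightarrow> ('m \<Rightarrow> 'n) set"
  where
  "rmod_hom R M N = {h \<in> hom (add_monoid M) (add_monoid N).
     \<forall>x\<in>carrier M. \<forall>a\<in>carrier R. h (x \<lhd>\<^bsub>M\<^esub> a) = h x \<lhd>\<^bsub>N\<^esub> a}"

definition bimod_hom ::
  "('r, 'x) ring_scheme \<Rightarrow> ('r, 'm, 'y) bimodule_scheme \<Rightarrow> ('r, 'n, 'z) bimodule_scheme \<Rightarrow> ('m \<Rightarrow> 'n) set"
  where
  "bimod_hom R M N = {h \<in> rmod_hom R M N.
     \<forall>x\<in>carrier M. \<forall>a\<in>carrier R. h (a \<rhd>\<^bsub>M\<^esub> x) = a \<rhd>\<^bsub>N\<^esub> h x}"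

definition rmod_iso ::
  "('r, 'x) ring_scheme \<Rightarrow> ('r, 'm, 'y) rmodule_scheme \<Rightarrow> ('r, 'n, 'z) rmodule_scheme \<Rightarrow> bool"
  where
  "rmod_iso R M N \<longleftrightarrow> (\<exists>h\<in>rmod_hom R M N. bij_betw h (carrier M) (carrier N))"

definition bimod_iso ::
  "('r, 'x) ring_scheme \<Rightarrow> ('r, 'm, 'y) bimodule_scheme \<Rightarrow> ('r, 'n, 'z) bimodule_scheme \<Rightarrow> bool"
  where
  "bimod_iso R M N \<longleftrightarrow> (\<exists>h\<in>bimod_hom R M N. bij_betw h (carrier M) (carrier N))"

text \<open>The following are external direct sums for a finite index set \<open>I\<close> only.\<close>

definition rmod_dsum :: "'i set \<Rightarrow> ('i \<Rightarrow> ('r, 'm, 'y) rmodule_scheme) \<Rightarrow> ('r, 'i \<Rightarrow> 'm) rmodule" where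
  "rmod_dsum I N = \<lparr>carrier = (\<Pi>\<^sub>E i\<in>I. carrier (N i)),
     monoid.mult = undefined, one = undefined,
     ring.zero = (\<lambda>i\<in>I. \<zero>\<^bsub>N i\<^esub>), ring.add = (\<lambda>f g. \<lambda>i\<in>I. f i \<oplus>\<^bsub>N i\<^esub> g i),
     ract = (\<lambda>f a. \<lambda>i\<in>I. f i \<lhd>\<^bsub>N i\<^esub> a)\<rparr>"

definition bimod_dsum :: "'i set \<Rightarrow> ('i \<Rightarrow> ('r, 'm, 'y) bimodule_scheme) \<Rightarrow> ('r, 'i \<Rightarrow> 'm) bimodule" where
  "bimod_dsum I N = rmodule.extend (rmod_dsum I N)
     (bimodule.fields (\<lambda>a f. \<lambda>i\<in>I. a \<rhd>\<^bsub>N i\<^esub> f i))"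

definition iso_to_bimod_summand ::
  "('r, 'x) ring_scheme \<Rightarrow> ('r, 'm, 'y) bimodule_scheme \<Rightarrow> ('r, 'n, 'z) bimodule_scheme \<Rightarrow> bool"
  where
  "iso_to_bimod_summand R M D \<longleftrightarrow>
     (\<exists>U U'. bisubmodule U R D \<and> bisubmodule U' R D \<and> complementary D U U' \<and>
        bimod_iso R M (D\<lparr>carrier := U\<rparr>))"

section \<open>Simple modules and semisimple algebras\<close>

definition simple_rmodule :: "('r, 'x) ring_scheme \<Rightarrow> ('r, 'm, 'y) rmodule_scheme \<Rightarrow> bool" where
  "simple_rmodule R M \<longleftrightarrow> right_module R M \<and> carrier M \<noteq> {\<zero>\<^bsub>M\<^esub>} \<and>
     (\<forall>U. rsubmodule U R M \<longrightarrow> U = {\<zero>\<^bsub>M\<^esub>} \<or> U = carrier M)"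

text \<open>The modules \<open>V 0, \<dots>, V (s - 1)\<close> form a complete irredundant list of simple right modules.
  A simple module is isomorphic to \<open>R / I\<close> for a right ideal \<open>I\<close>, whose elements are cosets in
  \<open>R\<close>; so completeness need only be demanded for simple modules with carrier in the type
  \<open>'r set\<close>.\<close>

definition simple_reps :: "('r, 'x) ring_scheme \<Rightarrow> nat \<Rightarrow> (nat \<Rightarrow> ('r, 'v) rmodule) \<Rightarrow> bool" where
  "simple_reps R s V \<longleftrightarrow>
     (\<forall>j<s. simple_rmodule R (V j)) \<and>
     (\<forall>j<s. \<forall>k<s. rmod_iso R (V j) (V k) \<longrightarrow> j = k) \<and>
     (\<forall>U :: ('r, 'r set) rmodule. simple_rmodule R U \<longrightarrow> (\<exists>j<s. rmod_iso R U (V j)))"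

definition regular_rmodule :: "('r, 'x) ring_scheme \<Rightarrow> ('r, 'r) rmodule" where
  "regular_rmodule R = \<lparr>carrier = carrier R, monoid.mult = undefined, one = undefined,
     ring.zero = \<zero>\<^bsub>R\<^esub>, ring.add = ring.add R, ract = monoid.mult R\<rparr>"

definition semisimple_ring :: "('r, 'x) ring_scheme \<Rightarrow> bool" where
  "semisimple_ring R \<longleftrightarrow> ring R \<and>
     (\<forall>U. rsubmodule U R (regular_rmodule R) \<longrightarrow>
        (\<exists>U'. rsubmodule U' R (regular_rmodule R) \<and> complementary (regular_rmodule R) U U'))"

definition complex_ring :: "complex ring" where
  "complex_ring = \<lparr>carrier = UNIV, monoid.mult = (*), one = 1, ring.zero = 0, ring.add = (+)\<rparr>"

text \<open>The library's locale \<open>algebra\<close> is restricted to commutative algebras.\<close>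

locale complex_algebra = A?: ring A + complex_vs?: module complex_ring A
  for A :: "(complex, 'a, 'x) module_scheme" (structure) +
  assumes smult_mult_left: "\<lbrakk>x \<in> carrier A; y \<in> carrier A\<rbrakk> \<Longrightarrow>
      (c \<odot>\<^bsub>A\<^esub> x) \<otimes>\<^bsub>A\<^esub> y = c \<odot>\<^bsub>A\<^esub> (x \<otimes>\<^bsub>A\<^esub> y)"
    and smult_mult_right: "\<lbrakk>x \<in> carrier A; y \<in> carrier A\<rbrakk> \<Longrightarrow>
      x \<otimes>\<^bsub>A\<^esub> (c \<odot>\<^bsub>A\<^esub> y) = c \<odot>\<^bsub>A\<^esub> (x \<otimes>\<^bsub>A\<^esub> y)"

definition finite_dim :: "(complex, 'a, 'x) module_scheme \<Rightarrow> bool" where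
  "finite_dim A \<longleftrightarrow> (\<exists>X. finite X \<and> X \<subseteq> carrier A \<and>
     (\<forall>y\<in>carrier A. \<exists>c. y = (\<Oplus>\<^bsub>A\<^esub>x\<in>X. c x \<odot>\<^bsub>A\<^esub> x)))"

definition fd_semisimple_algebra :: "(complex, 'a, 'x) module_scheme \<Rightarrow> bool" where
  "fd_semisimple_algebra A \<longleftrightarrow> complex_algebra A \<and> finite_dim A \<and> semisimple_ring A"

text \<open>A \<open>subring\<close> contains the unit element of the ambient ring.\<close>

definition complex_subalgebra :: "'a set \<Rightarrow> (complex, 'a, 'x) module_scheme \<Rightarrow> bool" where
  "complex_subalgebra B A \<longleftrightarrow> subring B A \<and> (\<forall>c. \<forall>b\<in>B. c \<odot>\<^bsub>A\<^esub> b \<in> B)"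

text \<open>The entry of \<open>M\<close> at \<open>(i, j)\<close> is the multiplicity of \<open>W i\<close> in the restriction of \<open>V j\<close>
  to \<open>B\<close>: for every \<open>j\<close>, the restriction is the direct sum over \<open>i\<close> of \<open>M $$ (i, j)\<close> copies of
  \<open>W i\<close>.\<close>

definition inclusion_matrix ::
  "('a, 'x) ring_scheme \<Rightarrow> 'a set \<Rightarrow> nat \<Rightarrow> (nat \<Rightarrow> ('a, 'w) rmodule) \<Rightarrow>
   nat \<Rightarrow> (nat \<Rightarrow> ('a, 'v) rmodule) \<Rightarrow> nat mat \<Rightarrow> bool" where
  "inclusion_matrix A B r W s V M \<longleftrightarrow>
     simple_reps A s V \<and> simple_reps (A\<lparr>carrier := B\<rparr>) r W \<and> M \<in> carrier_mat r s \<and>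
     (\<forall>j<s. rmod_iso (A\<lparr>carrier := B\<rparr>) (V j)
        (rmod_dsum (SIGMA i:{..<r}. {..<M $$ (i, j)}) (\<lambda>(i, k). W i)))"

section \<open>Tensor powers over a subring and H-depth\<close>

text \<open>The \<open>n\<close>-fold tensor product \<open>A \<otimes>\<^sub>B \<dots> \<otimes>\<^sub>B A\<close> for \<open>n \<ge> 1\<close>: the free abelian group on the
  \<open>n\<close>-tuples of elements of \<open>A\<close> modulo additivity in each position and
  \<open>(\<dots>, x b, y, \<dots>) = (\<dots>, x, b y, \<dots>)\<close> for \<open>b \<in> B\<close>.\<close>

definition tuples :: "('a, 'x) ring_scheme \<Rightarrow> nat \<Rightarrow> 'a list set" where
  "tuples A n = {w. length w = n \<and> set w \<subseteq> carrier A}"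

definition tensor_relators :: "('a, 'x) ring_scheme \<Rightarrow> 'a set \<Rightarrow> nat \<Rightarrow> ('a list \<Rightarrow>\<^sub>0 int) set" where
  "tensor_relators A B n =
     {frag_of (w[i := x \<oplus>\<^bsub>A\<^esub> y]) - frag_of (w[i := x]) - frag_of (w[i := y]) | w i x y.
        w \<in> tuples A n \<and> i < n \<and> x \<in> carrier A \<and> y \<in> carrier A} \<union>
     {frag_of (w[i := w ! i \<otimes>\<^bsub>A\<^esub> b]) - frag_of (w[Suc i := b \<otimes>\<^bsub>A\<^esub> w ! Suc i]) | w i b.
        w \<in> tuples A n \<and> Suc i < n \<and> b \<in> B}"

definition tensor_kernel :: "('a, 'x) ring_scheme \<Rightarrow> 'a set \<Rightarrow> nat \<Rightarrow> ('a list \<Rightarrow>\<^sub>0 int) set" where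
  "tensor_kernel A B n = generate (free_Abelian_group (tuples A n)) (tensor_relators A B n)"

text \<open>The map that \<open>f\<close> on \<open>n\<close>-tuples induces on cosets of the kernel \<open>K\<close>: the image of \<open>X\<close> under
  the linear extension of \<open>f\<close> lies in a single coset, which is recovered by adding \<open>K\<close>.\<close>

definition tensor_map ::
  "('a, 'x) ring_scheme \<Rightarrow> 'a set \<Rightarrow> nat \<Rightarrow> ('a list \<Rightarrow> 'a list) \<Rightarrow>
   ('a list \<Rightarrow>\<^sub>0 int) set \<Rightarrow> ('a list \<Rightarrow>\<^sub>0 int) set" where
  "tensor_map A B n f X =
     tensor_kernel A B n <#>\<^bsub>free_Abelian_group (tuples A n)\<^esub> (frag_extend (\<lambda>w. frag_of (f w)) ` X)"

definition tensor_power ::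
  "('a, 'x) ring_scheme \<Rightarrow> 'a set \<Rightarrow> nat \<Rightarrow> ('a, ('a list \<Rightarrow>\<^sub>0 int) set) bimodule" where
  "tensor_power A B n =
     (let Q = free_Abelian_group (tuples A n) Mod tensor_kernel A B n in
      \<lparr>carrier = carrier Q, monoid.mult = undefined, one = undefined,
       ring.zero = \<one>\<^bsub>Q\<^esub>, ring.add = monoid.mult Q,
       ract = (\<lambda>X a. tensor_map A B n (\<lambda>w. w[n - 1 := w ! (n - 1) \<otimes>\<^bsub>A\<^esub> a]) X),
       lact = (\<lambda>a X. tensor_map A B n (\<lambda>w. w[0 := a \<otimes>\<^bsub>A\<^esub> w ! 0]) X)\<rparr>)"

text \<open>The property of having H-depth \<open>2 n - 1\<close>, meaningful for \<open>n \<ge> 1\<close>.\<close>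

definition has_H_depth_odd :: "('a, 'x) ring_scheme \<Rightarrow> 'a set \<Rightarrow> nat \<Rightarrow> bool" where
  "has_H_depth_odd A B n \<longleftrightarrow>
     (\<exists>q>0. iso_to_bimod_summand A (tensor_power A B (n + 1))
        (bimod_dsum {..<q::nat} (\<lambda>_. tensor_power A B n)))"

end

theory Submission
  imports Defs "Jordan_Normal_Form.Spectral_Radius"
begin

text \<open>A matrix of natural numbers is bounded by a multiple of another one iff its support is contained
  in the other support.  So the inequality \<open>S\<^sup>n \<le> q S\<^sup>n\<^sup>-\<^sup>1\<close> only says which simple \<open>A\<close>-\<open>A\<close>-bimodules
  occur in the tensor powers, and no multiplicity has to be computed.

  The simple right \<open>A\<close>-modules are \<open>e\<^sub>i A\<close> for idempotents \<open>e\<^sub>i\<close> with \<open>e\<^sub>i A e\<^sub>i = \<complex> e\<^sub>i\<close> (Schur's lemma),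
  \<open>e\<^sub>i A e\<^sub>j = 0\<close> for \<open>i \<noteq> j\<close>, and \<open>A \<epsilon> A = A\<close> for \<open>\<epsilon> = \<Sum>\<^sub>i e\<^sub>i\<close> (\<open>ex_corner_system\<close>).  The same holds for
  \<open>B\<close>, with idempotents \<open>p\<^sub>k\<close>.

  By Morita theory a bimodule \<open>D\<close> is determined by its corner \<open>\<epsilon> D \<epsilon>\<close>, which splits into the
  multiplicity spaces \<open>e\<^sub>i D e\<^sub>j\<close> of the simple bimodules.  For finite-dimensional bimodules, \<open>D\<close> is
  therefore isomorphic to a direct summand of a multiple of \<open>D'\<close> iff \<open>e\<^sub>i D e\<^sub>j \<noteq> 0\<close> implies
  \<open>e\<^sub>i D' e\<^sub>j \<noteq> 0\<close> (\<open>iso_to_bimod_summand_iff_corners\<close>): in one direction an embedding restricts to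
  the corners, and in the other the identity of \<open>D\<close> is written as a sum of maps that factor through
  \<open>D'\<close> and have rank one on the corners.

  It remains to decide when \<open>e\<^sub>i C\<^sub>n(A,B) e\<^sub>j\<close> is nonzero.  Expanding \<open>\<one>\<close> in \<open>\<Sum>\<^sub>k B p\<^sub>k B\<close> at every
  tensor sign shows that this requires a sequence \<open>k\<^sub>1, \<dots>, k\<^sub>m\<close>, where \<open>m = n - 1\<close>, such that
  \<open>e\<^sub>i A p\<^sub>k\<^sub>1\<close>, \<open>p\<^sub>k\<^sub>1 A p\<^sub>k\<^sub>2\<close>, \<open>\<dots>\<close>, \<open>p\<^sub>k\<^sub>m A e\<^sub>j\<close> are all nonzero.  Conversely, a tensor with nonzero
  entries from these spaces is nonzero, since suitable right \<open>B\<close>-linear maps \<open>A \<rightarrow> A\<close> contract its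
  tensor signs one by one down to the last entry (\<open>tensor_power_corner_nonzero_iff\<close>).  As
  \<open>e\<^sub>i A p\<^sub>k\<close> and \<open>p\<^sub>k A e\<^sub>i\<close> are nonzero iff the entry of \<open>M\<close> at \<open>(k, i)\<close> is, such sequences exist
  iff the entry of \<open>S\<^sup>n\<^sup>-\<^sup>1\<close> at \<open>(i, j)\<close> is nonzero (\<open>reaches_iff_power_entry\<close>).\<close>

section \<open>Finite sums and additive maps\<close>

abbreviation additive_maps :: "('m, 'y) ring_scheme \<Rightarrow> ('n, 'z) ring_scheme \<Rightarrow> ('m \<Rightarrow> 'n) set" where
  "additive_maps M N \<equiv> hom (add_monoid M) (add_monoid N)"

lemma additive_mapsI:
  assumes "\<And>x. x \<in> carrier M \<Longrightarrow> T x \<in> carrier N"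
    and "\<And>x y. \<lbrakk>x \<in> carrier M; y \<in> carrier M\<rbrakk> \<Longrightarrow> T (x \<oplus>\<^bsub>M\<^esub> y) = T x \<oplus>\<^bsub>N\<^esub> T y"
  shows "T \<in> additive_maps M N"
  using assms by (simp add: hom_def)

lemma additive_closed: "\<lbrakk>T \<in> additive_maps M N; x \<in> carrier M\<rbrakk> \<Longrightarrow> T x \<in> carrier N"
  by (auto simp: hom_def)

lemma additive_add:
  "\<lbrakk>T \<in> additive_maps M N; x \<in> carrier M; y \<in> carrier M\<rbrakk> \<Longrightarrow> T (x \<oplus>\<^bsub>M\<^esub> y) = T x \<oplus>\<^bsub>N\<^esub> T y"
  by (auto simp: hom_def)

lemma additive_zero:
  assumes "abelian_group M" "abelian_group N" "T \<in> additive_maps M N"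
  shows "T \<zero>\<^bsub>M\<^esub> = \<zero>\<^bsub>N\<^esub>"
proof -
  interpret M: abelian_group M by fact
  interpret N: abelian_group N by fact
  interpret group_hom "add_monoid M" "add_monoid N" T
    using assms(3) by (simp add: group_hom_def group_hom_axioms_def M.a_group N.a_group)
  show ?thesis using hom_one by simp
qed

lemma additive_minus:
  assumes "abelian_group M" "abelian_group N" "T \<in> additive_maps M N" "x \<in> carrier M"
  shows "T (\<ominus>\<^bsub>M\<^esub> x) = \<ominus>\<^bsub>N\<^esub> T x"
proof -
  interpret M: abelian_group M by fact
  interpret N: abelian_group N by fact
  interpret group_hom "add_monoid M" "add_monoid N" T
    using assms(3) by (simp add: group_hom_def group_hom_axioms_def M.a_group N.a_group)
  show ?thesis using hom_inv[of x] assms(4) by (simp add: a_inv_def)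
qed

lemma additive_comp:
  "\<lbrakk>T \<in> additive_maps M N; U \<in> additive_maps N L\<rbrakk> \<Longrightarrow> (\<lambda>x. U (T x)) \<in> additive_maps M L"
  by (auto simp: hom_def Pi_iff)

lemma additive_finsum:
  assumes "abelian_group M" "abelian_group N" "T \<in> additive_maps M N" "f \<in> I \<rightarrow> carrier M"
  shows "T (finsum M f I) = finsum N (\<lambda>i. T (f i)) I"
proof -
  interpret M: abelian_group M by fact
  interpret N: abelian_group N by fact
  note T = additive_closed[OF assms(3)] additive_add[OF assms(3)]
  show ?thesis
    using assms(4)
  proof (induction I rule: infinite_finite_induct)
    case (insert i I)
    then have "(\<lambda>i. T (f i)) \<in> I \<rightarrow> carrier N" by (auto simp: T Pi_iff)
    with insert show ?case by (simp add: T Pi_iff)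
  qed (simp_all add: additive_zero[OF assms(1-3)])
qed

lemma additive_finsum_maps:
  assumes "abelian_group M" "abelian_group N" "\<And>i. i \<in> I \<Longrightarrow> T i \<in> additive_maps M N"
  shows "(\<lambda>x. finsum N (\<lambda>i. T i x) I) \<in> additive_maps M N"
proof -
  interpret M: abelian_group M by fact
  interpret N: abelian_group N by fact
  note T = additive_closed[OF assms(3)] additive_add[OF assms(3)]
  show ?thesis
  proof (rule additive_mapsI)
    fix x y assume xy: "x \<in> carrier M" "y \<in> carrier M"
    have "(\<Oplus>\<^bsub>N\<^esub>i\<in>I. T i (x \<oplus>\<^bsub>M\<^esub> y)) = (\<Oplus>\<^bsub>N\<^esub>i\<in>I. T i x \<oplus>\<^bsub>N\<^esub> T i y)"
      by (rule N.finsum_cong') (use xy in \<open>auto simp: T\<close>)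
    also have "\<dots> = (\<Oplus>\<^bsub>N\<^esub>i\<in>I. T i x) \<oplus>\<^bsub>N\<^esub> (\<Oplus>\<^bsub>N\<^esub>i\<in>I. T i y)"
      by (rule N.finsum_addf) (use xy in \<open>auto simp: T\<close>)
    finally show "(\<Oplus>\<^bsub>N\<^esub>i\<in>I. T i (x \<oplus>\<^bsub>M\<^esub> y)) = (\<Oplus>\<^bsub>N\<^esub>i\<in>I. T i x) \<oplus>\<^bsub>N\<^esub> (\<Oplus>\<^bsub>N\<^esub>i\<in>I. T i y)" .
  qed (use T in auto)
qed

lemma (in abelian_group) finsum_swap:
  assumes "finite I" "finite J" "\<And>i j. \<lbrakk>i \<in> I; j \<in> J\<rbrakk> \<Longrightarrow> f i j \<in> carrier G"
  shows "(\<Oplus>i\<in>I. \<Oplus>j\<in>J. f i j) = (\<Oplus>j\<in>J. \<Oplus>i\<in>I. f i j)"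
  using assms(1,3)
proof (induction I)
  case (insert i I)
  have "(\<Oplus>j\<in>J. \<Oplus>i\<in>insert i I. f i j) = (\<Oplus>j\<in>J. f i j \<oplus> (\<Oplus>i\<in>I. f i j))"
    using insert by (intro finsum_cong') (auto simp: Pi_iff)
  also have "\<dots> = (\<Oplus>j\<in>J. f i j) \<oplus> (\<Oplus>j\<in>J. \<Oplus>i\<in>I. f i j)"
    using insert by (intro finsum_addf) (auto simp: Pi_iff)
  finally show ?case using insert by (simp add: Pi_iff)
qed simp

lemma (in abelian_group) finsum_nonzero:
  assumes "(\<Oplus>i\<in>I. f i) \<noteq> \<zero>"
  obtains i where "i \<in> I" "f i \<noteq> \<zero>"
  using assms add.finprod_one_eqI[of I f] by (auto simp: finsum_def)

lemma (in abelian_group) finsum_delta: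
  assumes "finite I" "i \<in> I" "f i \<in> carrier G"
    and "\<And>j. \<lbrakk>j \<in> I; j \<noteq> i\<rbrakk> \<Longrightarrow> f j = \<zero>"
  shows "(\<Oplus>j\<in>I. f j) = f i"
proof -
  have "(\<Oplus>j\<in>I. f j) = (\<Oplus>j\<in>I. if i = j then f j else \<zero>)"
    using assms by (intro finsum_cong') auto
  also have "\<dots> = (\<Oplus>j\<in>I. if i = j then f i else \<zero>)"
    using assms by (intro finsum_cong') auto
  also have "\<dots> = f i"
    using assms by (intro finsum_singleton) auto
  finally show ?thesis .
qed

lemma finsum_subcarrier:
  assumes "abelian_group M" "abelian_group (M\<lparr>carrier := U\<rparr>)" "U \<subseteq> carrier M" "f \<in> I \<rightarrow> U"
  shows "finsum (M\<lparr>carrier := U\<rparr>) f I = finsum M f I"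
proof -
  have "(\<lambda>x. x) \<in> additive_maps (M\<lparr>carrier := U\<rparr>) M"
    using assms(3) by (intro additive_mapsI) auto
  from additive_finsum[OF assms(2,1) this, of f I] assms(4) show ?thesis
    by simp
qed

section \<open>Finite-dimensional complex vector spaces\<close>

lemma complex_ring_simps [simp]:
  "carrier complex_ring = UNIV" "x \<oplus>\<^bsub>complex_ring\<^esub> y = x + y"
  "x \<otimes>\<^bsub>complex_ring\<^esub> y = x * y" "\<zero>\<^bsub>complex_ring\<^esub> = 0" "\<one>\<^bsub>complex_ring\<^esub> = 1"
  by (simp_all add: complex_ring_def)

lemma cring_complex_ring: "cring complex_ring"
proof (rule cringI)
  show "abelian_group complex_ring"
    by (rule abelian_groupI) (auto simp: algebra_simps intro: exI[of _ "- _"])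
  show "Group.comm_monoid complex_ring"
    by (rule comm_monoidI) (auto simp: algebra_simps)
qed (auto simp: algebra_simps)

lemma finsum_complex_ring: "finite I \<Longrightarrow> finsum complex_ring f I = sum f I"
proof (induction I rule: finite_induct)
  interpret cring complex_ring by (rule cring_complex_ring)
  case empty then show ?case by simp
next
  interpret cring complex_ring by (rule cring_complex_ring)
  case (insert i I) then show ?case by (subst finsum_insert) auto
qed

locale complex_vector_space = module complex_ring V
  for V :: "(complex, 'v, 'y) module_scheme" (structure)
begin

lemma smult_minus_one: "v \<in> carrier V \<Longrightarrow> (-1) \<odot> v = \<ominus> v"
proof (rule M.minus_equality[symmetric])
  assume v: "v \<in> carrier V"
  have "(-1) \<odot> v \<oplus> v = (-1) \<odot> v \<oplus> 1 \<odot> v" using smult_one[OF _] v by simp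
  also have "\<dots> = (-1 + 1) \<odot> v" using smult_l_distr[of "-1" 1 v] v by simp
  also have "\<dots> = \<zero>" using smult_l_null[OF v] by simp
  finally show "(-1) \<odot> v \<oplus> v = \<zero>" .
qed auto

definition linear_form :: "('v \<Rightarrow> complex) \<Rightarrow> bool" where
  "linear_form \<phi> \<longleftrightarrow> (\<forall>x\<in>carrier V. \<forall>y\<in>carrier V. \<phi> (x \<oplus> y) = \<phi> x + \<phi> y) \<and>
     (\<forall>c. \<forall>x\<in>carrier V. \<phi> (c \<odot> x) = c * \<phi> x)"

lemma linear_formD:
  assumes "linear_form \<phi>"
  shows "\<lbrakk>x \<in> carrier V; y \<in> carrier V\<rbrakk> \<Longrightarrow> \<phi> (x \<oplus> y) = \<phi> x + \<phi> y"
    and "x \<in> carrier V \<Longrightarrow> \<phi> (c \<odot> x) = c * \<phi> x"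
  using assms by (auto simp: linear_form_def)

lemma linear_form_finsum:
  assumes "linear_form \<phi>" "finite I" "f \<in> I \<rightarrow> carrier V"
  shows "\<phi> (\<Oplus>i\<in>I. f i) = (\<Sum>i\<in>I. \<phi> (f i))"
  using additive_finsum[of V complex_ring \<phi> f I] assms M.abelian_group_axioms
    R.abelian_group_axioms
  by (simp add: hom_def linear_form_def finsum_complex_ring)

lemma linear_form_zero: "linear_form \<phi> \<Longrightarrow> \<phi> \<zero> = 0"
  using linear_formD(2)[of \<phi> \<zero> 0] by simp

lemma linear_combination_add:
  assumes "X \<subseteq> carrier V"
  shows "(\<Oplus>x\<in>X. (c x + d x) \<odot> x) = (\<Oplus>x\<in>X. c x \<odot> x) \<oplus> (\<Oplus>x\<in>X. d x \<odot> x)"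
proof -
  have "(\<Oplus>x\<in>X. (c x + d x) \<odot> x) = (\<Oplus>x\<in>X. c x \<odot> x \<oplus> d x \<odot> x)"
    using assms smult_l_distr by (intro M.finsum_cong') auto
  also have "\<dots> = (\<Oplus>x\<in>X. c x \<odot> x) \<oplus> (\<Oplus>x\<in>X. d x \<odot> x)"
    using assms by (intro M.finsum_addf) auto
  finally show ?thesis .
qed

lemma additive_smult: "(\<lambda>x. c \<odot> x) \<in> additive_maps V V"
  using smult_r_distr by (intro additive_mapsI) auto

lemma linear_combination_smult:
  assumes "X \<subseteq> carrier V"
  shows "(\<Oplus>x\<in>X. (c * d x) \<odot> x) = c \<odot> (\<Oplus>x\<in>X. d x \<odot> x)"
proof -
  have "(\<Oplus>x\<in>X. (c * d x) \<odot> x) = (\<Oplus>x\<in>X. c \<odot> (d x \<odot> x))"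
    using assms smult_assoc1 by (intro M.finsum_cong') auto
  also have "\<dots> = c \<odot> (\<Oplus>x\<in>X. d x \<odot> x)"
    using assms additive_finsum[OF _ _ additive_smult, of "\<lambda>x. d x \<odot> x" X c] M.abelian_group_axioms
    by fastforce
  finally show ?thesis .
qed

definition basis_with_coordinates :: "'v set \<Rightarrow> ('v \<Rightarrow> 'v \<Rightarrow> complex) \<Rightarrow> bool" where
  "basis_with_coordinates X \<phi> \<longleftrightarrow> finite X \<and> X \<subseteq> carrier V \<and> (\<forall>x\<in>X. linear_form (\<phi> x)) \<and>
     (\<forall>v\<in>carrier V. v = (\<Oplus>x\<in>X. \<phi> x v \<odot> x)) \<and>
     (\<forall>x\<in>X. \<forall>y\<in>X. \<phi> x y = (if x = y then 1 else 0))"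

text \<open>In a spanning set of least cardinality, coefficients are unique: two expansions of the same
  vector would express one of its elements by the others.  Uniqueness makes each coefficient a
  linear form.\<close>

lemma ex_basis_with_coordinates:
  assumes "finite_dim V"
  shows "\<exists>X \<phi>. basis_with_coordinates X \<phi>"
proof -
  define spans where "spans = (\<lambda>X. finite X \<and> X \<subseteq> carrier V \<and>
     (\<forall>y\<in>carrier V. \<exists>c. y = (\<Oplus>x\<in>X. c x \<odot> x)))"
  have "\<exists>X. spans X"
    using assms by (simp add: finite_dim_def spans_def)
  then obtain X where X: "spans X" and least: "\<And>Y. spans Y \<Longrightarrow> card X \<le> card Y"
    using exists_least_iff[of "\<lambda>n. \<exists>X. spans X \<and> card X = n"] by (metis leI)
  have fin: "finite X" and sub: "X \<subseteq> carrier V" using X by (auto simp: spans_def)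
  have independent: "c x = 0" if x: "x \<in> X" and c: "(\<Oplus>x\<in>X. c x \<odot> x) = \<zero>" for c x
  proof (rule ccontr)
    assume nz: "c x \<noteq> 0"
    define Y where "Y = X - {x}"
    have Y: "finite Y" "Y \<subseteq> carrier V" "X = insert x Y" "x \<notin> Y" "x \<in> carrier V"
      using fin sub x by (auto simp: Y_def)
    have "\<exists>d. y = (\<Oplus>x\<in>Y. d x \<odot> x)" if y: "y \<in> carrier V" for y
    proof -
      obtain d where d: "y = (\<Oplus>x\<in>X. d x \<odot> x)" using X y by (auto simp: spans_def)
      \<comment> \<open>Subtracting a multiple of the relation \<open>c\<close> removes \<open>x\<close> from the expansion of \<open>y\<close>.\<close>
      define d' where "d' = (\<lambda>z. d z + (- (d x / c x)) * c z)"
      have "(\<Oplus>z\<in>X. d' z \<odot> z) = (\<Oplus>z\<in>X. d z \<odot> z) \<oplus> (- (d x / c x)) \<odot> (\<Oplus>z\<in>X. c z \<odot> z)"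
        unfolding d'_def using sub by (simp only: linear_combination_add linear_combination_smult)
      then have "y = (\<Oplus>z\<in>X. d' z \<odot> z)" using d y by (simp add: c)
      also have "\<dots> = d' x \<odot> x \<oplus> (\<Oplus>z\<in>Y. d' z \<odot> z)"
        using Y by (simp add: Pi_iff subset_iff)
      also have "\<dots> = (\<Oplus>z\<in>Y. d' z \<odot> z)"
        using Y nz smult_l_null[of x] by (simp add: d'_def Pi_iff subset_iff)
      finally show ?thesis by blast
    qed
    then have "spans Y" using Y by (simp add: spans_def)
    from least[OF this] Y show False by simp
  qed
  have unique: "c x = d x" if x: "x \<in> X" and e: "(\<Oplus>x\<in>X. c x \<odot> x) = (\<Oplus>x\<in>X. d x \<odot> x)" for c d x
  proof -
    have "(\<Oplus>x\<in>X. (c x + (-1) * d x) \<odot> x) = (\<Oplus>x\<in>X. (1 + (-1)) * d x \<odot> x)"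
      using sub e by (simp only: linear_combination_add linear_combination_smult distrib_right mult_1)
    also have "\<dots> = \<zero>"
      using sub smult_l_null by (intro M.add.finprod_one_eqI[unfolded finsum_def[symmetric]]) auto
    finally show ?thesis using independent[OF x, of "\<lambda>x. c x + (-1) * d x"] by simp
  qed
  define coeffs where "coeffs = (\<lambda>v. SOME c. v = (\<Oplus>x\<in>X. c x \<odot> x))"
  define \<phi> where "\<phi> = (\<lambda>x v. coeffs v x)"
  have \<phi>: "v = (\<Oplus>x\<in>X. \<phi> x v \<odot> x)" if "v \<in> carrier V" for v
  proof -
    have "\<exists>c. v = (\<Oplus>x\<in>X. c x \<odot> x)" using X that by (simp add: spans_def)
    then show ?thesis unfolding \<phi>_def coeffs_def by (rule someI_ex)
  qed
  have \<phi>_eqI: "\<phi> x v = c x" if "v = (\<Oplus>x\<in>X. c x \<odot> x)" "v \<in> carrier V" "x \<in> X" for x v c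
    using unique[of x "\<lambda>x. \<phi> x v" c] that \<phi>[of v] by simp
  have "linear_form (\<phi> x)" if x: "x \<in> X" for x
    unfolding linear_form_def
  proof (intro conjI ballI allI)
    fix v w assume vw: "v \<in> carrier V" "w \<in> carrier V"
    show "\<phi> x (v \<oplus> w) = \<phi> x v + \<phi> x w"
      using vw x \<phi> sub by (intro \<phi>_eqI) (auto simp: linear_combination_add)
  next
    fix c v assume v: "v \<in> carrier V"
    show "\<phi> x (c \<odot> v) = c * \<phi> x v"
      using v x \<phi> sub by (intro \<phi>_eqI) (auto simp: linear_combination_smult)
  qed
  note lin = this
  have delta: "\<phi> x y = (if x = y then 1 else 0)" if xy: "x \<in> X" "y \<in> X" for x y
  proof (rule \<phi>_eqI)
    have "(\<Oplus>x\<in>X. (if x = y then 1 else 0) \<odot> x) = (\<Oplus>x\<in>X. if y = x then x else \<zero>)"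
      using sub smult_one smult_l_null by (intro M.finsum_cong') auto
    also have "\<dots> = y"
      using fin sub xy M.finsum_singleton[of y X "\<lambda>x. x"] by (simp add: Pi_iff subset_iff)
    finally show "y = (\<Oplus>x\<in>X. (if x = y then 1 else 0) \<odot> x)" by simp
  qed (use xy sub in auto)
  have "basis_with_coordinates X \<phi>"
    unfolding basis_with_coordinates_def
    by (intro conjI ballI fin sub lin delta; (rule \<phi>; assumption)?)
  then show ?thesis by blast
qed

lemma ex_separating_linear_form:
  assumes "finite_dim V" "v \<in> carrier V" "v \<noteq> \<zero>"
  obtains \<phi> where "linear_form \<phi>" "\<phi> v = 1"
proof -
  obtain X \<phi> where X: "basis_with_coordinates X \<phi>"
    using ex_basis_with_coordinates[OF assms(1)] by blast
  then have "(\<Oplus>x\<in>X. \<phi> x v \<odot> x) \<noteq> \<zero>"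
    using assms unfolding basis_with_coordinates_def by metis
  then obtain x where x: "x \<in> X" "\<phi> x v \<odot> x \<noteq> \<zero>" by (rule M.finsum_nonzero)
  have nz: "\<phi> x v \<noteq> 0"
    using x X smult_l_null[of x] by (auto simp: basis_with_coordinates_def)
  have "linear_form (\<phi> x)" using X x by (simp add: basis_with_coordinates_def)
  then have "linear_form (\<lambda>w. \<phi> x w / \<phi> x v)"
    by (simp add: linear_form_def add_divide_distrib)
  then show thesis using nz that by simp
qed

text \<open>The matrix of the endomorphism in a basis has an eigenvector over the complex numbers.\<close>

lemma ex_eigenvector:
  assumes "finite_dim V" "carrier V \<noteq> {\<zero>}"
    and T: "T \<in> additive_maps V V" "\<And>c v. v \<in> carrier V \<Longrightarrow> T (c \<odot> v) = c \<odot> T v"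
  obtains k v where "v \<in> carrier V" "v \<noteq> \<zero>" "T v = k \<odot> v"
proof -
  obtain X \<phi> where "basis_with_coordinates X \<phi>"
    using ex_basis_with_coordinates[OF assms(1)] by blast
  then have X: "finite X" "X \<subseteq> carrier V" "\<And>x. x \<in> X \<Longrightarrow> linear_form (\<phi> x)"
      "\<And>v. v \<in> carrier V \<Longrightarrow> v = (\<Oplus>x\<in>X. \<phi> x v \<odot> x)"
      "\<And>x y. \<lbrakk>x \<in> X; y \<in> X\<rbrakk> \<Longrightarrow> \<phi> x y = (if x = y then 1 else 0)"
    unfolding basis_with_coordinates_def by blast+
  obtain xs where xs: "set xs = X" "distinct xs" using finite_distinct_list[OF X(1)] by blast
  define n where "n = length xs"
  have bij: "bij_betw ((!) xs) {0..<n} X"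
    using bij_betw_nth[OF xs(2), of "{0..<n}" X] xs(1) by (simp add: n_def atLeast0LessThan)
  have mem: "xs ! i \<in> X" if "i < n" for i using that xs by (simp add: n_def flip: xs(1))
  have "X \<noteq> {}"
  proof
    assume "X = {}"
    then have "v = \<zero>" if "v \<in> carrier V" for v using X(4)[OF that] by (metis M.finsum_empty)
    then show False using assms(2) by blast
  qed
  then have "n > 0" using xs by (auto simp: n_def)
  define C where "C = mat n n (\<lambda>(i, j). \<phi> (xs ! i) (T (xs ! j)))"
  have C: "C \<in> carrier_mat n n" by (simp add: C_def)
  obtain k where "eigenvalue C k"
    using spectrum_non_empty[OF C \<open>n > 0\<close>] by (auto simp: spectrum_def)
  then obtain u where u: "u \<in> carrier_vec n" "u \<noteq> 0\<^sub>v n" "C *\<^sub>v u = k \<cdot>\<^sub>v u"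
    using C by (auto simp: eigenvalue_def eigenvector_def)
  define f where "f = (\<lambda>j. u $ j \<odot> xs ! j)"
  define v where "v = (\<Oplus>j\<in>{0..<n}. f j)"
  have f: "f \<in> {0..<n} \<rightarrow> carrier V" using mem X(2) by (auto simp: f_def subset_iff)
  have v: "v \<in> carrier V" unfolding v_def using f by (rule M.finsum_closed)
  have Tc: "T w \<in> carrier V" if "w \<in> carrier V" for w using additive_closed[OF T(1) that] .
  have coord: "\<phi> (xs ! i) v = u $ i" if i: "i < n" for i
  proof -
    have "\<phi> (xs ! i) v = (\<Sum>j\<in>{0..<n}. \<phi> (xs ! i) (f j))"
      unfolding v_def using X mem[OF i] f by (intro linear_form_finsum) auto
    also have "\<dots> = (\<Sum>j\<in>{0..<n}. if j = i then u $ j else 0)"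
      using i mem X xs n_def
      by (intro sum.cong) (auto simp: f_def linear_formD subset_iff nth_eq_iff_index_eq)
    finally show ?thesis using i by simp
  qed
  have coordT: "\<phi> (xs ! i) (T v) = k * u $ i" if i: "i < n" for i
  proof -
    have "T v = (\<Oplus>j\<in>{0..<n}. T (f j))"
      unfolding v_def using T f M.abelian_group_axioms by (intro additive_finsum) auto
    then have "\<phi> (xs ! i) (T v) = (\<Sum>j\<in>{0..<n}. \<phi> (xs ! i) (T (f j)))"
      using X mem[OF i] f Tc by (simp add: linear_form_finsum Pi_iff)
    also have "\<dots> = (\<Sum>j\<in>{0..<n}. C $$ (i, j) * u $ j)"
      using i mem X Tc by (intro sum.cong) (auto simp: f_def C_def T(2) linear_formD subset_iff)
    also have "\<dots> = (C *\<^sub>v u) $ i"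
      using i u(1) C by (auto simp: scalar_prod_def intro!: sum.cong)
    finally show ?thesis using u i by simp
  qed
  have "v \<noteq> \<zero>"
  proof
    assume "v = \<zero>"
    then have "u $ i = 0" if "i < n" for i
      using coord[OF that] X(3)[OF mem[OF that]] by (simp add: linear_form_zero)
    then have "u = 0\<^sub>v n" using u(1) by (intro eq_vecI) auto
    with u(2) show False ..
  qed
  moreover have "T v = k \<odot> v"
  proof -
    have "\<phi> x (T v) = \<phi> x (k \<odot> v)" if "x \<in> X" for x
    proof -
      obtain i where "i < n" "x = xs ! i" using bij \<open>x \<in> X\<close> by (auto simp: bij_betw_def)
      then show ?thesis using coord coordT X(3) v that by (simp add: linear_formD)
    qed
    then have "(\<Oplus>x\<in>X. \<phi> x (T v) \<odot> x) = (\<Oplus>x\<in>X. \<phi> x (k \<odot> v) \<odot> x)"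
      using X by (intro M.finsum_cong') auto
    then show ?thesis using X(4)[OF Tc[OF v]] X(4)[of "k \<odot> v"] v by simp
  qed
  ultimately show thesis using v that by blast
qed

definition lin_span :: "'v set \<Rightarrow> 'v set" where
  "lin_span X = range (\<lambda>c. \<Oplus>x\<in>X. c x \<odot> x)"

lemma lin_spanI: "v = (\<Oplus>x\<in>X. c x \<odot> x) \<Longrightarrow> v \<in> lin_span X"
  unfolding lin_span_def by (rule range_eqI)

lemma lin_span_add:
  assumes "X \<subseteq> carrier V" "v \<in> lin_span X" "w \<in> lin_span X"
  shows "v \<oplus> w \<in> lin_span X"
proof -
  obtain c d where "v = (\<Oplus>x\<in>X. c x \<odot> x)" "w = (\<Oplus>x\<in>X. d x \<odot> x)"
    using assms by (auto simp: lin_span_def)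
  then have "v \<oplus> w = (\<Oplus>x\<in>X. (c x + d x) \<odot> x)"
    using assms by (simp add: linear_combination_add)
  then show ?thesis by (rule lin_spanI)
qed

lemma lin_span_smult:
  assumes "X \<subseteq> carrier V" "v \<in> lin_span X"
  shows "c \<odot> v \<in> lin_span X"
proof -
  obtain d where "v = (\<Oplus>x\<in>X. d x \<odot> x)" using assms by (auto simp: lin_span_def)
  then have "c \<odot> v = (\<Oplus>x\<in>X. (c * d x) \<odot> x)"
    using assms by (simp add: linear_combination_smult)
  then show ?thesis by (rule lin_spanI)
qed

lemma lin_span_zero: "X \<subseteq> carrier V \<Longrightarrow> \<zero> \<in> lin_span X"
  using linear_combination_smult[of X 0 "\<lambda>_. 0"] smult_l_null[of "\<Oplus>x\<in>X. 0 \<odot> x"]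
  by (intro lin_spanI[of _ "\<lambda>_. 0 * 0"]) (simp add: Pi_iff subset_iff)

lemma lin_span_base:
  assumes "finite X" "X \<subseteq> carrier V" "y \<in> X"
  shows "y \<in> lin_span X"
proof -
  have "(\<Oplus>x\<in>X. (if x = y then 1 else 0) \<odot> x) = (\<Oplus>x\<in>X. if y = x then x else \<zero>)"
    using assms smult_one smult_l_null by (intro M.finsum_cong') auto
  also have "\<dots> = y"
    using assms M.finsum_singleton[of y X "\<lambda>x. x"] by (simp add: Pi_iff subset_iff)
  finally have "y = (\<Oplus>x\<in>X. (if x = y then 1 else 0) \<odot> x)" by simp
  then show ?thesis by (rule lin_spanI)
qed

lemma lin_span_closed: "X \<subseteq> carrier V \<Longrightarrow> v \<in> lin_span X \<Longrightarrow> v \<in> carrier V"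
  by (auto simp: lin_span_def intro!: M.finsum_closed)

lemma lin_span_finsum:
  assumes "X \<subseteq> carrier V" "f \<in> I \<rightarrow> lin_span X"
  shows "(\<Oplus>i\<in>I. f i) \<in> lin_span X"
  using assms(2)
proof (induction I rule: infinite_finite_induct)
  case (insert i I)
  then have "f \<in> I \<rightarrow> carrier V" "f i \<in> carrier V"
    using lin_span_closed[OF assms(1)] by auto
  with insert show ?case using lin_span_add[OF assms(1)] by (simp add: Pi_iff)
qed (simp_all add: lin_span_zero assms)

lemma finite_dimI:
  assumes "finite X" "X \<subseteq> carrier V" "carrier V \<subseteq> lin_span X"
  shows "finite_dim V"
  unfolding finite_dim_def
proof (rule exI[of _ X], intro conjI ballI)
  fix y assume "y \<in> carrier V"
  then show "\<exists>c. y = (\<Oplus>x\<in>X. c x \<odot> x)" using assms(3) by (auto simp: lin_span_def)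
qed (use assms in auto)

end

lemma finite_dim_surjective_image:
  assumes "complex_vector_space V" "complex_vector_space V'" "finite_dim V"
    and T: "T \<in> additive_maps V V'" "\<And>c v. v \<in> carrier V \<Longrightarrow> T (c \<odot>\<^bsub>V\<^esub> v) = c \<odot>\<^bsub>V'\<^esub> T v"
    and surj: "T ` carrier V = carrier V'"
  shows "finite_dim V'"
proof -
  interpret V: complex_vector_space V by fact
  interpret V': complex_vector_space V' by fact
  obtain X where X: "finite X" "X \<subseteq> carrier V"
      "\<forall>y\<in>carrier V. \<exists>c. y = (\<Oplus>\<^bsub>V\<^esub>x\<in>X. c x \<odot>\<^bsub>V\<^esub> x)"
    using assms(3) by (auto simp: finite_dim_def)
  have sub: "T ` X \<subseteq> carrier V'" using X(2) surj by blast
  have "T y \<in> V'.lin_span (T ` X)" if "y \<in> carrier V" for y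
  proof -
    obtain c where c: "y = (\<Oplus>\<^bsub>V\<^esub>x\<in>X. c x \<odot>\<^bsub>V\<^esub> x)" using X(3) \<open>y \<in> carrier V\<close> by blast
    have "T y = (\<Oplus>\<^bsub>V'\<^esub>x\<in>X. T (c x \<odot>\<^bsub>V\<^esub> x))"
      unfolding c using X(2) T(1) V.M.abelian_group_axioms V'.M.abelian_group_axioms
      by (intro additive_finsum) auto
    also have "\<dots> \<in> V'.lin_span (T ` X)"
    proof (rule V'.lin_span_finsum[OF sub], rule Pi_I)
      fix x assume "x \<in> X"
      then have "T x \<in> V'.lin_span (T ` X)"
        using X(1) sub by (intro V'.lin_span_base) auto
      then show "T (c x \<odot>\<^bsub>V\<^esub> x) \<in> V'.lin_span (T ` X)"
        using X(2) \<open>x \<in> X\<close> V'.lin_span_smult[OF sub] T(2) by auto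
    qed
    finally show ?thesis .
  qed
  then have "carrier V' \<subseteq> V'.lin_span (T ` X)"
    unfolding surj[symmetric] by (rule image_subsetI)
  with X(1) sub show ?thesis by (intro V'.finite_dimI[of "T ` X"]) auto
qed

lemma abelian_group_subcarrier:
  assumes "abelian_group M" "subgroup U (add_monoid M)"
  shows "abelian_group (M\<lparr>carrier := U\<rparr>)"
proof -
  interpret M: abelian_group M by fact
  interpret U: subgroup U "add_monoid M" by fact
  have sub: "x \<in> carrier M" if "x \<in> U" for x using U.subset that by auto
  show ?thesis
  proof (rule abelian_groupI)
    fix x assume "x \<in> carrier (M\<lparr>carrier := U\<rparr>)"
    then show "\<exists>y\<in>carrier (M\<lparr>carrier := U\<rparr>). y \<oplus>\<^bsub>M\<lparr>carrier := U\<rparr>\<^esub> x = \<zero>\<^bsub>M\<lparr>carrier := U\<rparr>\<^esub>"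
      using U.m_inv_closed[of x] sub[of x]
      by (intro bexI[of _ "\<ominus>\<^bsub>M\<^esub> x"]) (auto simp: a_inv_def[symmetric] M.l_neg)
  qed (use U.m_closed U.one_closed sub in \<open>auto simp: M.a_assoc intro: M.a_comm\<close>)
qed

lemma subgroup_finsum_closed:
  assumes "abelian_group M" "subgroup U (add_monoid M)" "f \<in> I \<rightarrow> U"
  shows "finsum M f I \<in> U"
proof -
  interpret U: abelian_group "M\<lparr>carrier := U\<rparr>"
    by (rule abelian_group_subcarrier[OF assms(1,2)])
  have "finsum (M\<lparr>carrier := U\<rparr>) f I \<in> U"
    using U.finsum_closed[of f I] assms(3) by simp
  then show ?thesis
    using finsum_subcarrier[OF assms(1) U.abelian_group_axioms _ assms(3)]
      subgroup.subset[OF assms(2)] by simp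
qed

section \<open>Simple modules and idempotents\<close>

context right_module
begin

lemma additive_ract: "a \<in> carrier R \<Longrightarrow> (\<lambda>x. x \<lhd>\<^bsub>M\<^esub> a) \<in> additive_maps M M"
  by (intro additive_mapsI) (auto intro: ract_closed ract_add)

lemma additive_ract_scalar: "x \<in> carrier M \<Longrightarrow> (\<lambda>a. x \<lhd>\<^bsub>M\<^esub> a) \<in> additive_maps R M"
  by (intro additive_mapsI) (auto intro: ract_closed ract_add_scalar)

lemma zero_ract: "a \<in> carrier R \<Longrightarrow> \<zero>\<^bsub>M\<^esub> \<lhd>\<^bsub>M\<^esub> a = \<zero>\<^bsub>M\<^esub>"
  using additive_zero[OF _ _ additive_ract] M.abelian_group_axioms by blast

lemma ract_zero: "x \<in> carrier M \<Longrightarrow> x \<lhd>\<^bsub>M\<^esub> \<zero>\<^bsub>R\<^esub> = \<zero>\<^bsub>M\<^esub>"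
  using additive_zero[OF _ _ additive_ract_scalar] M.abelian_group_axioms R.abelian_group_axioms by blast

lemma ract_minus: "\<lbrakk>x \<in> carrier M; a \<in> carrier R\<rbrakk> \<Longrightarrow> x \<lhd>\<^bsub>M\<^esub> (\<ominus>\<^bsub>R\<^esub> a) = \<ominus>\<^bsub>M\<^esub> (x \<lhd>\<^bsub>M\<^esub> a)"
  using additive_minus[OF _ _ additive_ract_scalar] M.abelian_group_axioms R.abelian_group_axioms by blast

lemma ract_diff:
  "\<lbrakk>x \<in> carrier M; a \<in> carrier R; b \<in> carrier R\<rbrakk> \<Longrightarrow>
    x \<lhd>\<^bsub>M\<^esub> (a \<ominus>\<^bsub>R\<^esub> b) = x \<lhd>\<^bsub>M\<^esub> a \<ominus>\<^bsub>M\<^esub> x \<lhd>\<^bsub>M\<^esub> b"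
  by (simp add: a_minus_def ract_add_scalar ract_minus)

lemma rsubmoduleI:
  assumes "U \<subseteq> carrier M" "\<zero>\<^bsub>M\<^esub> \<in> U" "\<And>x y. \<lbrakk>x \<in> U; y \<in> U\<rbrakk> \<Longrightarrow> x \<oplus>\<^bsub>M\<^esub> y \<in> U"
    and "\<And>x a. \<lbrakk>x \<in> U; a \<in> carrier R\<rbrakk> \<Longrightarrow> x \<lhd>\<^bsub>M\<^esub> a \<in> U"
  shows "rsubmodule U R M"
proof -
  have "\<ominus>\<^bsub>M\<^esub> x \<in> U" if "x \<in> U" for x
    using assms(4)[OF that, of "\<ominus>\<^bsub>R\<^esub> \<one>\<^bsub>R\<^esub>"] assms(1) that ract_minus[of x "\<one>\<^bsub>R\<^esub>"] ract_one[of x]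
    by auto
  then have "subgroup U (add_monoid M)"
    using assms(1-3) by (intro M.add.subgroupI) (auto simp: a_inv_def)
  then show ?thesis using assms(4) by (simp add: rsubmodule_def)
qed

lemma right_module_rsubmodule:
  assumes "rsubmodule U R M"
  shows "right_module R (M\<lparr>carrier := U\<rparr>)"
proof -
  have U: "subgroup U (add_monoid M)" "\<And>x a. \<lbrakk>x \<in> U; a \<in> carrier R\<rbrakk> \<Longrightarrow> x \<lhd>\<^bsub>M\<^esub> a \<in> U"
    using assms by (auto simp: rsubmodule_def)
  have sub: "x \<in> carrier M" if "x \<in> U" for x
    using subgroup.subset[OF U(1)] that by auto
  show ?thesis
    by (intro right_module.intro right_module_axioms.intro R.ring_axioms abelian_group_subcarrier
        M.abelian_group_axioms U)
      (auto simp: U sub ract_add ract_add_scalar ract_mult ract_one)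
qed

lemma rsubmodule_orbit:
  assumes "x \<in> carrier M"
  shows "rsubmodule ((\<lambda>a. x \<lhd>\<^bsub>M\<^esub> a) ` carrier R) R M"
proof (rule rsubmoduleI)
  show "\<zero>\<^bsub>M\<^esub> \<in> (\<lambda>a. x \<lhd>\<^bsub>M\<^esub> a) ` carrier R"
    using ract_zero[OF assms] by (metis R.zero_closed imageI)
qed (use assms in \<open>auto simp: ract_closed ract_add_scalar[symmetric] ract_mult[symmetric]\<close>)

end

lemma rsubmodule_subset: "rsubmodule U R M \<Longrightarrow> U \<subseteq> carrier M"
  using subgroup.subset by (fastforce simp: rsubmodule_def)

lemma rsubmodule_zero: "rsubmodule U R M \<Longrightarrow> \<zero>\<^bsub>M\<^esub> \<in> U"
  using subgroup.one_closed by (fastforce simp: rsubmodule_def)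

lemma rsubmodule_add: "\<lbrakk>rsubmodule U R M; x \<in> U; y \<in> U\<rbrakk> \<Longrightarrow> x \<oplus>\<^bsub>M\<^esub> y \<in> U"
  using subgroup.m_closed by (fastforce simp: rsubmodule_def)

lemma rsubmodule_ract: "\<lbrakk>rsubmodule U R M; x \<in> U; a \<in> carrier R\<rbrakk> \<Longrightarrow> x \<lhd>\<^bsub>M\<^esub> a \<in> U"
  by (simp add: rsubmodule_def)

lemma rmod_homD:
  assumes "h \<in> rmod_hom R M N"
  shows "h \<in> additive_maps M N"
    and "\<lbrakk>x \<in> carrier M; a \<in> carrier R\<rbrakk> \<Longrightarrow> h (x \<lhd>\<^bsub>M\<^esub> a) = h x \<lhd>\<^bsub>N\<^esub> a"
  using assms by (auto simp: rmod_hom_def)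

lemma simple_rmoduleD:
  assumes "simple_rmodule R M"
  shows "right_module R M" and "carrier M \<noteq> {\<zero>\<^bsub>M\<^esub>}"
    and "rsubmodule U R M \<Longrightarrow> U = {\<zero>\<^bsub>M\<^esub>} \<or> U = carrier M"
  using assms by (auto simp: simple_rmodule_def)

lemma rmod_hom_kernel:
  assumes "right_module R M" "right_module R N" "h \<in> rmod_hom R M N"
  shows "rsubmodule {x \<in> carrier M. h x = \<zero>\<^bsub>N\<^esub>} R M"
proof -
  interpret M: right_module R M by fact
  interpret N: right_module R N by fact
  note h = rmod_homD[OF assms(3)]
  show ?thesis
    by (rule M.rsubmoduleI)
      (auto simp: h(2) additive_add[OF h(1)] additive_zero[OF _ _ h(1)] M.M.abelian_group_axioms
        N.M.abelian_group_axioms M.ract_closed N.zero_ract)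
qed

lemma rmod_hom_image:
  assumes "right_module R M" "right_module R N" "h \<in> rmod_hom R M N" "rsubmodule U R M"
  shows "rsubmodule (h ` U) R N"
proof -
  interpret M: right_module R M by fact
  interpret N: right_module R N by fact
  note h = rmod_homD[OF assms(3)]
  have sub: "x \<in> carrier M" if "x \<in> U" for x using rsubmodule_subset[OF assms(4)] that by auto
  show ?thesis
  proof (rule N.rsubmoduleI)
    show "\<zero>\<^bsub>N\<^esub> \<in> h ` U"
      using rsubmodule_zero[OF assms(4)] additive_zero[OF _ _ h(1)] M.M.abelian_group_axioms
        N.M.abelian_group_axioms by force
  qed (use sub in \<open>auto simp: h(2)[symmetric] additive_closed[OF h(1)] additive_add[OF h(1), symmetric]
      intro!: imageI rsubmodule_add[OF assms(4)] rsubmodule_ract[OF assms(4)]\<close>)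
qed

lemma additive_injI:
  assumes "abelian_group M" "abelian_group N" "h \<in> additive_maps M N"
    and "\<And>x. \<lbrakk>x \<in> carrier M; h x = \<zero>\<^bsub>N\<^esub>\<rbrakk> \<Longrightarrow> x = \<zero>\<^bsub>M\<^esub>"
  shows "inj_on h (carrier M)"
proof (rule inj_onI)
  interpret M: abelian_group M by fact
  interpret N: abelian_group N by fact
  fix x y assume xy: "x \<in> carrier M" "y \<in> carrier M" "h x = h y"
  have "h (x \<ominus>\<^bsub>M\<^esub> y) = \<zero>\<^bsub>N\<^esub>"
    using xy additive_closed[OF assms(3)]
    by (simp add: a_minus_def additive_add[OF assms(3)] additive_minus[OF assms(1-3)] N.r_neg)
  then have "x \<ominus>\<^bsub>M\<^esub> y = \<zero>\<^bsub>M\<^esub>" using xy assms(4) by auto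
  then show "x = y" using xy by simp
qed

lemma simple_rmodule_hom_bij:
  assumes "simple_rmodule R M" "simple_rmodule R N" "h \<in> rmod_hom R M N"
    and "x \<in> carrier M" "h x \<noteq> \<zero>\<^bsub>N\<^esub>"
  shows "bij_betw h (carrier M) (carrier N)"
proof -
  note MN = simple_rmoduleD(1)[OF assms(1)] simple_rmoduleD(1)[OF assms(2)]
  interpret M: right_module R M by (fact MN)
  interpret N: right_module R N by (fact MN)
  note h = rmod_homD[OF assms(3)]
  have "{x \<in> carrier M. h x = \<zero>\<^bsub>N\<^esub>} = {\<zero>\<^bsub>M\<^esub>}"
    using simple_rmoduleD(3)[OF assms(1) rmod_hom_kernel[OF MN assms(3)]] assms(4,5) by blast
  then have "inj_on h (carrier M)"
    by (intro additive_injI[OF _ _ h(1)] M.M.abelian_group_axioms N.M.abelian_group_axioms) auto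
  moreover have "rsubmodule (carrier M) R M"
    by (rule M.rsubmoduleI) (auto intro: M.ract_closed)
  then have "h ` carrier M = {\<zero>\<^bsub>N\<^esub>} \<or> h ` carrier M = carrier N"
    by (intro simple_rmoduleD(3)[OF assms(2)] rmod_hom_image[OF MN assms(3)])
  then have "h ` carrier M = carrier N" using assms(4,5) by blast
  ultimately show ?thesis by (simp add: bij_betw_def)
qed

lemma simple_rmodule_orbit:
  assumes "simple_rmodule R M" "x \<in> carrier M" "x \<noteq> \<zero>\<^bsub>M\<^esub>"
  shows "(\<lambda>a. x \<lhd>\<^bsub>M\<^esub> a) ` carrier R = carrier M"
proof -
  interpret right_module R M using simple_rmoduleD(1)[OF assms(1)] .
  have "x \<in> (\<lambda>a. x \<lhd>\<^bsub>M\<^esub> a) ` carrier R"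
    using ract_one[OF assms(2)] by (metis R.one_closed imageI)
  then show ?thesis
    using simple_rmoduleD(3)[OF assms(1) rsubmodule_orbit[OF assms(2)]] assms(3) by blast
qed

lemma simple_rmodule_iso:
  assumes "simple_rmodule R M" "right_module R N" "h \<in> rmod_hom R M N"
    "bij_betw h (carrier M) (carrier N)"
  shows "simple_rmodule R N"
proof -
  note M = simple_rmoduleD[OF assms(1)]
  interpret M: right_module R M by (fact M)
  interpret N: right_module R N by fact
  note h = rmod_homD[OF assms(3)]
  have h0: "h \<zero>\<^bsub>M\<^esub> = \<zero>\<^bsub>N\<^esub>"
    by (rule additive_zero[OF _ _ h(1)]) (rule M.M.abelian_group_axioms N.M.abelian_group_axioms)+
  have "carrier N \<noteq> {\<zero>\<^bsub>N\<^esub>}"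
  proof
    assume "carrier N = {\<zero>\<^bsub>N\<^esub>}"
    then have "x = \<zero>\<^bsub>M\<^esub>" if "x \<in> carrier M" for x
      using assms(4) h0 that unfolding bij_betw_def inj_on_def
      by (metis M.M.zero_closed imageI singletonD)
    then show False using M(2) M.M.zero_closed by blast
  qed
  moreover have "U = {\<zero>\<^bsub>N\<^esub>} \<or> U = carrier N" if U: "rsubmodule U R N" for U
  proof -
    let ?T = "{x \<in> carrier M. h x \<in> U}"
    have "rsubmodule ?T R M"
      by (rule M.rsubmoduleI)
        (auto simp: h(2) h0 additive_add[OF h(1)] M.ract_closed rsubmodule_zero[OF U]
          intro: rsubmodule_add[OF U] rsubmodule_ract[OF U])
    then have "?T = {\<zero>\<^bsub>M\<^esub>} \<or> ?T = carrier M" by (rule M(3))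
    moreover have "U = h ` ?T"
      using assms(4) rsubmodule_subset[OF U] by (auto simp: bij_betw_def)
    ultimately show ?thesis using h0 assms(4) by (auto simp: bij_betw_def)
  qed
  ultimately show ?thesis using assms(2) by (simp add: simple_rmodule_def)
qed

lemma (in ring) right_module_regular: "right_module R (regular_rmodule R)"
proof (intro right_module.intro right_module_axioms.intro ring_axioms)
  show "abelian_group (regular_rmodule R)"
    by (rule abelian_groupI)
      (auto simp: regular_rmodule_def a_assoc intro: a_comm l_neg)
qed (auto simp: regular_rmodule_def l_distr r_distr m_assoc)

lemma regular_rmodule_simps [simp]:
  "carrier (regular_rmodule R) = carrier R" "x \<oplus>\<^bsub>regular_rmodule R\<^esub> y = x \<oplus>\<^bsub>R\<^esub> y"
  "\<zero>\<^bsub>regular_rmodule R\<^esub> = \<zero>\<^bsub>R\<^esub>" "x \<lhd>\<^bsub>regular_rmodule R\<^esub> y = x \<otimes>\<^bsub>R\<^esub> y"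
  by (simp_all add: regular_rmodule_def)

abbreviation right_ideal :: "'r set \<Rightarrow> ('r, 'x) ring_scheme \<Rightarrow> bool" where
  "right_ideal U R \<equiv> rsubmodule U R (regular_rmodule R)"

lemma (in ring) right_idealI:
  assumes "U \<subseteq> carrier R" "\<zero> \<in> U" "\<And>x y. \<lbrakk>x \<in> U; y \<in> U\<rbrakk> \<Longrightarrow> x \<oplus> y \<in> U"
    and "\<And>x a. \<lbrakk>x \<in> U; a \<in> carrier R\<rbrakk> \<Longrightarrow> x \<otimes> a \<in> U"
  shows "right_ideal U R"
  using assms by (intro right_module.rsubmoduleI[OF right_module_regular]) auto

lemma (in ring) right_ideal_diff:
  "\<lbrakk>right_ideal U R; x \<in> U; y \<in> U\<rbrakk> \<Longrightarrow> x \<ominus> y \<in> U"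
proof -
  assume U: "right_ideal U R" "x \<in> U" "y \<in> U"
  then have c: "x \<in> carrier R" "y \<in> carrier R" using rsubmodule_subset by fastforce+
  have "y \<otimes> \<ominus> \<one> \<in> U" using rsubmodule_ract[OF U(1,3), of "\<ominus> \<one>"] by simp
  then have "\<ominus> y \<in> U" using c by (simp add: r_minus)
  then show ?thesis using rsubmodule_add[OF U(1,2)] by (simp add: a_minus_def)
qed

text \<open>These conditions say that \<open>e a \<mapsto> v a\<close> is an isomorphism from the right ideal \<open>e R\<close> to
  \<open>M\<close>.\<close>

definition presents :: "('r, 'x) ring_scheme \<Rightarrow> ('r, 'm, 'y) rmodule_scheme \<Rightarrow> 'r \<Rightarrow> 'm \<Rightarrow> bool" where
  "presents R M e v \<longleftrightarrow> e \<in> carrier R \<and> e \<otimes>\<^bsub>R\<^esub> e = e \<and> v \<in> carrier M \<and> v \<lhd>\<^bsub>M\<^esub> e = v \<and>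
     (\<lambda>a. v \<lhd>\<^bsub>M\<^esub> a) ` carrier R = carrier M \<and>
     (\<forall>a\<in>carrier R. v \<lhd>\<^bsub>M\<^esub> a = \<zero>\<^bsub>M\<^esub> \<longrightarrow> e \<otimes>\<^bsub>R\<^esub> a = \<zero>\<^bsub>R\<^esub>)"

text \<open>A complement of the annihilator of \<open>v\<close> is a right ideal isomorphic to \<open>v R\<close>; the
  component of \<open>\<one>\<close> in it is the idempotent.\<close>

lemma ex_presents:
  assumes "semisimple_ring R" "simple_rmodule R M"
  shows "\<exists>e v. presents R M e v"
proof -
  interpret ring R using assms(1) by (simp add: semisimple_ring_def)
  note M = simple_rmoduleD[OF assms(2)]
  interpret M: right_module R M by (fact M)
  obtain v where v: "v \<in> carrier M" "v \<noteq> \<zero>\<^bsub>M\<^esub>"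
    using M(2) M.M.zero_closed by blast
  define N where "N = {a \<in> carrier R. v \<lhd>\<^bsub>M\<^esub> a = \<zero>\<^bsub>M\<^esub>}"
  have N: "right_ideal N R"
    by (rule right_idealI)
      (auto simp: N_def v M.ract_zero M.ract_add_scalar M.ract_mult M.zero_ract)
  then obtain U where U: "right_ideal U R" "N \<inter> U = {\<zero>\<^bsub>R\<^esub>}"
      "carrier R = {n \<oplus>\<^bsub>R\<^esub> u | n u. n \<in> N \<and> u \<in> U}"
    using assms(1) by (fastforce simp: semisimple_ring_def complementary_def)
  then obtain f e where fe: "f \<in> N" "e \<in> U" "\<one>\<^bsub>R\<^esub> = f \<oplus>\<^bsub>R\<^esub> e"
    using one_closed by auto
  have c: "f \<in> carrier R" "e \<in> carrier R" "v \<lhd>\<^bsub>M\<^esub> f = \<zero>\<^bsub>M\<^esub>"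
    using fe rsubmodule_subset[OF U(1)] by (auto simp: N_def)
  have ve: "v \<lhd>\<^bsub>M\<^esub> e = v"
    using M.ract_one[OF v(1)] c v by (simp add: fe(3) M.ract_add_scalar M.ract_closed)
  have kill: "e \<otimes>\<^bsub>R\<^esub> a = \<zero>\<^bsub>R\<^esub>" if a: "a \<in> carrier R" "v \<lhd>\<^bsub>M\<^esub> a = \<zero>\<^bsub>M\<^esub>" for a
  proof -
    have "e \<otimes>\<^bsub>R\<^esub> a \<in> U" using rsubmodule_ract[OF U(1) fe(2)] a by simp
    moreover have "v \<lhd>\<^bsub>M\<^esub> (e \<otimes>\<^bsub>R\<^esub> a) = \<zero>\<^bsub>M\<^esub>"
      using a c v ve by (simp add: M.ract_mult)
    then have "e \<otimes>\<^bsub>R\<^esub> a \<in> N" using a c by (simp add: N_def)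
    ultimately show ?thesis using U(2) by auto
  qed
  have "v \<lhd>\<^bsub>M\<^esub> (e \<ominus>\<^bsub>R\<^esub> \<one>\<^bsub>R\<^esub>) = \<zero>\<^bsub>M\<^esub>"
    using v c ve M.ract_diff[of v e "\<one>\<^bsub>R\<^esub>"] by (simp add: M.ract_one a_minus_def M.M.r_neg)
  then have "e \<otimes>\<^bsub>R\<^esub> (e \<ominus>\<^bsub>R\<^esub> \<one>\<^bsub>R\<^esub>) = \<zero>\<^bsub>R\<^esub>" using kill c by simp
  then have "e \<otimes>\<^bsub>R\<^esub> e \<ominus>\<^bsub>R\<^esub> e = \<zero>\<^bsub>R\<^esub>" using c by (simp add: a_minus_def r_distr r_minus)
  then have "e \<otimes>\<^bsub>R\<^esub> e = e" using c by simp
  then have "presents R M e v"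
    using c v ve kill simple_rmodule_orbit[OF assms(2) v] by (simp add: presents_def)
  then show ?thesis by blast
qed

lemma presentsD:
  assumes "presents R M e v"
  shows "e \<in> carrier R" "e \<otimes>\<^bsub>R\<^esub> e = e" "v \<in> carrier M" "v \<lhd>\<^bsub>M\<^esub> e = v"
    "(\<lambda>a. v \<lhd>\<^bsub>M\<^esub> a) ` carrier R = carrier M"
    "\<lbrakk>a \<in> carrier R; v \<lhd>\<^bsub>M\<^esub> a = \<zero>\<^bsub>M\<^esub>\<rbrakk> \<Longrightarrow> e \<otimes>\<^bsub>R\<^esub> a = \<zero>\<^bsub>R\<^esub>"
  using assms by (auto simp: presents_def)

lemma presents_nonzero:
  assumes "presents R M e v" "simple_rmodule R M"
  shows "v \<noteq> \<zero>\<^bsub>M\<^esub>" "e \<noteq> \<zero>\<^bsub>R\<^esub>"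
proof -
  interpret right_module R M using simple_rmoduleD(1)[OF assms(2)] .
  note e = presentsD[OF assms(1)]
  show v: "v \<noteq> \<zero>\<^bsub>M\<^esub>"
  proof
    assume "v = \<zero>\<^bsub>M\<^esub>"
    then have "carrier M \<subseteq> {\<zero>\<^bsub>M\<^esub>}" unfolding e(5)[symmetric] by (auto simp: zero_ract)
    then show False using simple_rmoduleD(2)[OF assms(2)] M.zero_closed by blast
  qed
  show "e \<noteq> \<zero>\<^bsub>R\<^esub>" using v e(3,4) ract_zero[of v] by auto
qed

lemma presents_ract_nonzero:
  assumes "presents R M e v" "right_module R M" "x \<in> carrier R"
  shows "(\<exists>w\<in>carrier M. w \<lhd>\<^bsub>M\<^esub> x \<noteq> \<zero>\<^bsub>M\<^esub>) \<longleftrightarrow> (\<exists>a\<in>carrier R. e \<otimes>\<^bsub>R\<^esub> a \<otimes>\<^bsub>R\<^esub> x \<noteq> \<zero>\<^bsub>R\<^esub>)"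
proof -
  interpret right_module R M by fact
  note e = presentsD[OF assms(1)]
  have "v \<lhd>\<^bsub>M\<^esub> (a \<otimes>\<^bsub>R\<^esub> x) = \<zero>\<^bsub>M\<^esub> \<longleftrightarrow> e \<otimes>\<^bsub>R\<^esub> a \<otimes>\<^bsub>R\<^esub> x = \<zero>\<^bsub>R\<^esub>"
    if a: "a \<in> carrier R" for a
  proof
    assume "e \<otimes>\<^bsub>R\<^esub> a \<otimes>\<^bsub>R\<^esub> x = \<zero>\<^bsub>R\<^esub>"
    then have "v \<lhd>\<^bsub>M\<^esub> (e \<otimes>\<^bsub>R\<^esub> (a \<otimes>\<^bsub>R\<^esub> x)) = \<zero>\<^bsub>M\<^esub>"
      using a e assms(3) by (simp add: R.m_assoc ract_zero)
    then show "v \<lhd>\<^bsub>M\<^esub> (a \<otimes>\<^bsub>R\<^esub> x) = \<zero>\<^bsub>M\<^esub>"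
      using a e assms(3) by (simp add: ract_mult[of v e])
  qed (use a e assms(3) in \<open>simp add: R.m_assoc\<close>)
  then show ?thesis unfolding e(5)[symmetric] using e(3) assms(3) by (auto simp: ract_mult)
qed

lemma simple_right_inverse:
  assumes "presents R M e v" "simple_rmodule R M" "x \<in> carrier R" "e \<otimes>\<^bsub>R\<^esub> x \<noteq> \<zero>\<^bsub>R\<^esub>"
  obtains a where "a \<in> carrier R" "e \<otimes>\<^bsub>R\<^esub> x \<otimes>\<^bsub>R\<^esub> a = e"
proof -
  interpret right_module R M using simple_rmoduleD(1)[OF assms(2)] .
  note e = presentsD[OF assms(1)]
  have "v \<lhd>\<^bsub>M\<^esub> x \<noteq> \<zero>\<^bsub>M\<^esub>" using e(6)[OF assms(3)] assms(4) by blast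
  then have "v \<in> (\<lambda>a. (v \<lhd>\<^bsub>M\<^esub> x) \<lhd>\<^bsub>M\<^esub> a) ` carrier R"
    using simple_rmodule_orbit[OF assms(2), of "v \<lhd>\<^bsub>M\<^esub> x"] e(3) assms(3) by (simp add: ract_closed)
  then obtain a where a: "a \<in> carrier R" "v = (v \<lhd>\<^bsub>M\<^esub> x) \<lhd>\<^bsub>M\<^esub> a" by auto
  have "v \<lhd>\<^bsub>M\<^esub> (x \<otimes>\<^bsub>R\<^esub> a \<ominus>\<^bsub>R\<^esub> e) = v \<ominus>\<^bsub>M\<^esub> v"
    using a e(1,3,4) assms(3) by (simp add: ract_diff ract_mult)
  also have "\<dots> = \<zero>\<^bsub>M\<^esub>" using e(3) by (simp add: a_minus_def M.r_neg)
  finally have "e \<otimes>\<^bsub>R\<^esub> (x \<otimes>\<^bsub>R\<^esub> a \<ominus>\<^bsub>R\<^esub> e) = \<zero>\<^bsub>R\<^esub>"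
    using a assms(3) e(1) by (intro e(6)) auto
  then have "e \<otimes>\<^bsub>R\<^esub> x \<otimes>\<^bsub>R\<^esub> a \<ominus>\<^bsub>R\<^esub> e = \<zero>\<^bsub>R\<^esub>"
    using a assms(3) e(1,2) by (simp add: a_minus_def R.r_distr R.r_minus R.m_assoc)
  then show thesis using that a assms(3) e(1) by simp
qed

text \<open>A nonzero element of \<open>e R f\<close> acts by left multiplication as a nonzero homomorphism from
  \<open>f R\<close> to \<open>e R\<close>.\<close>

lemma presents_iso:
  assumes "presents R M e v" "simple_rmodule R M" "presents R N f w" "simple_rmodule R N"
    and "x \<in> carrier R" "e \<otimes>\<^bsub>R\<^esub> x \<otimes>\<^bsub>R\<^esub> f \<noteq> \<zero>\<^bsub>R\<^esub>"
  shows "rmod_iso R N M"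
proof -
  interpret M: right_module R M using simple_rmoduleD(1)[OF assms(2)] .
  interpret N: right_module R N using simple_rmoduleD(1)[OF assms(4)] .
  note e = presentsD[OF assms(1)] and f = presentsD[OF assms(3)]
  define y where "y = v \<lhd>\<^bsub>M\<^esub> (x \<otimes>\<^bsub>R\<^esub> f)"
  have y: "y \<in> carrier M" using e f assms(5) by (simp add: y_def M.ract_closed)
  have wd: "y \<lhd>\<^bsub>M\<^esub> a = y \<lhd>\<^bsub>M\<^esub> b"
    if ab: "a \<in> carrier R" "b \<in> carrier R" "w \<lhd>\<^bsub>N\<^esub> a = w \<lhd>\<^bsub>N\<^esub> b" for a b
  proof -
    have "w \<lhd>\<^bsub>N\<^esub> (a \<ominus>\<^bsub>R\<^esub> b) = \<zero>\<^bsub>N\<^esub>"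
      using ab f(3) N.ract_diff[of w a b] by (simp add: N.ract_closed a_minus_def N.M.r_neg)
    then have "f \<otimes>\<^bsub>R\<^esub> (a \<ominus>\<^bsub>R\<^esub> b) = \<zero>\<^bsub>R\<^esub>" using ab by (intro f(6)) auto
    then have "y \<lhd>\<^bsub>M\<^esub> (a \<ominus>\<^bsub>R\<^esub> b) = \<zero>\<^bsub>M\<^esub>"
      unfolding y_def using e f ab assms(5)
      by (simp add: M.ract_mult[symmetric] M.R.m_assoc M.ract_zero)
    then show ?thesis using ab y by (simp add: M.ract_diff M.ract_closed)
  qed
  define h where "h = (\<lambda>n. y \<lhd>\<^bsub>M\<^esub> (SOME a. a \<in> carrier R \<and> w \<lhd>\<^bsub>N\<^esub> a = n))"
  have h: "h (w \<lhd>\<^bsub>N\<^esub> a) = y \<lhd>\<^bsub>M\<^esub> a" if a: "a \<in> carrier R" for a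
  proof -
    have "\<exists>b. b \<in> carrier R \<and> w \<lhd>\<^bsub>N\<^esub> b = w \<lhd>\<^bsub>N\<^esub> a" using a by blast
    from someI_ex[OF this] a show ?thesis unfolding h_def by (intro wd) auto
  qed
  have "h \<in> rmod_hom R N M"
    unfolding rmod_hom_def mem_Collect_eq
  proof (intro conjI additive_mapsI ballI)
    fix n m assume "n \<in> carrier N" "m \<in> carrier N"
    then obtain a b where ab: "a \<in> carrier R" "b \<in> carrier R" "n = w \<lhd>\<^bsub>N\<^esub> a" "m = w \<lhd>\<^bsub>N\<^esub> b"
      unfolding f(5)[symmetric] by blast
    show "h (n \<oplus>\<^bsub>N\<^esub> m) = h n \<oplus>\<^bsub>M\<^esub> h m"
      using ab f(3) y by (simp add: h N.ract_add_scalar[symmetric] M.ract_add_scalar)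
  next
    fix n assume "n \<in> carrier N"
    then obtain a where a: "a \<in> carrier R" "n = w \<lhd>\<^bsub>N\<^esub> a" unfolding f(5)[symmetric] by blast
    show "h n \<in> carrier M" using a y by (simp add: h M.ract_closed)
  next
    fix n b assume "n \<in> carrier N" and b: "b \<in> carrier R"
    then obtain a where a: "a \<in> carrier R" "n = w \<lhd>\<^bsub>N\<^esub> a" unfolding f(5)[symmetric] by blast
    show "h (n \<lhd>\<^bsub>N\<^esub> b) = h n \<lhd>\<^bsub>M\<^esub> b"
      using a b f(3) y by (simp add: h N.ract_mult[symmetric] M.ract_mult[symmetric])
  qed
  moreover have "h w \<noteq> \<zero>\<^bsub>M\<^esub>"
  proof
    assume "h w = \<zero>\<^bsub>M\<^esub>"
    then have "v \<lhd>\<^bsub>M\<^esub> (x \<otimes>\<^bsub>R\<^esub> f) = \<zero>\<^bsub>M\<^esub>"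
      using h[of f] f e assms(5) by (simp add: y_def M.ract_mult[symmetric] M.R.m_assoc)
    then have "e \<otimes>\<^bsub>R\<^esub> (x \<otimes>\<^bsub>R\<^esub> f) = \<zero>\<^bsub>R\<^esub>" using f assms(5) by (intro e(6)) auto
    then show False using assms(5,6) e f by (simp add: M.R.m_assoc)
  qed
  ultimately show ?thesis
    using simple_rmodule_hom_bij[OF assms(4,2)] f(3) unfolding rmod_iso_def by blast
qed

section \<open>Idempotents of a semisimple complex algebra\<close>

sublocale complex_algebra \<subseteq> complex_vector_space A
  by unfold_locales

lemma right_ideal_subgroup: "right_ideal U R \<Longrightarrow> subgroup U (add_monoid R)"
  by (simp add: rsubmodule_def subgroup_def m_inv_def)

text \<open>Write \<open>\<one> = x y + u'\<close> along a complement of the right ideal \<open>x R\<close>.  Then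
  \<open>u' x = x - x y x\<close> lies in both summands, so it vanishes.\<close>

lemma semisimple_ring_regular_element:
  assumes "semisimple_ring R" "x \<in> carrier R"
  obtains y where "y \<in> carrier R" "x \<otimes>\<^bsub>R\<^esub> y \<otimes>\<^bsub>R\<^esub> x = x"
proof -
  interpret ring R using assms(1) by (simp add: semisimple_ring_def)
  define U where "U = (\<lambda>a. x \<otimes>\<^bsub>R\<^esub> a) ` carrier R"
  have U: "right_ideal U R"
    using right_module.rsubmodule_orbit[OF right_module_regular, of x] assms(2) by (simp add: U_def)
  then obtain U' where U': "right_ideal U' R" "U \<inter> U' = {\<zero>\<^bsub>R\<^esub>}"
      "carrier R = {u \<oplus>\<^bsub>R\<^esub> u' | u u'. u \<in> U \<and> u' \<in> U'}"
    using assms(1) by (fastforce simp: semisimple_ring_def complementary_def)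
  then obtain u u' where u: "u \<in> U" "u' \<in> U'" "\<one>\<^bsub>R\<^esub> = u \<oplus>\<^bsub>R\<^esub> u'"
    using one_closed by auto
  then obtain y where y: "y \<in> carrier R" "u = x \<otimes>\<^bsub>R\<^esub> y" by (auto simp: U_def)
  have c: "u \<in> carrier R" "u' \<in> carrier R"
    using u rsubmodule_subset[OF U] rsubmodule_subset[OF U'(1)] by auto
  have eq: "x = u \<otimes>\<^bsub>R\<^esub> x \<oplus>\<^bsub>R\<^esub> u' \<otimes>\<^bsub>R\<^esub> x"
    using l_one[OF assms(2)] c assms(2) by (simp add: u(3) l_distr)
  have "x = x \<otimes>\<^bsub>R\<^esub> \<one>\<^bsub>R\<^esub>" using assms(2) by simp
  then have xU: "x \<in> U" unfolding U_def by (metis imageI one_closed)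
  have "u' \<otimes>\<^bsub>R\<^esub> x = x \<ominus>\<^bsub>R\<^esub> u \<otimes>\<^bsub>R\<^esub> x"
  proof -
    have "u' \<otimes>\<^bsub>R\<^esub> x = u \<otimes>\<^bsub>R\<^esub> x \<oplus>\<^bsub>R\<^esub> u' \<otimes>\<^bsub>R\<^esub> x \<ominus>\<^bsub>R\<^esub> u \<otimes>\<^bsub>R\<^esub> x"
      using c assms(2) by (simp add: a_minus_def a_ac r_neg r_neg1)
    then show ?thesis using eq by simp
  qed
  also have "\<dots> \<in> U"
    using xU rsubmodule_ract[OF U u(1)] assms(2) by (intro right_ideal_diff[OF U]) simp_all
  finally have "u' \<otimes>\<^bsub>R\<^esub> x \<in> U \<inter> U'" using rsubmodule_ract[OF U'(1) u(2)] assms(2) by simp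
  then have "u' \<otimes>\<^bsub>R\<^esub> x = \<zero>\<^bsub>R\<^esub>" using U'(2) by blast
  then have "x \<otimes>\<^bsub>R\<^esub> y \<otimes>\<^bsub>R\<^esub> x = x" using eq c assms(2) y by simp
  then show thesis using that y by blast
qed

context complex_algebra
begin

lemma scalar_left: "x \<in> carrier A \<Longrightarrow> (c \<odot> \<one>) \<otimes> x = c \<odot> x"
  by (simp add: smult_mult_left)

lemma scalar_right: "x \<in> carrier A \<Longrightarrow> x \<otimes> (c \<odot> \<one>) = c \<odot> x"
  by (simp add: smult_mult_right)

lemma right_ideal_vector_space:
  assumes "right_ideal U A"
  shows "complex_vector_space (A\<lparr>carrier := U\<rparr>)"
proof -
  have sub: "x \<in> carrier A" if "x \<in> U" for x using rsubmodule_subset[OF assms] that by auto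
  have sm: "c \<odot> x \<in> U" if "x \<in> U" for c x
    using rsubmodule_ract[OF assms that, of "c \<odot> \<one>"] sub[OF that] by (simp add: scalar_right)
  have "module complex_ring (A\<lparr>carrier := U\<rparr>)"
    by (intro moduleI cring_complex_ring abelian_group_subcarrier right_ideal_subgroup assms
        A.abelian_group_axioms)
      (use sm sub smult_l_distr smult_r_distr smult_assoc1 smult_one in auto)
  then show ?thesis by (simp add: complex_vector_space_def)
qed

text \<open>Schur's lemma.  Left multiplication by \<open>e x e\<close> has an eigenvector \<open>y\<close> in \<open>e A\<close>, and
  \<open>y\<close> generates \<open>e A\<close>; hence \<open>e x e\<close> acts on \<open>e\<close> as a scalar.\<close>

lemma simple_corner_scalar:
  assumes "finite_dim A" "presents A M e v" "simple_rmodule A M" "x \<in> carrier A"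
  shows "\<exists>c. e \<otimes> x \<otimes> e = c \<odot> e"
proof -
  note e = presentsD[OF assms(2)]
  define U where "U = (\<lambda>a. e \<otimes> a) ` carrier A"
  have U: "right_ideal U A"
    using right_module.rsubmodule_orbit[OF A.right_module_regular, of e] e(1) by (simp add: U_def)
  have left_id: "e \<otimes> u = u" "u \<in> carrier A" if "u \<in> U" for u
    using that e(1,2) A.m_assoc[OF e(1) e(1), symmetric] by (auto simp: U_def)
  interpret U: complex_vector_space "A\<lparr>carrier := U\<rparr>"
    by (rule right_ideal_vector_space[OF U])
  have fd: "finite_dim (A\<lparr>carrier := U\<rparr>)"
    by (rule finite_dim_surjective_image[OF complex_vector_space_axioms U.complex_vector_space_axioms
          assms(1), of "\<lambda>a. e \<otimes> a"])
      (use e(1) in \<open>auto simp: U_def A.r_distr smult_mult_right hom_def\<close>)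
  have "e \<in> U" unfolding U_def using e(1,2) by (metis imageI)
  then have nz: "carrier (A\<lparr>carrier := U\<rparr>) \<noteq> {\<zero>\<^bsub>A\<lparr>carrier := U\<rparr>\<^esub>}"
    using presents_nonzero(2)[OF assms(2,3)] by auto
  define T where "T = (\<lambda>u. e \<otimes> x \<otimes> e \<otimes> u)"
  have T: "T u \<in> U" if "u \<in> carrier A" for u
    using that e(1) assms(4) by (auto simp: T_def U_def A.m_assoc)
  obtain k y where y: "y \<in> carrier (A\<lparr>carrier := U\<rparr>)" "y \<noteq> \<zero>\<^bsub>A\<lparr>carrier := U\<rparr>\<^esub>"
      "T y = k \<odot>\<^bsub>A\<lparr>carrier := U\<rparr>\<^esub> y"
  proof (rule U.ex_eigenvector[OF fd nz, of T])
    show "T \<in> additive_maps (A\<lparr>carrier := U\<rparr>) (A\<lparr>carrier := U\<rparr>)"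
      by (rule additive_mapsI) (use T left_id e(1) assms(4) in \<open>auto simp: T_def A.r_distr\<close>)
    show "T (c \<odot>\<^bsub>A\<lparr>carrier := U\<rparr>\<^esub> u) = c \<odot>\<^bsub>A\<lparr>carrier := U\<rparr>\<^esub> T u"
      if "u \<in> carrier (A\<lparr>carrier := U\<rparr>)" for c u
      using that left_id e(1) assms(4) by (auto simp: T_def smult_mult_right)
  qed
  then have y': "y \<in> U" "e \<otimes> y = y" "y \<in> carrier A" "y \<noteq> \<zero>" "T y = k \<odot> y" using left_id by auto
  obtain a where a: "a \<in> carrier A" "y \<otimes> a = e"
    using simple_right_inverse[OF assms(2,3) y'(3)] y' by auto
  have "e \<otimes> x \<otimes> e = T y \<otimes> a"
    using a y'(2,3) e(1) assms(4) unfolding T_def by (simp only: A.m_assoc A.m_closed)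
  also have "\<dots> = k \<odot> e" using a y' by (simp add: smult_mult_left)
  finally show ?thesis by blast
qed

end

definition right_ideal_generated :: "('r, 'x) ring_scheme \<Rightarrow> 'p set \<Rightarrow> ('p \<Rightarrow> 'r) \<Rightarrow> 'r set" where
  "right_ideal_generated R P g = (\<lambda>t. \<Oplus>\<^bsub>R\<^esub>p\<in>P. g p \<otimes>\<^bsub>R\<^esub> t p) ` (P \<rightarrow> carrier R)"

context ring
begin

lemma right_ideal_generatedI:
  "t \<in> P \<rightarrow> carrier R \<Longrightarrow> x = (\<Oplus>p\<in>P. g p \<otimes> t p) \<Longrightarrow> x \<in> right_ideal_generated R P g"
  unfolding right_ideal_generated_def by blast

lemma right_ideal_right_ideal_generated:
  assumes "finite P" "g \<in> P \<rightarrow> carrier R"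
  shows "right_ideal (right_ideal_generated R P g) R"
proof (rule right_idealI)
  have gc: "g p \<in> carrier R" if "p \<in> P" for p using assms(2) that by auto
  show "right_ideal_generated R P g \<subseteq> carrier R"
    using gc by (auto simp: right_ideal_generated_def intro!: finsum_closed)
  have "(\<Oplus>p\<in>P. g p \<otimes> \<zero>) = (\<Oplus>p\<in>P. \<zero>)" by (rule finsum_cong') (use gc in auto)
  then have "\<zero> = (\<Oplus>p\<in>P. g p \<otimes> \<zero>)" by simp
  then show "\<zero> \<in> right_ideal_generated R P g" by (intro right_ideal_generatedI[of "\<lambda>_. \<zero>"]) auto
  fix x assume "x \<in> right_ideal_generated R P g"
  then obtain t where t: "t \<in> P \<rightarrow> carrier R" "x = (\<Oplus>p\<in>P. g p \<otimes> t p)"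
    by (auto simp: right_ideal_generated_def)
  then have tc: "t p \<in> carrier R" if "p \<in> P" for p using that by auto
  show "x \<otimes> a \<in> right_ideal_generated R P g" if a: "a \<in> carrier R" for a
  proof (rule right_ideal_generatedI)
    have "x \<otimes> a = (\<Oplus>p\<in>P. g p \<otimes> t p \<otimes> a)"
      unfolding t(2) by (rule finsum_ldistr) (use assms gc tc a in auto)
    also have "\<dots> = (\<Oplus>p\<in>P. g p \<otimes> (t p \<otimes> a))"
      by (rule finsum_cong') (use gc tc a in \<open>auto simp: m_assoc\<close>)
    finally show "x \<otimes> a = (\<Oplus>p\<in>P. g p \<otimes> (t p \<otimes> a))" .
  qed (use a tc in auto)
  fix y assume "y \<in> right_ideal_generated R P g"
  then obtain u where u: "u \<in> P \<rightarrow> carrier R" "y = (\<Oplus>p\<in>P. g p \<otimes> u p)"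
    by (auto simp: right_ideal_generated_def)
  then have uc: "u p \<in> carrier R" if "p \<in> P" for p using that by auto
  show "x \<oplus> y \<in> right_ideal_generated R P g"
  proof (rule right_ideal_generatedI)
    have "x \<oplus> y = (\<Oplus>p\<in>P. g p \<otimes> t p \<oplus> g p \<otimes> u p)"
      unfolding t(2) u(2) by (rule finsum_addf[symmetric]) (use gc tc uc in auto)
    also have "\<dots> = (\<Oplus>p\<in>P. g p \<otimes> (t p \<oplus> u p))"
      by (rule finsum_cong') (use gc tc uc in \<open>auto simp: r_distr\<close>)
    finally show "x \<oplus> y = (\<Oplus>p\<in>P. g p \<otimes> (t p \<oplus> u p))" .
  qed (use tc uc in auto)
qed

lemma right_ideal_generated_base:
  assumes "finite P" "g \<in> P \<rightarrow> carrier R" "p \<in> P"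
  shows "g p \<in> right_ideal_generated R P g"
proof (rule right_ideal_generatedI)
  show "g p = (\<Oplus>q\<in>P. g q \<otimes> (if q = p then \<one> else \<zero>))"
    using assms by (subst finsum_delta[of P p]) (auto simp: Pi_iff)
qed simp

lemma ex_maximal_right_ideal:
  assumes "right_ideal J R" "\<one> \<notin> J"
  obtains I where "right_ideal I R" "J \<subseteq> I" "\<one> \<notin> I"
    "\<And>K. \<lbrakk>right_ideal K R; I \<subseteq> K; \<one> \<notin> K\<rbrakk> \<Longrightarrow> K = I"
proof -
  define \<I> where "\<I> = {I. right_ideal I R \<and> J \<subseteq> I \<and> \<one> \<notin> I}"
  have "\<exists>I\<in>\<I>. \<forall>K\<in>\<I>. I \<subseteq> K \<longrightarrow> K = I"
  proof (rule subset_Zorn_nonempty)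
    show "\<I> \<noteq> {}" using assms by (auto simp: \<I>_def)
    fix C assume C: "C \<noteq> {}" "subset.chain \<I> C"
    then have mem: "right_ideal I R" "J \<subseteq> I" "\<one> \<notin> I" if "I \<in> C" for I
      using that by (auto simp: subset_chain_def \<I>_def)
    have "right_ideal (\<Union>C) R"
    proof (rule right_idealI)
      show "\<Union>C \<subseteq> carrier R" using mem(1) rsubmodule_subset by fastforce
      show "\<zero> \<in> \<Union>C" using C(1) mem(1) rsubmodule_zero by fastforce
      show "x \<otimes> a \<in> \<Union>C" if "x \<in> \<Union>C" "a \<in> carrier R" for x a
        using that mem(1) rsubmodule_ract by fastforce
      show "x \<oplus> y \<in> \<Union>C" if xy: "x \<in> \<Union>C" "y \<in> \<Union>C" for x y
      proof -
        obtain I K where IK: "I \<in> C" "K \<in> C" "x \<in> I" "y \<in> K" using xy by blast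
        then have "I \<subseteq> K \<or> K \<subseteq> I" using C(2) by (auto simp: subset_chain_def)
        then obtain L where L: "L \<in> C" "x \<in> L" "y \<in> L" using IK by blast
        then show ?thesis using rsubmodule_add[OF mem(1)[OF L(1)] L(2,3)] by auto
      qed
    qed
    then show "\<Union>C \<in> \<I>" using mem(2,3) C(1) by (auto simp: \<I>_def)
  qed
  then obtain I where "I \<in> \<I>" "\<forall>K\<in>\<I>. I \<subseteq> K \<longrightarrow> K = I" by blast
  then have "right_ideal I R" "J \<subseteq> I" "\<one> \<notin> I"
      "\<And>K. \<lbrakk>right_ideal K R; I \<subseteq> K; \<one> \<notin> K\<rbrakk> \<Longrightarrow> K = I"
    by (auto simp: \<I>_def)
  then show thesis by (rule that)
qed

text \<open>For a submodule \<open>T\<close> of the complement \<open>U\<close>, the right ideal \<open>I + T\<close> is either \<open>I\<close>, so that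
  \<open>T = 0\<close>, or contains \<open>\<one> = i + t\<close>, so that \<open>u = t u\<close> for every \<open>u \<in> U\<close>.\<close>

lemma complement_of_maximal_simple:
  assumes I: "right_ideal I R" "\<one> \<notin> I"
    "\<And>K. \<lbrakk>right_ideal K R; I \<subseteq> K; \<one> \<notin> K\<rbrakk> \<Longrightarrow> K = I"
    and U: "right_ideal U R" "complementary (regular_rmodule R) I U"
  shows "simple_rmodule R ((regular_rmodule R)\<lparr>carrier := U\<rparr>)"
proof -
  have IU: "I \<inter> U = {\<zero>}" "carrier R = {i \<oplus> u | i u. i \<in> I \<and> u \<in> U}"
    using U(2) by (auto simp: complementary_def)
  have sub: "I \<subseteq> carrier R" "U \<subseteq> carrier R"
    using rsubmodule_subset[OF I(1)] rsubmodule_subset[OF U(1)] by auto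
  obtain i u where "i \<in> I" "u \<in> U" "\<one> = i \<oplus> u" using IU(2) one_closed by auto
  then have "U \<noteq> {\<zero>}" using I(2) sub by auto
  moreover
  have "T = {\<zero>} \<or> T = U" if T': "rsubmodule T R ((regular_rmodule R)\<lparr>carrier := U\<rparr>)" for T
  proof -
    have TU: "T \<subseteq> U" using rsubmodule_subset[OF T'] by simp
    have T: "right_ideal T R"
      using rsubmodule_zero[OF T'] rsubmodule_add[OF T'] rsubmodule_ract[OF T'] TU sub
      by (intro right_idealI) auto
    define K where "K = {i \<oplus> t | i t. i \<in> I \<and> t \<in> T}"
    have K: "right_ideal K R"
    proof (rule right_idealI)
      show "K \<subseteq> carrier R" using sub TU by (auto simp: K_def)
      show "\<zero> \<in> K" using rsubmodule_zero[OF I(1)] rsubmodule_zero[OF T] by (force simp: K_def)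
      fix x assume "x \<in> K"
      then obtain i t where x: "x = i \<oplus> t" "i \<in> I" "t \<in> T" by (auto simp: K_def)
      then have c: "i \<in> carrier R" "t \<in> carrier R" using sub TU by auto
      show "x \<otimes> a \<in> K" if a: "a \<in> carrier R" for a
      proof -
        have "x \<otimes> a = i \<otimes> a \<oplus> t \<otimes> a" using x c a by (simp add: l_distr)
        moreover have "i \<otimes> a \<in> I" "t \<otimes> a \<in> T"
          using rsubmodule_ract[OF I(1) x(2) a] rsubmodule_ract[OF T x(3) a] by simp_all
        ultimately show ?thesis by (auto simp: K_def)
      qed
      fix y assume "y \<in> K"
      then obtain i' t' where y: "y = i' \<oplus> t'" "i' \<in> I" "t' \<in> T" by (auto simp: K_def)
      then have c': "i' \<in> carrier R" "t' \<in> carrier R" using sub TU by auto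
      have "x \<oplus> y = (i \<oplus> i') \<oplus> (t \<oplus> t')" using x(1) y(1) c c' by (simp add: a_ac)
      moreover have "i \<oplus> i' \<in> I" "t \<oplus> t' \<in> T"
        using rsubmodule_add[OF I(1) x(2) y(2)] rsubmodule_add[OF T x(3) y(3)] by simp_all
      ultimately show "x \<oplus> y \<in> K" by (auto simp: K_def)
    qed
    have IK: "I \<subseteq> K"
    proof
      fix i assume "i \<in> I"
      moreover have "i = i \<oplus> \<zero>" using \<open>i \<in> I\<close> sub by auto
      ultimately show "i \<in> K" using rsubmodule_zero[OF T] unfolding K_def by force
    qed
    show ?thesis
    proof (cases "\<one> \<in> K")
      case False
      then have "K = I" using I(3)[OF K IK] by simp
      have "T \<subseteq> I"
      proof
        fix t assume "t \<in> T"
        moreover have "t = \<zero> \<oplus> t" using \<open>t \<in> T\<close> TU sub by auto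
        ultimately show "t \<in> I"
          using rsubmodule_zero[OF I(1)] \<open>K = I\<close> unfolding K_def by force
      qed
      then have "T \<subseteq> {\<zero>}" using TU IU(1) by blast
      then show ?thesis using rsubmodule_zero[OF T] by auto
    next
      case True
      then obtain i t where it: "\<one> = i \<oplus> t" "i \<in> I" "t \<in> T" by (auto simp: K_def)
      then have c: "i \<in> carrier R" "t \<in> carrier R" using sub TU by auto
      have "u \<in> T" if u: "u \<in> U" for u
      proof -
        have uc: "u \<in> carrier R" using u sub by auto
        have tu: "t \<otimes> u \<in> T" using rsubmodule_ract[OF T it(3) uc] by simp
        have eq: "u = i \<otimes> u \<oplus> t \<otimes> u" using l_one[OF uc] c uc by (simp add: it(1) l_distr)
        have "i \<otimes> u = i \<otimes> u \<oplus> t \<otimes> u \<ominus> t \<otimes> u"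
          using c uc by (simp add: a_minus_def a_assoc r_neg)
        then have "i \<otimes> u = u \<ominus> t \<otimes> u" using eq by simp
        also have "\<dots> \<in> U" using tu TU u by (intro right_ideal_diff[OF U(1)]) auto
        finally have "i \<otimes> u \<in> I \<inter> U"
          using rsubmodule_ract[OF I(1) it(2) uc] by simp
        then have "i \<otimes> u = \<zero>" using IU(1) by blast
        then show ?thesis using eq tu c uc by simp
      qed
      then show ?thesis using TU by blast
    qed
  qed
  ultimately show ?thesis
    using right_module.right_module_rsubmodule[OF right_module_regular U(1)]
    by (simp add: simple_rmodule_def)
qed

end

text \<open>The same module with every element \<open>x\<close> replaced by \<open>{x}\<close>; this moves a right ideal to the
  type over which simple modules are classified.\<close>

definition singleton_rmodule :: "('r, 'm, 'y) rmodule_scheme \<Rightarrow> ('r, 'm set) rmodule" where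
  "singleton_rmodule M = \<lparr>carrier = (\<lambda>x. {x}) ` carrier M, monoid.mult = undefined, one = undefined,
     ring.zero = {\<zero>\<^bsub>M\<^esub>}, ring.add = (\<lambda>X Y. {the_elem X \<oplus>\<^bsub>M\<^esub> the_elem Y}),
     ract = (\<lambda>X a. {the_elem X \<lhd>\<^bsub>M\<^esub> a})\<rparr>"

lemma simple_singleton_rmodule:
  assumes "simple_rmodule R M"
  shows "simple_rmodule R (singleton_rmodule M)"
proof -
  interpret right_module R M using simple_rmoduleD(1)[OF assms] .
  have ab: "abelian_group (singleton_rmodule M)"
  proof (rule abelian_groupI)
    fix X assume "X \<in> carrier (singleton_rmodule M)"
    then obtain x where "X = {x}" "x \<in> carrier M" by (auto simp: singleton_rmodule_def)
    then show "\<exists>Y\<in>carrier (singleton_rmodule M).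
        Y \<oplus>\<^bsub>singleton_rmodule M\<^esub> X = \<zero>\<^bsub>singleton_rmodule M\<^esub>"
      by (intro bexI[of _ "{\<ominus>\<^bsub>M\<^esub> x}"]) (auto simp: singleton_rmodule_def M.l_neg)
  qed (auto simp: singleton_rmodule_def M.a_assoc intro: M.a_comm)
  have "right_module R (singleton_rmodule M)"
    by (intro right_module.intro right_module_axioms.intro R.ring_axioms ab)
      (auto simp: singleton_rmodule_def ract_closed ract_add ract_add_scalar ract_mult ract_one)
  then show ?thesis
    by (rule simple_rmodule_iso[OF assms, of _ "\<lambda>x. {x}"])
      (auto simp: rmod_hom_def hom_def bij_betw_def singleton_rmodule_def)
qed

text \<open>Since \<open>X\<close> spans \<open>A\<close>, the right ideal generated by the elements \<open>x e\<^sub>i\<close> contains \<open>A e\<^sub>i\<close>.  If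
  it were proper, a complement of a maximal right ideal containing it would be a simple module on
  which every \<open>e\<^sub>i\<close> acts as zero; but \<open>e\<^sub>i\<close> does not act as zero on \<open>V\<^sub>i\<close>.\<close>

lemma one_in_ideal_of_idempotents:
  assumes A: "fd_semisimple_algebra A" and reps: "simple_reps A s V"
    and e: "\<And>i. i < s \<Longrightarrow> presents A (V i) (e i) (v i)"
    and X: "finite X" "X \<subseteq> carrier A" "\<forall>y\<in>carrier A. \<exists>c. y = (\<Oplus>\<^bsub>A\<^esub>x\<in>X. c x \<odot>\<^bsub>A\<^esub> x)"
  shows "\<one>\<^bsub>A\<^esub> \<in> right_ideal_generated A ({..<s} \<times> X) (\<lambda>p. snd p \<otimes>\<^bsub>A\<^esub> e (fst p))"
proof (rule ccontr)
  interpret complex_algebra A using A by (simp add: fd_semisimple_algebra_def)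
  have ss: "semisimple_ring A" using A by (simp add: fd_semisimple_algebra_def)
  define J where "J = right_ideal_generated A ({..<s} \<times> X) (\<lambda>p. snd p \<otimes>\<^bsub>A\<^esub> e (fst p))"
  assume "\<one>\<^bsub>A\<^esub> \<notin> right_ideal_generated A ({..<s} \<times> X) (\<lambda>p. snd p \<otimes>\<^bsub>A\<^esub> e (fst p))"
  then have one: "\<one>\<^bsub>A\<^esub> \<notin> J" by (simp add: J_def)
  have g: "(\<lambda>p. snd p \<otimes>\<^bsub>A\<^esub> e (fst p)) \<in> ({..<s} \<times> X) \<rightarrow> carrier A"
    using X(2) presentsD(1)[OF e] by (auto intro!: A.m_closed)
  have finP: "finite ({..<s} \<times> X)" using X by simp
  have J: "right_ideal J A"
    unfolding J_def by (rule A.right_ideal_right_ideal_generated[OF finP g])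
  have Je: "u \<otimes>\<^bsub>A\<^esub> e i \<in> J" if u: "u \<in> carrier A" and i: "i < s" for u i
  proof -
    have ei: "e i \<in> carrier A" using presentsD(1)[OF e[OF i]] .
    obtain c where c: "u = (\<Oplus>\<^bsub>A\<^esub>x\<in>X. c x \<odot>\<^bsub>A\<^esub> x)" using X(3) u by blast
    have "u \<otimes>\<^bsub>A\<^esub> e i = (\<Oplus>\<^bsub>A\<^esub>x\<in>X. (c x \<odot>\<^bsub>A\<^esub> x) \<otimes>\<^bsub>A\<^esub> e i)"
      unfolding c using X ei by (intro A.finsum_ldistr) auto
    also have "\<dots> \<in> J"
    proof (rule subgroup_finsum_closed[OF A.abelian_group_axioms right_ideal_subgroup[OF J]],
        rule Pi_I)
      fix x assume x: "x \<in> X"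
      have "x \<otimes>\<^bsub>A\<^esub> e i \<in> J"
        using A.right_ideal_generated_base[OF finP g, of "(i, x)"] x i by (simp add: J_def)
      from rsubmodule_ract[OF J this, of "c x \<odot>\<^bsub>A\<^esub> \<one>\<^bsub>A\<^esub>"]
      show "(c x \<odot>\<^bsub>A\<^esub> x) \<otimes>\<^bsub>A\<^esub> e i \<in> J"
        using x X ei by (auto simp: scalar_right smult_mult_left subset_iff)
    qed
    finally show ?thesis .
  qed
  obtain I where I: "right_ideal I A" "J \<subseteq> I" "\<one>\<^bsub>A\<^esub> \<notin> I"
      "\<And>K. \<lbrakk>right_ideal K A; I \<subseteq> K; \<one>\<^bsub>A\<^esub> \<notin> K\<rbrakk> \<Longrightarrow> K = I"
    by (rule A.ex_maximal_right_ideal[OF J one]) blast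
  obtain U where U: "right_ideal U A" "complementary (regular_rmodule A) I U"
    using ss I(1) by (auto simp: semisimple_ring_def)
  define N where "N = (regular_rmodule A)\<lparr>carrier := U\<rparr>"
  have "simple_rmodule A N"
    unfolding N_def by (rule A.complement_of_maximal_simple[OF I(1,3,4) U])
  then have simp_N: "simple_rmodule A (singleton_rmodule N)" by (rule simple_singleton_rmodule)
  then obtain i where i: "i < s" "rmod_iso A (singleton_rmodule N) (V i)"
    using reps unfolding simple_reps_def by blast
  have Vi: "simple_rmodule A (V i)" using reps i by (simp add: simple_reps_def)
  interpret Vi: right_module A "V i" using simple_rmoduleD(1)[OF Vi] .
  interpret N: right_module A "singleton_rmodule N" using simple_rmoduleD(1)[OF simp_N] .
  obtain h where h: "h \<in> rmod_hom A (singleton_rmodule N) (V i)"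
      "bij_betw h (carrier (singleton_rmodule N)) (carrier (V i))"
    using i(2) unfolding rmod_iso_def by blast
  note ei = presentsD[OF e[OF i(1)]]
  obtain u where u: "u \<in> U" "h {u} = v i"
  proof -
    have "v i \<in> h ` (\<lambda>x. {x}) ` U"
      using ei(3) h(2) by (simp add: bij_betw_def singleton_rmodule_def N_def)
    then show thesis using that by auto
  qed
  have uc: "u \<in> carrier A" using u(1) rsubmodule_subset[OF U(1)] by auto
  have mem: "{u} \<in> carrier (singleton_rmodule N)" "{u \<otimes>\<^bsub>A\<^esub> e i} \<in> carrier (singleton_rmodule N)"
    using u(1) rsubmodule_ract[OF U(1) u(1) ei(1)] by (auto simp: singleton_rmodule_def N_def)
  have "h {u \<otimes>\<^bsub>A\<^esub> e i} = h {u}"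
    using rmod_homD(2)[OF h(1) mem(1) ei(1)] u(2) ei(4) by (simp add: singleton_rmodule_def N_def)
  then have "{u \<otimes>\<^bsub>A\<^esub> e i} = {u}"
    using h(2) mem by (auto simp: bij_betw_def dest: inj_onD)
  then have "u \<otimes>\<^bsub>A\<^esub> e i = u" by simp
  then have "u \<in> I" using Je[OF uc i(1)] I(2) by auto
  then have "u = \<zero>\<^bsub>A\<^esub>" using U(2) u(1) by (auto simp: complementary_def)
  then have "h {u} = \<zero>\<^bsub>V i\<^esub>"
    using additive_zero[OF _ _ rmod_homD(1)[OF h(1)]] N.M.abelian_group_axioms Vi.M.abelian_group_axioms
    by (simp add: singleton_rmodule_def N_def)
  then show False using presents_nonzero(1)[OF e[OF i(1)] Vi] u(2) by simp
qed

section \<open>Full sums of primitive idempotents\<close>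

text \<open>The idempotents \<open>e i\<close> represent the simple modules.  Their sum \<open>\<epsilon>\<close> is an idempotent for which
  \<open>\<epsilon> A \<epsilon>\<close>, the basic algebra of \<open>A\<close>, is a product of copies of the complex numbers.  The
  elements \<open>a p\<close> and \<open>b p\<close> witness that \<open>\<epsilon>\<close> is full, that is, \<open>A \<epsilon> A = A\<close>.\<close>

locale corner_system = complex_algebra A for A :: "(complex, 'a, 'x) module_scheme" (structure) +
  fixes s :: nat and e :: "nat \<Rightarrow> 'a" and P :: "'p set" and a b :: "'p \<Rightarrow> 'a"
  assumes finite_P: "finite P"
    and e_closed: "i < s \<Longrightarrow> e i \<in> carrier A"
    and e_nonzero: "i < s \<Longrightarrow> e i \<noteq> \<zero>"
    and e_idem: "i < s \<Longrightarrow> e i \<otimes> e i = e i"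
    and e_orth: "\<lbrakk>i < s; j < s; i \<noteq> j; x \<in> carrier A\<rbrakk> \<Longrightarrow> e i \<otimes> x \<otimes> e j = \<zero>"
    and e_scalar: "\<lbrakk>i < s; x \<in> carrier A\<rbrakk> \<Longrightarrow> \<exists>c. e i \<otimes> x \<otimes> e i = c \<odot> e i"
    and a_closed: "p \<in> P \<Longrightarrow> a p \<in> carrier A"
    and b_closed: "p \<in> P \<Longrightarrow> b p \<in> carrier A"
    and sum_ab: "(\<Oplus>p\<in>P. a p \<otimes> b p) = \<one>"
    and ab_corner: "p \<in> P \<Longrightarrow> \<exists>i<s. a p \<otimes> e i = a p \<and> e i \<otimes> b p = b p"
begin

definition \<epsilon> :: 'a where "\<epsilon> = (\<Oplus>i\<in>{..<s}. e i)"

lemma eps_closed: "\<epsilon> \<in> carrier A"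
  unfolding \<epsilon>_def by (rule A.finsum_closed) (auto simp: e_closed)

lemma e_orth': "\<lbrakk>i < s; j < s; i \<noteq> j\<rbrakk> \<Longrightarrow> e i \<otimes> e j = \<zero>"
  using e_orth[of i j \<one>] by (simp add: e_closed)

lemma e_eps: "i < s \<Longrightarrow> e i \<otimes> \<epsilon> = e i"
  unfolding \<epsilon>_def
  by (subst A.finsum_rdistr)
    (auto simp: e_closed e_orth' e_idem intro!: trans[OF A.finsum_delta[of _ i]])

lemma eps_e: "i < s \<Longrightarrow> \<epsilon> \<otimes> e i = e i"
  unfolding \<epsilon>_def
  by (subst A.finsum_ldistr)
    (auto simp: e_closed e_orth' e_idem intro!: trans[OF A.finsum_delta[of _ i]])

lemma a_eps: "p \<in> P \<Longrightarrow> a p \<otimes> \<epsilon> = a p"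
  using ab_corner[of p] a_closed[of p] e_closed eps_closed e_eps by (metis A.m_assoc)

lemma eps_b: "p \<in> P \<Longrightarrow> \<epsilon> \<otimes> b p = b p"
  using ab_corner[of p] b_closed[of p] e_closed eps_closed eps_e by (metis A.m_assoc)

lemma e_corner:
  assumes "i < s" "x \<in> carrier A"
  shows "e i \<otimes> (\<epsilon> \<otimes> x \<otimes> \<epsilon>) = e i \<otimes> x \<otimes> e i"
proof -
  have "e i \<otimes> (\<epsilon> \<otimes> x \<otimes> \<epsilon>) = e i \<otimes> x \<otimes> \<epsilon>"
    using assms e_eps[OF assms(1)] e_closed eps_closed by (metis A.m_assoc A.m_closed)
  also have "\<dots> = (\<Oplus>j\<in>{..<s}. e i \<otimes> x \<otimes> e j)"
    unfolding \<epsilon>_def by (rule A.finsum_rdistr) (use assms in \<open>auto simp: e_closed\<close>)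
  also have "\<dots> = e i \<otimes> x \<otimes> e i"
    by (rule A.finsum_delta) (use assms e_orth in \<open>auto simp: e_closed\<close>)
  finally show ?thesis .
qed

lemma corner_e:
  assumes "i < s" "x \<in> carrier A"
  shows "(\<epsilon> \<otimes> x \<otimes> \<epsilon>) \<otimes> e i = e i \<otimes> x \<otimes> e i"
proof -
  have "(\<epsilon> \<otimes> x \<otimes> \<epsilon>) \<otimes> e i = \<epsilon> \<otimes> (x \<otimes> e i)"
    using assms eps_e[OF assms(1)] e_closed eps_closed by (metis A.m_assoc A.m_closed)
  also have "\<dots> = (\<Oplus>j\<in>{..<s}. e j \<otimes> (x \<otimes> e i))"
    unfolding \<epsilon>_def by (rule A.finsum_ldistr) (use assms in \<open>auto simp: e_closed\<close>)
  also have "\<dots> = e i \<otimes> (x \<otimes> e i)"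
    by (rule A.finsum_delta)
      (use assms e_orth in \<open>auto simp: e_closed A.m_assoc[symmetric]\<close>)
  finally show ?thesis using assms by (simp add: A.m_assoc e_closed)
qed

lemma sum_ab_right: "x \<in> carrier A \<Longrightarrow> x = (\<Oplus>p\<in>P. x \<otimes> a p \<otimes> b p)"
proof -
  assume x: "x \<in> carrier A"
  have "x = x \<otimes> (\<Oplus>p\<in>P. a p \<otimes> b p)" using x by (simp add: sum_ab)
  also have "\<dots> = (\<Oplus>p\<in>P. x \<otimes> (a p \<otimes> b p))"
    by (rule A.finsum_rdistr) (auto simp: finite_P x a_closed b_closed)
  also have "\<dots> = (\<Oplus>p\<in>P. x \<otimes> a p \<otimes> b p)"
    by (rule A.finsum_cong') (auto simp: x a_closed b_closed A.m_assoc)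
  finally show ?thesis .
qed

lemma sum_ab_left: "x \<in> carrier A \<Longrightarrow> x = (\<Oplus>p\<in>P. a p \<otimes> (b p \<otimes> x))"
proof -
  assume x: "x \<in> carrier A"
  have "x = (\<Oplus>p\<in>P. a p \<otimes> b p) \<otimes> x" using x by (simp add: sum_ab)
  also have "\<dots> = (\<Oplus>p\<in>P. a p \<otimes> b p \<otimes> x)"
    by (rule A.finsum_ldistr) (auto simp: finite_P x a_closed b_closed)
  also have "\<dots> = (\<Oplus>p\<in>P. a p \<otimes> (b p \<otimes> x))"
    by (rule A.finsum_cong') (auto simp: x a_closed b_closed A.m_assoc)
  finally show ?thesis .
qed

lemma sum_ab_ract:
  assumes "right_module A D" "d \<in> carrier D"
  shows "d = (\<Oplus>\<^bsub>D\<^esub>p\<in>P. d \<lhd>\<^bsub>D\<^esub> a p \<lhd>\<^bsub>D\<^esub> b p)"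
proof -
  interpret D: right_module A D by fact
  have "d = d \<lhd>\<^bsub>D\<^esub> (\<Oplus>p\<in>P. a p \<otimes> b p)" using assms(2) by (simp add: sum_ab D.ract_one)
  also have "\<dots> = (\<Oplus>\<^bsub>D\<^esub>p\<in>P. d \<lhd>\<^bsub>D\<^esub> (a p \<otimes> b p))"
    using additive_finsum[OF A.abelian_group_axioms D.M.abelian_group_axioms
        D.additive_ract_scalar[OF assms(2)], of "\<lambda>p. a p \<otimes> b p" P] a_closed b_closed by auto
  also have "\<dots> = (\<Oplus>\<^bsub>D\<^esub>p\<in>P. d \<lhd>\<^bsub>D\<^esub> a p \<lhd>\<^bsub>D\<^esub> b p)"
    by (rule D.M.finsum_cong') (auto simp: assms(2) a_closed b_closed D.ract_mult D.ract_closed)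
  finally show ?thesis .
qed

text \<open>Since \<open>\<epsilon>\<close> is a full idempotent, a homomorphism between the modules \<open>D \<epsilon>\<close> and \<open>D' \<epsilon>\<close> over
  \<open>\<epsilon> A \<epsilon>\<close> extends to \<open>D\<close> (Morita theory).  The extension is well behaved because
  \<open>x a\<^sub>p = \<Sum>\<^sub>q a\<^sub>q (b\<^sub>q x a\<^sub>p)\<close> with \<open>b\<^sub>q x a\<^sub>p \<in> \<epsilon> A \<epsilon>\<close>.\<close>

definition extension :: "('m \<Rightarrow> 'n) \<Rightarrow> ('a, 'm, 'y) rmodule_scheme \<Rightarrow> ('a, 'n, 'z) rmodule_scheme
    \<Rightarrow> 'm \<Rightarrow> 'n" where
  "extension h D D' d = (\<Oplus>\<^bsub>D'\<^esub>p\<in>P. h (d \<lhd>\<^bsub>D\<^esub> a p) \<lhd>\<^bsub>D'\<^esub> b p)"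

context
  fixes D :: "('a, 'm, 'y) rmodule_scheme" and D' :: "('a, 'n, 'z) rmodule_scheme" and h :: "'m \<Rightarrow> 'n"
  assumes D: "right_module A D" and D': "right_module A D'" and h: "h \<in> additive_maps D D'"
    and h_corner: "\<And>d x. \<lbrakk>d \<in> carrier D; x \<in> carrier A\<rbrakk> \<Longrightarrow>
      h (d \<lhd>\<^bsub>D\<^esub> (\<epsilon> \<otimes> x \<otimes> \<epsilon>)) = h d \<lhd>\<^bsub>D'\<^esub> (\<epsilon> \<otimes> x \<otimes> \<epsilon>)"
begin

interpretation D: right_module A D by (fact D)
interpretation D': right_module A D' by (fact D')

lemma extension_additive: "extension h D D' \<in> additive_maps D D'"
  unfolding extension_def[abs_def]
  by (intro additive_finsum_maps D.M.abelian_group_axioms D'.M.abelian_group_axioms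
      additive_comp[OF _ D'.additive_ract] additive_comp[OF D.additive_ract h])
    (auto simp: a_closed b_closed)

lemma extension_hom: "extension h D D' \<in> rmod_hom A D D'"
proof -
  have "extension h D D' (d \<lhd>\<^bsub>D\<^esub> x) = extension h D D' d \<lhd>\<^bsub>D'\<^esub> x"
    if d: "d \<in> carrier D" and x: "x \<in> carrier A" for d x
  proof -
    have hc: "h m \<in> carrier D'" if "m \<in> carrier D" for m using additive_closed[OF h that] .
    have t: "b q \<otimes> x \<otimes> a p \<in> carrier A" "\<epsilon> \<otimes> (b q \<otimes> x \<otimes> a p) \<otimes> \<epsilon> = b q \<otimes> x \<otimes> a p"
      if "p \<in> P" "q \<in> P" for p q
      using that x a_closed b_closed eps_closed a_eps[OF that(1)] eps_b[OF that(2)]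
      by (auto simp: A.m_assoc) (metis A.m_assoc A.m_closed)
    have step: "h (d \<lhd>\<^bsub>D\<^esub> x \<lhd>\<^bsub>D\<^esub> a p) \<lhd>\<^bsub>D'\<^esub> b p
        = (\<Oplus>\<^bsub>D'\<^esub>q\<in>P. h (d \<lhd>\<^bsub>D\<^esub> a q) \<lhd>\<^bsub>D'\<^esub> (b q \<otimes> x \<otimes> a p \<otimes> b p))" if p: "p \<in> P" for p
    proof -
      have "d \<lhd>\<^bsub>D\<^esub> x \<lhd>\<^bsub>D\<^esub> a p = d \<lhd>\<^bsub>D\<^esub> (x \<otimes> a p)"
        using d x p by (simp add: D.ract_mult a_closed)
      also have "\<dots> = d \<lhd>\<^bsub>D\<^esub> (\<Oplus>q\<in>P. a q \<otimes> (b q \<otimes> (x \<otimes> a p)))"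
        using sum_ab_left[of "x \<otimes> a p"] x p a_closed by simp
      also have "\<dots> = (\<Oplus>\<^bsub>D\<^esub>q\<in>P. d \<lhd>\<^bsub>D\<^esub> (a q \<otimes> (b q \<otimes> (x \<otimes> a p))))"
        using additive_finsum[OF A.abelian_group_axioms D.M.abelian_group_axioms
            D.additive_ract_scalar[OF d], of "\<lambda>q. a q \<otimes> (b q \<otimes> (x \<otimes> a p))" P] a_closed b_closed x p
        by auto
      also have "\<dots> = (\<Oplus>\<^bsub>D\<^esub>q\<in>P. d \<lhd>\<^bsub>D\<^esub> a q \<lhd>\<^bsub>D\<^esub> (b q \<otimes> x \<otimes> a p))"
        by (rule D.M.finsum_cong')
          (use d x p in \<open>auto simp: a_closed b_closed A.m_assoc D.ract_mult[symmetric] D.ract_closed\<close>)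
      finally have "h (d \<lhd>\<^bsub>D\<^esub> x \<lhd>\<^bsub>D\<^esub> a p) \<lhd>\<^bsub>D'\<^esub> b p
          = h (\<Oplus>\<^bsub>D\<^esub>q\<in>P. d \<lhd>\<^bsub>D\<^esub> a q \<lhd>\<^bsub>D\<^esub> (b q \<otimes> x \<otimes> a p)) \<lhd>\<^bsub>D'\<^esub> b p" by simp
      also have "\<dots> = (\<Oplus>\<^bsub>D'\<^esub>q\<in>P. h (d \<lhd>\<^bsub>D\<^esub> a q \<lhd>\<^bsub>D\<^esub> (b q \<otimes> x \<otimes> a p)) \<lhd>\<^bsub>D'\<^esub> b p)"
        by (rule additive_finsum[OF D.M.abelian_group_axioms D'.M.abelian_group_axioms
              additive_comp[OF h D'.additive_ract]])
          (use d t p in \<open>auto simp: a_closed b_closed D.ract_closed\<close>)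
      also have "\<dots> = (\<Oplus>\<^bsub>D'\<^esub>q\<in>P. h (d \<lhd>\<^bsub>D\<^esub> a q) \<lhd>\<^bsub>D'\<^esub> (b q \<otimes> x \<otimes> a p \<otimes> b p))"
      proof (rule D'.M.finsum_cong')
        fix q assume q: "q \<in> P"
        have "h (d \<lhd>\<^bsub>D\<^esub> a q \<lhd>\<^bsub>D\<^esub> (b q \<otimes> x \<otimes> a p)) = h (d \<lhd>\<^bsub>D\<^esub> a q) \<lhd>\<^bsub>D'\<^esub> (b q \<otimes> x \<otimes> a p)"
          using h_corner[of "d \<lhd>\<^bsub>D\<^esub> a q" "b q \<otimes> x \<otimes> a p"] t[OF p q] d q
          by (simp add: a_closed D.ract_closed)
        then show "h (d \<lhd>\<^bsub>D\<^esub> a q \<lhd>\<^bsub>D\<^esub> (b q \<otimes> x \<otimes> a p)) \<lhd>\<^bsub>D'\<^esub> b p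
            = h (d \<lhd>\<^bsub>D\<^esub> a q) \<lhd>\<^bsub>D'\<^esub> (b q \<otimes> x \<otimes> a p \<otimes> b p)"
          using t(1)[OF p q] d q p by (simp add: D'.ract_mult a_closed b_closed D.ract_closed hc)
      qed (use d t p in \<open>auto simp: a_closed b_closed D.ract_closed D'.ract_closed hc\<close>)
      finally show ?thesis .
    qed
    have "extension h D D' (d \<lhd>\<^bsub>D\<^esub> x)
        = (\<Oplus>\<^bsub>D'\<^esub>p\<in>P. \<Oplus>\<^bsub>D'\<^esub>q\<in>P. h (d \<lhd>\<^bsub>D\<^esub> a q) \<lhd>\<^bsub>D'\<^esub> (b q \<otimes> x \<otimes> a p \<otimes> b p))"
      unfolding extension_def
      by (rule D'.M.finsum_cong')
        (use d t in \<open>auto simp: step a_closed b_closed D.ract_closed D'.ract_closed hc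
          intro!: D'.M.finsum_closed\<close>)
    also have "\<dots> = (\<Oplus>\<^bsub>D'\<^esub>q\<in>P. \<Oplus>\<^bsub>D'\<^esub>p\<in>P. h (d \<lhd>\<^bsub>D\<^esub> a q) \<lhd>\<^bsub>D'\<^esub> (b q \<otimes> x \<otimes> a p \<otimes> b p))"
      by (rule D'.M.finsum_swap[OF finite_P finite_P])
        (use d x in \<open>auto simp: a_closed b_closed D.ract_closed D'.ract_closed hc\<close>)
    also have "\<dots> = (\<Oplus>\<^bsub>D'\<^esub>q\<in>P. h (d \<lhd>\<^bsub>D\<^esub> a q) \<lhd>\<^bsub>D'\<^esub> b q \<lhd>\<^bsub>D'\<^esub> x)"
    proof (rule D'.M.finsum_cong')
      fix q assume q: "q \<in> P"
      have c: "h (d \<lhd>\<^bsub>D\<^esub> a q) \<in> carrier D'" using d q by (simp add: hc D.ract_closed a_closed)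
      have "(\<Oplus>\<^bsub>D'\<^esub>p\<in>P. h (d \<lhd>\<^bsub>D\<^esub> a q) \<lhd>\<^bsub>D'\<^esub> (b q \<otimes> x \<otimes> a p \<otimes> b p))
          = h (d \<lhd>\<^bsub>D\<^esub> a q) \<lhd>\<^bsub>D'\<^esub> (\<Oplus>p\<in>P. b q \<otimes> x \<otimes> a p \<otimes> b p)"
        by (rule additive_finsum[OF A.abelian_group_axioms D'.M.abelian_group_axioms
            D'.additive_ract_scalar[OF c], symmetric])
          (use x q in \<open>auto simp: a_closed b_closed\<close>)
      also have "\<dots> = h (d \<lhd>\<^bsub>D\<^esub> a q) \<lhd>\<^bsub>D'\<^esub> (b q \<otimes> x)"
        using sum_ab_right[of "b q \<otimes> x"] x q b_closed by simp
      also have "\<dots> = h (d \<lhd>\<^bsub>D\<^esub> a q) \<lhd>\<^bsub>D'\<^esub> b q \<lhd>\<^bsub>D'\<^esub> x"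
        using x q c by (simp add: D'.ract_mult b_closed)
      finally show "(\<Oplus>\<^bsub>D'\<^esub>p\<in>P. h (d \<lhd>\<^bsub>D\<^esub> a q) \<lhd>\<^bsub>D'\<^esub> (b q \<otimes> x \<otimes> a p \<otimes> b p))
          = h (d \<lhd>\<^bsub>D\<^esub> a q) \<lhd>\<^bsub>D'\<^esub> b q \<lhd>\<^bsub>D'\<^esub> x" .
    qed (use d x in \<open>auto simp: a_closed b_closed D.ract_closed D'.ract_closed hc\<close>)
    also have "\<dots> = extension h D D' d \<lhd>\<^bsub>D'\<^esub> x"
      unfolding extension_def
      by (rule additive_finsum[OF D'.M.abelian_group_axioms D'.M.abelian_group_axioms
            D'.additive_ract[OF x], symmetric])
        (use d in \<open>auto simp: a_closed b_closed D.ract_closed D'.ract_closed hc\<close>)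
    finally show ?thesis .
  qed
  then show ?thesis using extension_additive by (simp add: rmod_hom_def)
qed

lemma extension_corner:
  assumes d: "d \<in> carrier D" "d \<lhd>\<^bsub>D\<^esub> \<epsilon> = d"
  shows "extension h D D' d = h d \<lhd>\<^bsub>D'\<^esub> \<epsilon>"
proof -
  have hd: "h d \<in> carrier D'" using additive_closed[OF h d(1)] .
  have "h (d \<lhd>\<^bsub>D\<^esub> a p) \<lhd>\<^bsub>D'\<^esub> b p = h d \<lhd>\<^bsub>D'\<^esub> (\<epsilon> \<otimes> a p \<otimes> b p)" if p: "p \<in> P" for p
  proof -
    have "d \<lhd>\<^bsub>D\<^esub> a p = d \<lhd>\<^bsub>D\<^esub> \<epsilon> \<lhd>\<^bsub>D\<^esub> a p" by (simp add: d(2))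
    also have "\<dots> = d \<lhd>\<^bsub>D\<^esub> (\<epsilon> \<otimes> a p \<otimes> \<epsilon>)"
      using d(1) p a_eps[OF p] by (simp add: D.ract_mult[symmetric] eps_closed a_closed A.m_assoc)
    finally have "h (d \<lhd>\<^bsub>D\<^esub> a p) = h d \<lhd>\<^bsub>D'\<^esub> (\<epsilon> \<otimes> a p \<otimes> \<epsilon>)"
      using h_corner[OF d(1) a_closed[OF p]] by simp
    also have "\<epsilon> \<otimes> a p \<otimes> \<epsilon> = \<epsilon> \<otimes> a p"
      using p a_eps[OF p] by (simp add: eps_closed a_closed A.m_assoc)
    finally show ?thesis
      using p hd by (simp add: D'.ract_mult[symmetric] eps_closed a_closed b_closed)
  qed
  then have "extension h D D' d = (\<Oplus>\<^bsub>D'\<^esub>p\<in>P. h d \<lhd>\<^bsub>D'\<^esub> (\<epsilon> \<otimes> a p \<otimes> b p))"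
    unfolding extension_def
    by (intro D'.M.finsum_cong') (use hd in \<open>auto simp: D'.ract_closed eps_closed a_closed b_closed\<close>)
  also have "\<dots> = h d \<lhd>\<^bsub>D'\<^esub> (\<Oplus>p\<in>P. \<epsilon> \<otimes> a p \<otimes> b p)"
    by (rule additive_finsum[OF A.abelian_group_axioms D'.M.abelian_group_axioms
        D'.additive_ract_scalar[OF hd], symmetric]) (auto simp: a_closed b_closed eps_closed)
  also have "\<dots> = h d \<lhd>\<^bsub>D'\<^esub> \<epsilon>" using sum_ab_right[OF eps_closed] by simp
  finally show ?thesis .
qed

end

end

theorem ex_corner_system:
  fixes A :: "(complex, 'a, 'x) module_scheme" and V :: "nat \<Rightarrow> ('a, 'v) rmodule"
  assumes A: "fd_semisimple_algebra A" and reps: "simple_reps A s V"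
  obtains e v and P :: "(nat \<times> 'a) set" and a b
  where "corner_system A s e P a b" "\<And>i. i < s \<Longrightarrow> presents A (V i) (e i) (v i)"
proof -
  interpret complex_algebra A using A by (simp add: fd_semisimple_algebra_def)
  have ss: "semisimple_ring A" and fd: "finite_dim A"
    using A by (simp_all add: fd_semisimple_algebra_def)
  have V: "simple_rmodule A (V i)" if "i < s" for i using reps that by (simp add: simple_reps_def)
  have "\<forall>i. \<exists>e v. i < s \<longrightarrow> presents A (V i) e v" using ex_presents[OF ss V] by blast
  then obtain e v where e: "presents A (V i) (e i) (v i)" if "i < s" for i by metis
  obtain X where X: "finite X" "X \<subseteq> carrier A"
      "\<forall>y\<in>carrier A. \<exists>c. y = (\<Oplus>\<^bsub>A\<^esub>x\<in>X. c x \<odot>\<^bsub>A\<^esub> x)"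
    using fd by (auto simp: finite_dim_def)
  define P where "P = {..<s} \<times> X"
  define a where "a = (\<lambda>p. snd p \<otimes>\<^bsub>A\<^esub> e (fst p))"
  obtain t where t: "t \<in> P \<rightarrow> carrier A" "\<one>\<^bsub>A\<^esub> = (\<Oplus>\<^bsub>A\<^esub>p\<in>P. a p \<otimes>\<^bsub>A\<^esub> t p)"
    using one_in_ideal_of_idempotents[OF A reps e X]
    unfolding right_ideal_generated_def P_def a_def by auto
  define b where "b = (\<lambda>p. e (fst p) \<otimes>\<^bsub>A\<^esub> t p)"
  note eD = presentsD[OF e]
  have mem: "fst p < s" "snd p \<in> carrier A" "t p \<in> carrier A" if "p \<in> P" for p
    using that X(2) t(1) by (auto simp: P_def)
  have ae: "a p \<otimes>\<^bsub>A\<^esub> e (fst p) = a p" if "p \<in> P" for p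
    using mem[OF that] eD(1,2) by (simp add: a_def A.m_assoc)
  have eb: "e (fst p) \<otimes>\<^bsub>A\<^esub> b p = b p" if "p \<in> P" for p
    using mem[OF that] eD(1,2) by (simp add: b_def A.m_assoc[symmetric])
  have ab: "a p \<otimes>\<^bsub>A\<^esub> b p = a p \<otimes>\<^bsub>A\<^esub> t p" if "p \<in> P" for p
  proof -
    have c: "a p \<in> carrier A" "e (fst p) \<in> carrier A" using mem[OF that] eD(1) by (auto simp: a_def)
    show ?thesis using A.m_assoc[OF c mem(3)[OF that]] ae[OF that] by (simp add: b_def)
  qed
  have "corner_system A s e P a b"
  proof (intro corner_system.intro corner_system_axioms.intro complex_algebra_axioms)
    show "finite P" using X by (simp add: P_def)
    show "e i \<in> carrier A" "e i \<otimes>\<^bsub>A\<^esub> e i = e i" if "i < s" for i using eD(1,2) that by auto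
    show "e i \<noteq> \<zero>\<^bsub>A\<^esub>" if "i < s" for i using presents_nonzero(2)[OF e[OF that] V[OF that]] .
    show "e i \<otimes>\<^bsub>A\<^esub> x \<otimes>\<^bsub>A\<^esub> e j = \<zero>\<^bsub>A\<^esub>" if "i < s" "j < s" "i \<noteq> j" "x \<in> carrier A" for i j x
    proof (rule ccontr)
      assume "e i \<otimes>\<^bsub>A\<^esub> x \<otimes>\<^bsub>A\<^esub> e j \<noteq> \<zero>\<^bsub>A\<^esub>"
      then have "rmod_iso A (V j) (V i)"
        using presents_iso[OF e[OF that(1)] V[OF that(1)] e[OF that(2)] V[OF that(2)] that(4)] by blast
      then show False using reps that by (auto simp: simple_reps_def)
    qed
    show "\<exists>c. e i \<otimes>\<^bsub>A\<^esub> x \<otimes>\<^bsub>A\<^esub> e i = c \<odot>\<^bsub>A\<^esub> e i" if "i < s" "x \<in> carrier A" for i x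
      using simple_corner_scalar[OF fd e[OF that(1)] V[OF that(1)] that(2)] .
    show "a p \<in> carrier A" "b p \<in> carrier A" if "p \<in> P" for p
      using mem[OF that] eD(1) by (auto simp: a_def b_def)
    then show "(\<Oplus>\<^bsub>A\<^esub>p\<in>P. a p \<otimes>\<^bsub>A\<^esub> b p) = \<one>\<^bsub>A\<^esub>"
      unfolding t(2) by (intro A.finsum_cong') (use ab mem in auto)
    show "\<exists>i<s. a p \<otimes>\<^bsub>A\<^esub> e i = a p \<and> e i \<otimes>\<^bsub>A\<^esub> b p = b p" if "p \<in> P" for p
      using mem[OF that] ae[OF that] eb[OF that] by blast
  qed
  with e that show thesis by blast
qed

section \<open>Bimodules over a semisimple complex algebra\<close>

definition opposite :: "('r, 'x) ring_scheme \<Rightarrow> ('r, 'x) ring_scheme" where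
  "opposite R = R\<lparr>monoid.mult := \<lambda>x y. y \<otimes>\<^bsub>R\<^esub> x\<rparr>"

lemma opposite_simps [simp]:
  "carrier (opposite R) = carrier R" "x \<otimes>\<^bsub>opposite R\<^esub> y = y \<otimes>\<^bsub>R\<^esub> x" "\<one>\<^bsub>opposite R\<^esub> = \<one>\<^bsub>R\<^esub>"
  "\<zero>\<^bsub>opposite R\<^esub> = \<zero>\<^bsub>R\<^esub>" "x \<oplus>\<^bsub>opposite R\<^esub> y = x \<oplus>\<^bsub>R\<^esub> y"
  by (simp_all add: opposite_def)

lemma smult_opposite [simp]: "c \<odot>\<^bsub>opposite A\<^esub> x = c \<odot>\<^bsub>A\<^esub> x"
  by (simp add: opposite_def)

lemma finsum_opposite [simp]: "finsum (opposite R) f I = finsum R f I"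
  by (simp add: opposite_def finsum_def)

lemma (in ring) ring_opposite: "ring (opposite R)"
proof (rule ringI)
  show "abelian_group (opposite R)"
    by (rule abelian_groupI) (auto simp: a_assoc intro: a_comm l_neg)
  show "Group.monoid (opposite R)"
    by (rule monoidI) (auto simp: m_assoc)
qed (auto simp: l_distr r_distr)

lemma (in complex_algebra) complex_algebra_opposite: "complex_algebra (opposite A)"
proof -
  interpret op: ring "opposite A" by (rule A.ring_opposite)
  have "module complex_ring (opposite A)"
    by (rule moduleI[OF cring_complex_ring op.abelian_group_axioms])
      (use smult_l_distr smult_r_distr smult_assoc1 smult_one in auto)
  then show ?thesis
    by (intro complex_algebra.intro complex_algebra_axioms.intro op.ring_axioms)
      (auto simp: smult_mult_left smult_mult_right)
qed

lemma (in corner_system) corner_system_opposite: "corner_system (opposite A) s e P b a"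
proof (intro corner_system.intro corner_system_axioms.intro complex_algebra_opposite)
  show "e i \<otimes>\<^bsub>opposite A\<^esub> x \<otimes>\<^bsub>opposite A\<^esub> e j = \<zero>\<^bsub>opposite A\<^esub>"
    if "i < s" "j < s" "i \<noteq> j" "x \<in> carrier (opposite A)" for i j x
    using e_orth[of j i x] that by (simp add: e_closed A.m_assoc)
  show "\<exists>c. e i \<otimes>\<^bsub>opposite A\<^esub> x \<otimes>\<^bsub>opposite A\<^esub> e i = c \<odot>\<^bsub>opposite A\<^esub> e i"
    if "i < s" "x \<in> carrier (opposite A)" for i x
    using e_scalar[of i x] that by (simp add: e_closed A.m_assoc)
  show "\<exists>i<s. b p \<otimes>\<^bsub>opposite A\<^esub> e i = b p \<and> e i \<otimes>\<^bsub>opposite A\<^esub> a p = a p" if "p \<in> P" for p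
    using ab_corner[OF that] by auto
qed (simp_all add: finite_P e_closed e_nonzero e_idem a_closed b_closed sum_ab)

definition left_rmodule :: "('r, 'm, 'y) bimodule_scheme \<Rightarrow> ('r, 'm, 'y) bimodule_scheme" where
  "left_rmodule D = D\<lparr>ract := \<lambda>x a. a \<rhd>\<^bsub>D\<^esub> x\<rparr>"

lemma left_rmodule_simps [simp]:
  "carrier (left_rmodule D) = carrier D" "x \<oplus>\<^bsub>left_rmodule D\<^esub> y = x \<oplus>\<^bsub>D\<^esub> y"
  "\<zero>\<^bsub>left_rmodule D\<^esub> = \<zero>\<^bsub>D\<^esub>" "x \<lhd>\<^bsub>left_rmodule D\<^esub> a = a \<rhd>\<^bsub>D\<^esub> x"
  by (simp_all add: left_rmodule_def)

lemma finsum_left_rmodule [simp]: "finsum (left_rmodule D) f I = finsum D f I"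
  by (simp add: left_rmodule_def finsum_def)

text \<open>By the last assumption the scalars act on \<open>D\<close> in the same way from both sides, so that \<open>D\<close> is
  a module over the complex algebra \<open>A \<otimes> A\<^sup>o\<^sup>p\<close>.\<close>

locale complex_bimodule = complex_algebra A + D?: right_module A D
  for A :: "(complex, 'a, 'x) module_scheme" (structure)
    and D :: "('a, 'm, 'y) bimodule_scheme" (structure) +
  assumes lact_closed: "\<lbrakk>x \<in> carrier D; a \<in> carrier A\<rbrakk> \<Longrightarrow> a \<rhd>\<^bsub>D\<^esub> x \<in> carrier D"
    and lact_add: "\<lbrakk>x \<in> carrier D; y \<in> carrier D; a \<in> carrier A\<rbrakk> \<Longrightarrow>
      a \<rhd>\<^bsub>D\<^esub> (x \<oplus>\<^bsub>D\<^esub> y) = a \<rhd>\<^bsub>D\<^esub> x \<oplus>\<^bsub>D\<^esub> a \<rhd>\<^bsub>D\<^esub> y"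
    and lact_add_scalar: "\<lbrakk>x \<in> carrier D; a \<in> carrier A; b \<in> carrier A\<rbrakk> \<Longrightarrow>
      (a \<oplus>\<^bsub>A\<^esub> b) \<rhd>\<^bsub>D\<^esub> x = a \<rhd>\<^bsub>D\<^esub> x \<oplus>\<^bsub>D\<^esub> b \<rhd>\<^bsub>D\<^esub> x"
    and lact_mult: "\<lbrakk>x \<in> carrier D; a \<in> carrier A; b \<in> carrier A\<rbrakk> \<Longrightarrow>
      (a \<otimes>\<^bsub>A\<^esub> b) \<rhd>\<^bsub>D\<^esub> x = a \<rhd>\<^bsub>D\<^esub> (b \<rhd>\<^bsub>D\<^esub> x)"
    and lact_one: "x \<in> carrier D \<Longrightarrow> \<one>\<^bsub>A\<^esub> \<rhd>\<^bsub>D\<^esub> x = x"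
    and lact_ract: "\<lbrakk>x \<in> carrier D; a \<in> carrier A; b \<in> carrier A\<rbrakk> \<Longrightarrow>
      (a \<rhd>\<^bsub>D\<^esub> x) \<lhd>\<^bsub>D\<^esub> b = a \<rhd>\<^bsub>D\<^esub> (x \<lhd>\<^bsub>D\<^esub> b)"
    and scalar_central: "x \<in> carrier D \<Longrightarrow>
      (c \<odot>\<^bsub>A\<^esub> \<one>\<^bsub>A\<^esub>) \<rhd>\<^bsub>D\<^esub> x = x \<lhd>\<^bsub>D\<^esub> (c \<odot>\<^bsub>A\<^esub> \<one>\<^bsub>A\<^esub>)"
begin

lemma abelian_group_D: "abelian_group D"
  by (rule D.M.abelian_group_axioms)

lemma right_module_D: "right_module A D"
  by (rule D.right_module_axioms)

lemma right_module_left_rmodule: "right_module (opposite A) (left_rmodule D)"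
proof (intro right_module.intro right_module_axioms.intro A.ring_opposite)
  show "abelian_group (left_rmodule D)"
    by (rule abelian_groupI)
      (auto simp: D.M.a_assoc intro: D.M.a_comm D.M.l_neg)
qed (auto simp: lact_closed lact_add lact_add_scalar lact_mult lact_one)

lemma additive_lact: "a \<in> carrier A \<Longrightarrow> (\<lambda>x. a \<rhd>\<^bsub>D\<^esub> x) \<in> additive_maps D D"
  by (intro additive_mapsI) (auto simp: lact_closed lact_add)

lemma lact_zero: "a \<in> carrier A \<Longrightarrow> a \<rhd>\<^bsub>D\<^esub> \<zero>\<^bsub>D\<^esub> = \<zero>\<^bsub>D\<^esub>"
  using additive_zero[OF abelian_group_D abelian_group_D additive_lact] .

definition scalar_module :: "(complex, 'm) module" where
  "scalar_module = \<lparr>carrier = carrier D, monoid.mult = undefined, one = undefined,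
     ring.zero = \<zero>\<^bsub>D\<^esub>, ring.add = ring.add D, module.smult = (\<lambda>c x. x \<lhd>\<^bsub>D\<^esub> (c \<odot>\<^bsub>A\<^esub> \<one>\<^bsub>A\<^esub>))\<rparr>"

lemma scalar_module_simps [simp]:
  "carrier scalar_module = carrier D" "x \<oplus>\<^bsub>scalar_module\<^esub> y = x \<oplus>\<^bsub>D\<^esub> y"
  "\<zero>\<^bsub>scalar_module\<^esub> = \<zero>\<^bsub>D\<^esub>" "c \<odot>\<^bsub>scalar_module\<^esub> x = x \<lhd>\<^bsub>D\<^esub> (c \<odot>\<^bsub>A\<^esub> \<one>\<^bsub>A\<^esub>)"
  by (simp_all add: scalar_module_def)

lemma abelian_group_scalar_module: "abelian_group scalar_module"
  by (rule abelian_groupI) (auto simp: D.M.a_assoc intro: D.M.a_comm D.M.l_neg)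

lemma finsum_scalar_module: "f \<in> I \<rightarrow> carrier D \<Longrightarrow> finsum scalar_module f I = finsum D f I"
  using additive_finsum[OF abelian_group_scalar_module abelian_group_D, of "\<lambda>x. x" f I]
  by (simp add: hom_def)

lemma scalar_one_add: "(c + d) \<odot>\<^bsub>A\<^esub> \<one>\<^bsub>A\<^esub> = c \<odot>\<^bsub>A\<^esub> \<one>\<^bsub>A\<^esub> \<oplus>\<^bsub>A\<^esub> d \<odot>\<^bsub>A\<^esub> \<one>\<^bsub>A\<^esub>"
  using smult_l_distr[of c d "\<one>\<^bsub>A\<^esub>"] by simp

lemma scalar_one_mult: "(c * d) \<odot>\<^bsub>A\<^esub> \<one>\<^bsub>A\<^esub> = (d \<odot>\<^bsub>A\<^esub> \<one>\<^bsub>A\<^esub>) \<otimes>\<^bsub>A\<^esub> (c \<odot>\<^bsub>A\<^esub> \<one>\<^bsub>A\<^esub>)"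
  using smult_assoc1[of c d "\<one>\<^bsub>A\<^esub>"] by (simp add: scalar_right)

lemma complex_vector_space_scalar_module: "complex_vector_space scalar_module"
proof -
  have "module complex_ring scalar_module"
    by (rule moduleI[OF cring_complex_ring abelian_group_scalar_module])
      (use smult_one in \<open>auto simp: D.ract_closed D.ract_add D.ract_add_scalar D.ract_one scalar_one_add
        D.ract_mult scalar_one_mult\<close>)
  then show ?thesis by (simp add: complex_vector_space_def)
qed

sublocale S: complex_vector_space scalar_module
  by (rule complex_vector_space_scalar_module)

lemma linear_form_scalar:
  assumes "S.linear_form \<phi>" "x \<in> carrier D"
  shows "\<phi> (x \<lhd>\<^bsub>D\<^esub> (c \<odot>\<^bsub>A\<^esub> \<one>\<^bsub>A\<^esub>)) = c * \<phi> x" "\<phi> ((c \<odot>\<^bsub>A\<^esub> \<one>\<^bsub>A\<^esub>) \<rhd>\<^bsub>D\<^esub> x) = c * \<phi> x"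
  using S.linear_formD(2)[OF assms(1), of x c] assms(2) by (simp_all add: scalar_central)

end

lemma bimod_homD:
  assumes "h \<in> bimod_hom R M N"
  shows "h \<in> rmod_hom R M N" "h \<in> additive_maps M N"
    "\<lbrakk>x \<in> carrier M; a \<in> carrier R\<rbrakk> \<Longrightarrow> h (x \<lhd>\<^bsub>M\<^esub> a) = h x \<lhd>\<^bsub>N\<^esub> a"
    "\<lbrakk>x \<in> carrier M; a \<in> carrier R\<rbrakk> \<Longrightarrow> h (a \<rhd>\<^bsub>M\<^esub> x) = a \<rhd>\<^bsub>N\<^esub> h x"
  using assms by (auto simp: bimod_hom_def rmod_hom_def)

context corner_system
begin

lemma extension_lact:
  assumes "complex_bimodule A D" "complex_bimodule A D'" "h \<in> additive_maps D D'"
    and x: "x \<in> carrier A" and h: "\<And>d. d \<in> carrier D \<Longrightarrow> h (x \<rhd>\<^bsub>D\<^esub> d) = x \<rhd>\<^bsub>D'\<^esub> h d"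
    and d: "d \<in> carrier D"
  shows "extension h D D' (x \<rhd>\<^bsub>D\<^esub> d) = x \<rhd>\<^bsub>D'\<^esub> extension h D D' d"
proof -
  interpret D: complex_bimodule A D by fact
  interpret D': complex_bimodule A D' by fact
  have hc: "h m \<in> carrier D'" if "m \<in> carrier D" for m using additive_closed[OF assms(3) that] .
  have "extension h D D' (x \<rhd>\<^bsub>D\<^esub> d) = (\<Oplus>\<^bsub>D'\<^esub>p\<in>P. x \<rhd>\<^bsub>D'\<^esub> (h (d \<lhd>\<^bsub>D\<^esub> a p) \<lhd>\<^bsub>D'\<^esub> b p))"
    unfolding extension_def
    by (rule D'.D.M.finsum_cong')
      (use x d in \<open>auto simp: D.lact_ract D'.lact_ract h hc D.ract_closed D'.ract_closed
        D'.lact_closed a_closed b_closed\<close>)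
  also have "\<dots> = x \<rhd>\<^bsub>D'\<^esub> extension h D D' d"
    unfolding extension_def
    by (rule additive_finsum[OF D'.abelian_group_D D'.abelian_group_D D'.additive_lact[OF x], symmetric])
      (use d in \<open>auto simp: hc D.ract_closed D'.ract_closed a_closed b_closed\<close>)
  finally show ?thesis .
qed

text \<open>Extending on both sides; the left extension is the right extension over the opposite
  algebra.\<close>

lemma ex_bimod_hom_extension:
  assumes D: "complex_bimodule A D" and D': "complex_bimodule A D'" and h: "h \<in> additive_maps D D'"
    and right: "\<And>d x. \<lbrakk>d \<in> carrier D; x \<in> carrier A\<rbrakk> \<Longrightarrow>
      h (d \<lhd>\<^bsub>D\<^esub> (\<epsilon> \<otimes> x \<otimes> \<epsilon>)) = h d \<lhd>\<^bsub>D'\<^esub> (\<epsilon> \<otimes> x \<otimes> \<epsilon>)"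
    and left: "\<And>d x. \<lbrakk>d \<in> carrier D; x \<in> carrier A\<rbrakk> \<Longrightarrow>
      h ((\<epsilon> \<otimes> x \<otimes> \<epsilon>) \<rhd>\<^bsub>D\<^esub> d) = (\<epsilon> \<otimes> x \<otimes> \<epsilon>) \<rhd>\<^bsub>D'\<^esub> h d"
  obtains F where "F \<in> bimod_hom A D D'"
    "\<And>d. \<lbrakk>d \<in> carrier D; d \<lhd>\<^bsub>D\<^esub> \<epsilon> = d; \<epsilon> \<rhd>\<^bsub>D\<^esub> d = d\<rbrakk> \<Longrightarrow> F d = \<epsilon> \<rhd>\<^bsub>D'\<^esub> (h d \<lhd>\<^bsub>D'\<^esub> \<epsilon>)"
proof -
  interpret D: complex_bimodule A D by fact
  interpret D': complex_bimodule A D' by fact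
  interpret op: corner_system "opposite A" s e P b a by (rule corner_system_opposite)
  have op_eps: "op.\<epsilon> = \<epsilon>" by (simp add: op.\<epsilon>_def \<epsilon>_def)
  define g where "g = extension h D D'"
  note rext = D.right_module_D D'.right_module_D h right
  have g: "g \<in> rmod_hom A D D'" unfolding g_def by (rule extension_hom[OF rext])
  have g_left: "g ((\<epsilon> \<otimes> x \<otimes> \<epsilon>) \<rhd>\<^bsub>D\<^esub> d) = (\<epsilon> \<otimes> x \<otimes> \<epsilon>) \<rhd>\<^bsub>D'\<^esub> g d"
    if "d \<in> carrier D" "x \<in> carrier A" for d x
    unfolding g_def by (rule extension_lact[OF D D' h]) (use that left eps_closed in auto)
  define F where "F = op.extension g (left_rmodule D) (left_rmodule D')"
  have F_def': "F d = (\<Oplus>\<^bsub>D'\<^esub>p\<in>P. a p \<rhd>\<^bsub>D'\<^esub> g (b p \<rhd>\<^bsub>D\<^esub> d))" for d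
    by (simp add: F_def op.extension_def)
  have "g \<in> additive_maps (left_rmodule D) (left_rmodule D')"
    using rmod_homD(1)[OF g] by (simp add: hom_def)
  note lext = D.right_module_left_rmodule D'.right_module_left_rmodule this
  have lcorner: "g (d \<lhd>\<^bsub>left_rmodule D\<^esub> (op.\<epsilon> \<otimes>\<^bsub>opposite A\<^esub> x \<otimes>\<^bsub>opposite A\<^esub> op.\<epsilon>))
      = g d \<lhd>\<^bsub>left_rmodule D'\<^esub> (op.\<epsilon> \<otimes>\<^bsub>opposite A\<^esub> x \<otimes>\<^bsub>opposite A\<^esub> op.\<epsilon>)"
    if "d \<in> carrier (left_rmodule D)" "x \<in> carrier (opposite A)" for d x
    using g_left[of d x] that by (simp add: op_eps A.m_assoc eps_closed)
  have F: "F \<in> rmod_hom (opposite A) (left_rmodule D) (left_rmodule D')"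
    unfolding F_def by (rule op.extension_hom[OF lext lcorner])
  have gc: "g m \<in> carrier D'" if "m \<in> carrier D" for m using additive_closed[OF rmod_homD(1)[OF g] that] .
  have "F (d \<lhd>\<^bsub>D\<^esub> x) = F d \<lhd>\<^bsub>D'\<^esub> x" if "d \<in> carrier D" "x \<in> carrier A" for d x
  proof -
    have "F (d \<lhd>\<^bsub>D\<^esub> x) = (\<Oplus>\<^bsub>D'\<^esub>p\<in>P. (a p \<rhd>\<^bsub>D'\<^esub> g (b p \<rhd>\<^bsub>D\<^esub> d)) \<lhd>\<^bsub>D'\<^esub> x)"
      unfolding F_def'
      by (rule D'.D.M.finsum_cong')
        (use that in \<open>auto simp: D.lact_ract[symmetric] D'.lact_ract rmod_homD(2)[OF g] gc
          D.lact_closed D'.lact_closed D'.ract_closed a_closed b_closed\<close>)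
    also have "\<dots> = F d \<lhd>\<^bsub>D'\<^esub> x"
      unfolding F_def'
      by (rule additive_finsum[OF D'.abelian_group_D D'.abelian_group_D D'.additive_ract, symmetric])
        (use that in \<open>auto simp: gc D.lact_closed D'.lact_closed a_closed b_closed\<close>)
    finally show ?thesis .
  qed
  then have "F \<in> bimod_hom A D D'"
    using F by (simp add: bimod_hom_def rmod_hom_def hom_def)
  moreover have "F d = \<epsilon> \<rhd>\<^bsub>D'\<^esub> (h d \<lhd>\<^bsub>D'\<^esub> \<epsilon>)"
    if d: "d \<in> carrier D" "d \<lhd>\<^bsub>D\<^esub> \<epsilon> = d" "\<epsilon> \<rhd>\<^bsub>D\<^esub> d = d" for d
  proof -
    have "F d = g d \<lhd>\<^bsub>left_rmodule D'\<^esub> op.\<epsilon>"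
      unfolding F_def by (rule op.extension_corner[OF lext lcorner]) (use d in \<open>auto simp: op_eps\<close>)
    also have "\<dots> = \<epsilon> \<rhd>\<^bsub>D'\<^esub> g d" by (simp add: op_eps)
    also have "g d = h d \<lhd>\<^bsub>D'\<^esub> \<epsilon>"
      unfolding g_def by (rule extension_corner[OF rext d(1,2)])
    finally show ?thesis .
  qed
  ultimately show thesis using that by blast
qed

text \<open>The corner generates the bimodule, as \<open>d = \<Sum>\<^sub>p \<Sum>\<^sub>q a\<^sub>p (b\<^sub>p d a\<^sub>q) b\<^sub>q\<close>.\<close>

lemma bimod_hom_eq_id_if_eq_on_corner:
  assumes D: "complex_bimodule A D" and G: "G \<in> bimod_hom A D D"
    and corner: "\<And>d. \<lbrakk>d \<in> carrier D; d \<lhd>\<^bsub>D\<^esub> \<epsilon> = d; \<epsilon> \<rhd>\<^bsub>D\<^esub> d = d\<rbrakk> \<Longrightarrow> G d = d"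
    and d: "d \<in> carrier D"
  shows "G d = d"
proof -
  interpret D: complex_bimodule A D by fact
  interpret op: corner_system "opposite A" s e P b a by (rule corner_system_opposite)
  note G' = bimod_homD[OF G]
  have 1: "G m = m" if m: "m \<in> carrier D" "\<epsilon> \<rhd>\<^bsub>D\<^esub> m = m" for m
  proof -
    have "G (m \<lhd>\<^bsub>D\<^esub> a p) = m \<lhd>\<^bsub>D\<^esub> a p" if "p \<in> P" for p
      using m that a_eps[OF that]
      by (intro corner)
        (auto simp: D.ract_closed a_closed eps_closed D.ract_mult[symmetric] D.lact_ract[symmetric])
    then have *: "G (m \<lhd>\<^bsub>D\<^esub> a p \<lhd>\<^bsub>D\<^esub> b p) = m \<lhd>\<^bsub>D\<^esub> a p \<lhd>\<^bsub>D\<^esub> b p" if "p \<in> P" for p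
      using that m(1) by (simp add: G'(3) D.ract_closed a_closed b_closed)
    have "G m = G (\<Oplus>\<^bsub>D\<^esub>p\<in>P. m \<lhd>\<^bsub>D\<^esub> a p \<lhd>\<^bsub>D\<^esub> b p)"
      using sum_ab_ract[OF D.right_module_D m(1)] by simp
    also have "\<dots> = (\<Oplus>\<^bsub>D\<^esub>p\<in>P. G (m \<lhd>\<^bsub>D\<^esub> a p \<lhd>\<^bsub>D\<^esub> b p))"
      by (rule additive_finsum[OF D.abelian_group_D D.abelian_group_D G'(2)])
        (use m in \<open>auto simp: D.ract_closed a_closed b_closed\<close>)
    also have "\<dots> = (\<Oplus>\<^bsub>D\<^esub>p\<in>P. m \<lhd>\<^bsub>D\<^esub> a p \<lhd>\<^bsub>D\<^esub> b p)"
      by (rule D.D.M.finsum_cong') (use m * in \<open>auto simp: D.ract_closed a_closed b_closed\<close>)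
    also have "\<dots> = m" using sum_ab_ract[OF D.right_module_D m(1)] by simp
    finally show ?thesis .
  qed
  have "G (b p \<rhd>\<^bsub>D\<^esub> d) = b p \<rhd>\<^bsub>D\<^esub> d" if "p \<in> P" for p
    using d that eps_b[OF that]
    by (intro 1) (auto simp: D.lact_closed b_closed eps_closed D.lact_mult[symmetric])
  then have *: "G (a p \<rhd>\<^bsub>D\<^esub> (b p \<rhd>\<^bsub>D\<^esub> d)) = a p \<rhd>\<^bsub>D\<^esub> (b p \<rhd>\<^bsub>D\<^esub> d)" if "p \<in> P" for p
    using that d by (simp add: G'(4) D.lact_closed a_closed b_closed)
  have eq: "d = (\<Oplus>\<^bsub>D\<^esub>p\<in>P. a p \<rhd>\<^bsub>D\<^esub> (b p \<rhd>\<^bsub>D\<^esub> d))"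
    using op.sum_ab_ract[OF D.right_module_left_rmodule, of d] d by simp
  then have "G d = G (\<Oplus>\<^bsub>D\<^esub>p\<in>P. a p \<rhd>\<^bsub>D\<^esub> (b p \<rhd>\<^bsub>D\<^esub> d))" by simp
  also have "\<dots> = (\<Oplus>\<^bsub>D\<^esub>p\<in>P. G (a p \<rhd>\<^bsub>D\<^esub> (b p \<rhd>\<^bsub>D\<^esub> d)))"
    by (rule additive_finsum[OF D.abelian_group_D D.abelian_group_D G'(2)])
      (use d in \<open>auto simp: D.lact_closed a_closed b_closed\<close>)
  also have "\<dots> = (\<Oplus>\<^bsub>D\<^esub>p\<in>P. a p \<rhd>\<^bsub>D\<^esub> (b p \<rhd>\<^bsub>D\<^esub> d))"
    by (rule D.D.M.finsum_cong') (use d * in \<open>auto simp: D.lact_closed a_closed b_closed\<close>)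
  also have "\<dots> = d" using eq by simp
  finally show ?thesis .
qed

text \<open>On the corner \<open>\<epsilon> D \<epsilon>\<close> the homomorphism is \<open>d \<mapsto> \<phi> (e\<^sub>i d e\<^sub>j) y\<close>, which is linear over
  \<open>\<epsilon> A \<epsilon>\<close> because \<open>e\<^sub>i A e\<^sub>i\<close> and \<open>e\<^sub>j A e\<^sub>j\<close> consist of scalars.\<close>

lemma ex_rank_one_bimod_hom:
  assumes D: "complex_bimodule A D" and D': "complex_bimodule A D'"
    and ij: "i < s" "j < s"
    and y: "y \<in> carrier D'" "e i \<rhd>\<^bsub>D'\<^esub> y = y" "y \<lhd>\<^bsub>D'\<^esub> e j = y"
    and \<phi>: "complex_vector_space.linear_form (complex_bimodule.scalar_module A D) \<phi>"
  obtains F where "F \<in> bimod_hom A D D'"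
    "\<And>d. \<lbrakk>d \<in> carrier D; d \<lhd>\<^bsub>D\<^esub> \<epsilon> = d; \<epsilon> \<rhd>\<^bsub>D\<^esub> d = d\<rbrakk> \<Longrightarrow>
      F d = y \<lhd>\<^bsub>D'\<^esub> (\<phi> ((e i \<rhd>\<^bsub>D\<^esub> d) \<lhd>\<^bsub>D\<^esub> e j) \<odot> \<one>)"
proof -
  interpret D: complex_bimodule A D by fact
  interpret D': complex_bimodule A D' by fact
  note cl = D.lact_closed D.ract_closed D'.lact_closed D'.ract_closed e_closed ij eps_closed
  define h where "h = (\<lambda>d. y \<lhd>\<^bsub>D'\<^esub> (\<phi> ((e i \<rhd>\<^bsub>D\<^esub> d) \<lhd>\<^bsub>D\<^esub> e j) \<odot> \<one>))"
  have h: "h \<in> additive_maps D D'"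
  proof (rule additive_mapsI)
    fix d d' assume "d \<in> carrier D" "d' \<in> carrier D"
    then show "h (d \<oplus>\<^bsub>D\<^esub> d') = h d \<oplus>\<^bsub>D'\<^esub> h d'"
      using D.S.linear_formD(1)[OF \<phi>] y(1)
      by (simp add: h_def cl D.lact_add D.ract_add D.scalar_one_add D'.ract_add_scalar)
  qed (use y in \<open>simp add: h_def cl\<close>)
  have right: "h (d \<lhd>\<^bsub>D\<^esub> (\<epsilon> \<otimes> x \<otimes> \<epsilon>)) = h d \<lhd>\<^bsub>D'\<^esub> (\<epsilon> \<otimes> x \<otimes> \<epsilon>)"
    if d: "d \<in> carrier D" and x: "x \<in> carrier A" for d x
  proof -
    obtain c where c: "e j \<otimes> x \<otimes> e j = c \<odot> e j" using e_scalar[OF ij(2) x] by blast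
    let ?t = "\<epsilon> \<otimes> x \<otimes> \<epsilon>"
    have t: "?t \<in> carrier A" using x by (simp add: cl)
    have te: "?t \<otimes> e j = e j \<otimes> (c \<odot> \<one>)" "e j \<otimes> ?t = e j \<otimes> (c \<odot> \<one>)"
      using e_corner[OF ij(2) x] corner_e[OF ij(2) x] c by (simp_all add: scalar_right e_closed ij)
    have "(e i \<rhd>\<^bsub>D\<^esub> (d \<lhd>\<^bsub>D\<^esub> ?t)) \<lhd>\<^bsub>D\<^esub> e j = ((e i \<rhd>\<^bsub>D\<^esub> d) \<lhd>\<^bsub>D\<^esub> e j) \<lhd>\<^bsub>D\<^esub> (c \<odot> \<one>)"
      using d x t te(1) by (simp add: cl D.lact_ract D.ract_mult[symmetric])
    then have "h (d \<lhd>\<^bsub>D\<^esub> ?t) = y \<lhd>\<^bsub>D'\<^esub> ((c * \<phi> ((e i \<rhd>\<^bsub>D\<^esub> d) \<lhd>\<^bsub>D\<^esub> e j)) \<odot> \<one>)"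
      using d by (simp add: h_def cl D.linear_form_scalar[OF \<phi>])
    moreover have "h d \<lhd>\<^bsub>D'\<^esub> ?t = y \<lhd>\<^bsub>D'\<^esub> ((c * \<phi> ((e i \<rhd>\<^bsub>D\<^esub> d) \<lhd>\<^bsub>D\<^esub> e j)) \<odot> \<one>)" (is "?L = ?R")
    proof -
      let ?k = "\<phi> ((e i \<rhd>\<^bsub>D\<^esub> d) \<lhd>\<^bsub>D\<^esub> e j)"
      have "?L = y \<lhd>\<^bsub>D'\<^esub> ((?k \<odot> \<one>) \<otimes> ?t)"
        using y(1) t by (simp add: h_def D'.ract_mult)
      also have "(?k \<odot> \<one>) \<otimes> ?t = ?t \<otimes> (?k \<odot> \<one>)" using t by (simp add: scalar_left scalar_right)
      also have "y \<lhd>\<^bsub>D'\<^esub> \<dots> = y \<lhd>\<^bsub>D'\<^esub> e j \<lhd>\<^bsub>D'\<^esub> (?t \<otimes> (?k \<odot> \<one>))" by (simp add: y(3))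
      also have "\<dots> = y \<lhd>\<^bsub>D'\<^esub> (e j \<otimes> ?t) \<lhd>\<^bsub>D'\<^esub> (?k \<odot> \<one>)"
        using y(1) t by (simp add: cl D'.ract_mult)
      also have "\<dots> = y \<lhd>\<^bsub>D'\<^esub> (c \<odot> \<one>) \<lhd>\<^bsub>D'\<^esub> (?k \<odot> \<one>)"
        using y by (simp add: te(2) cl D'.ract_mult)
      also have "\<dots> = y \<lhd>\<^bsub>D'\<^esub> ((?k * c) \<odot> \<one>)"
        using y(1) by (simp add: D.scalar_one_mult D'.ract_mult)
      finally show ?thesis by (simp add: mult.commute)
    qed
    ultimately show ?thesis by simp
  qed
  have left: "h ((\<epsilon> \<otimes> x \<otimes> \<epsilon>) \<rhd>\<^bsub>D\<^esub> d) = (\<epsilon> \<otimes> x \<otimes> \<epsilon>) \<rhd>\<^bsub>D'\<^esub> h d"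
    if d: "d \<in> carrier D" and x: "x \<in> carrier A" for d x
  proof -
    obtain c where c: "e i \<otimes> x \<otimes> e i = c \<odot> e i" using e_scalar[OF ij(1) x] by blast
    let ?t = "\<epsilon> \<otimes> x \<otimes> \<epsilon>"
    have t: "?t \<in> carrier A" using x by (simp add: cl)
    have te: "?t \<otimes> e i = (c \<odot> \<one>) \<otimes> e i" "e i \<otimes> ?t = (c \<odot> \<one>) \<otimes> e i"
      using e_corner[OF ij(1) x] corner_e[OF ij(1) x] c by (simp_all add: scalar_left e_closed ij)
    have "(e i \<rhd>\<^bsub>D\<^esub> (?t \<rhd>\<^bsub>D\<^esub> d)) \<lhd>\<^bsub>D\<^esub> e j = (c \<odot> \<one>) \<rhd>\<^bsub>D\<^esub> ((e i \<rhd>\<^bsub>D\<^esub> d) \<lhd>\<^bsub>D\<^esub> e j)"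
      using d x t te(2) by (simp add: cl D.lact_ract[symmetric] D.lact_mult[symmetric])
    then have "h (?t \<rhd>\<^bsub>D\<^esub> d) = y \<lhd>\<^bsub>D'\<^esub> ((c * \<phi> ((e i \<rhd>\<^bsub>D\<^esub> d) \<lhd>\<^bsub>D\<^esub> e j)) \<odot> \<one>)"
      using d by (simp add: h_def cl D.linear_form_scalar[OF \<phi>])
    moreover have "?t \<rhd>\<^bsub>D'\<^esub> h d = y \<lhd>\<^bsub>D'\<^esub> ((c * \<phi> ((e i \<rhd>\<^bsub>D\<^esub> d) \<lhd>\<^bsub>D\<^esub> e j)) \<odot> \<one>)" (is "?L = ?R")
    proof -
      let ?k = "\<phi> ((e i \<rhd>\<^bsub>D\<^esub> d) \<lhd>\<^bsub>D\<^esub> e j)"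
      have "?L = (?t \<rhd>\<^bsub>D'\<^esub> y) \<lhd>\<^bsub>D'\<^esub> (?k \<odot> \<one>)"
        using y(1) t by (simp add: h_def D'.lact_ract)
      also have "?t \<rhd>\<^bsub>D'\<^esub> y = (?t \<otimes> e i) \<rhd>\<^bsub>D'\<^esub> y"
        using D'.lact_mult[OF y(1) t e_closed[OF ij(1)]] y(2) by simp
      also have "\<dots> = (c \<odot> \<one>) \<rhd>\<^bsub>D'\<^esub> y"
        using D'.lact_mult[OF y(1) _ e_closed[OF ij(1)], of "c \<odot> \<one>"] y(2) by (simp add: te(1))
      also have "\<dots> = y \<lhd>\<^bsub>D'\<^esub> (c \<odot> \<one>)" using y(1) by (rule D'.scalar_central)
      also have "\<dots> \<lhd>\<^bsub>D'\<^esub> (?k \<odot> \<one>) = y \<lhd>\<^bsub>D'\<^esub> ((?k * c) \<odot> \<one>)"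
        using y(1) by (simp add: D.scalar_one_mult D'.ract_mult)
      finally show ?thesis by (simp add: mult.commute)
    qed
    ultimately show ?thesis by simp
  qed
  obtain F where F: "F \<in> bimod_hom A D D'"
      "\<And>d. \<lbrakk>d \<in> carrier D; d \<lhd>\<^bsub>D\<^esub> \<epsilon> = d; \<epsilon> \<rhd>\<^bsub>D\<^esub> d = d\<rbrakk> \<Longrightarrow> F d = \<epsilon> \<rhd>\<^bsub>D'\<^esub> (h d \<lhd>\<^bsub>D'\<^esub> \<epsilon>)"
    using ex_bimod_hom_extension[OF D D' h right left] by blast
  have "\<epsilon> \<rhd>\<^bsub>D'\<^esub> (h d \<lhd>\<^bsub>D'\<^esub> \<epsilon>) = h d" for d
  proof -
    let ?k = "\<phi> ((e i \<rhd>\<^bsub>D\<^esub> d) \<lhd>\<^bsub>D\<^esub> e j) \<odot> \<one>"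
    have 1: "y \<lhd>\<^bsub>D'\<^esub> \<epsilon> = y"
      using D'.ract_mult[OF y(1) e_closed[OF ij(2)] eps_closed] by (simp add: y(3) e_eps[OF ij(2)])
    have 2: "\<epsilon> \<rhd>\<^bsub>D'\<^esub> y = y"
      using D'.lact_mult[OF y(1) eps_closed e_closed[OF ij(1)]] by (simp add: y(2) eps_e[OF ij(1)])
    have "y \<lhd>\<^bsub>D'\<^esub> ?k \<lhd>\<^bsub>D'\<^esub> \<epsilon> = y \<lhd>\<^bsub>D'\<^esub> \<epsilon> \<lhd>\<^bsub>D'\<^esub> ?k"
      using y(1) by (simp add: cl D'.ract_mult[symmetric] scalar_left scalar_right)
    then show ?thesis using 1 2 y(1) by (simp add: h_def cl D'.lact_ract[symmetric])
  qed
  then show thesis using F that unfolding h_def by simp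
qed

end

section \<open>Direct summands of multiples of a bimodule\<close>

lemma bimod_dsum_simps:
  "carrier (bimod_dsum I N) = (\<Pi>\<^sub>E i\<in>I. carrier (N i))"
  "\<zero>\<^bsub>bimod_dsum I N\<^esub> = (\<lambda>i\<in>I. \<zero>\<^bsub>N i\<^esub>)"
  "f \<oplus>\<^bsub>bimod_dsum I N\<^esub> g = (\<lambda>i\<in>I. f i \<oplus>\<^bsub>N i\<^esub> g i)"
  "f \<lhd>\<^bsub>bimod_dsum I N\<^esub> a = (\<lambda>i\<in>I. f i \<lhd>\<^bsub>N i\<^esub> a)"
  "a \<rhd>\<^bsub>bimod_dsum I N\<^esub> f = (\<lambda>i\<in>I. a \<rhd>\<^bsub>N i\<^esub> f i)"
  by (simp_all add: bimod_dsum_def rmod_dsum_def rmodule.defs bimodule.defs)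

lemma right_module_bimod_dsum:
  assumes R: "ring R" and N: "\<And>i. i \<in> I \<Longrightarrow> right_module R (N i)"
  shows "right_module R (bimod_dsum I N)"
proof -
  have ag: "abelian_group (N i)" if "i \<in> I" for i using N[OF that] by (simp add: right_module_def)
  note ag' = abelian_monoid.a_closed[OF abelian_group.axioms(1)[OF ag]]
    abelian_monoid.zero_closed[OF abelian_group.axioms(1)[OF ag]]
    abelian_monoid.a_assoc[OF abelian_group.axioms(1)[OF ag]]
    abelian_monoid.a_comm[OF abelian_group.axioms(1)[OF ag]]
    abelian_monoid.l_zero[OF abelian_group.axioms(1)[OF ag]]
    abelian_group.a_inv_closed[OF ag] abelian_group.l_neg[OF ag] abelian_group.r_neg[OF ag]
  note rm = right_module.ract_closed[OF N] right_module.ract_add[OF N]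
    right_module.ract_add_scalar[OF N] right_module.ract_mult[OF N] right_module.ract_one[OF N]
  have "abelian_group (bimod_dsum I N)"
  proof (rule abelian_groupI)
    fix f assume f: "f \<in> carrier (bimod_dsum I N)"
    then have fi: "f i \<in> carrier (N i)" if "i \<in> I" for i
      using that by (auto simp: bimod_dsum_simps)
    show "\<exists>g\<in>carrier (bimod_dsum I N). g \<oplus>\<^bsub>bimod_dsum I N\<^esub> f = \<zero>\<^bsub>bimod_dsum I N\<^esub>"
      by (intro bexI[of _ "\<lambda>i\<in>I. \<ominus>\<^bsub>N i\<^esub> f i"])
        (auto simp: bimod_dsum_simps ag' fi intro!: restrict_ext)
    show "\<zero>\<^bsub>bimod_dsum I N\<^esub> \<oplus>\<^bsub>bimod_dsum I N\<^esub> f = f"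
    proof
      fix i
      show "(\<zero>\<^bsub>bimod_dsum I N\<^esub> \<oplus>\<^bsub>bimod_dsum I N\<^esub> f) i = f i"
        using f fi[of i] by (cases "i \<in> I") (auto simp: bimod_dsum_simps ag'(5) dest: PiE_arb)
    qed
  qed (auto simp: bimod_dsum_simps intro!: restrict_ext ag'(1-4) dest: PiE_mem)
  then show ?thesis
    by (intro right_module.intro right_module_axioms.intro R)
      (auto simp: bimod_dsum_simps ring.ring_simprules[OF R] PiE_iff extensional_def
        intro!: restrict_ext rm(1-4) ext simp: rm(5))
qed

text \<open>The maps \<open>f k\<close> embed \<open>D\<close> into the direct sum, and the kernel of the retraction given by the
  maps \<open>g k\<close> is a complement of the image.\<close>

lemma iso_to_bimod_summandI:
  assumes D: "complex_bimodule A D" and D': "complex_bimodule A D'"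
    and f: "\<And>k. k < q \<Longrightarrow> f k \<in> bimod_hom A D D'" and g: "\<And>k. k < q \<Longrightarrow> g k \<in> bimod_hom A D' D"
    and id: "\<And>d. d \<in> carrier D \<Longrightarrow> (\<Oplus>\<^bsub>D\<^esub>k\<in>{..<q}. g k (f k d)) = d"
  shows "iso_to_bimod_summand A D (bimod_dsum {..<q::nat} (\<lambda>_. D'))"
proof -
  interpret D: complex_bimodule A D by fact
  interpret D': complex_bimodule A D' by fact
  define T where "T = bimod_dsum {..<q} (\<lambda>_. D')"
  have T: "right_module A T"
    unfolding T_def by (rule right_module_bimod_dsum[OF D.A.ring_axioms D'.right_module_D])
  interpret T: right_module A T by (fact T)
  note T_simps = bimod_dsum_simps[of "{..<q}" "\<lambda>_. D'", folded T_def]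
  note fD = bimod_homD[OF f] and gD = bimod_homD[OF g]
  note fc = additive_closed[OF fD(2)] and gc = additive_closed[OF gD(2)]
  define F where "F = (\<lambda>d. \<lambda>k\<in>{..<q}. f k d)"
  define G where "G = (\<lambda>u. \<Oplus>\<^bsub>D\<^esub>k\<in>{..<q}. g k (u k))"
  have GF: "G (F d) = d" if "d \<in> carrier D" for d
  proof -
    have "G (F d) = (\<Oplus>\<^bsub>D\<^esub>k\<in>{..<q}. g k (f k d))"
      unfolding G_def F_def using that by (intro D.D.M.finsum_cong') (auto simp: fc gc)
    then show ?thesis using id[OF that] by simp
  qed
  have "F \<in> additive_maps D T"
    by (rule additive_mapsI) (auto simp: F_def T_simps fc additive_add[OF fD(2)] intro!: restrict_ext)
  then have F: "F \<in> bimod_hom A D T"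
    unfolding bimod_hom_def rmod_hom_def
    by (auto simp: F_def bimod_dsum_simps(4,5) T_def fD(3,4) intro!: restrict_ext)
  have G: "G \<in> bimod_hom A T D"
    unfolding bimod_hom_def rmod_hom_def mem_Collect_eq
  proof (intro conjI ballI)
    have "(\<lambda>u. g k (u k)) \<in> additive_maps T D" if "k \<in> {..<q}" for k
    proof (rule additive_mapsI)
      have k: "k < q" using that by simp
      fix u assume "u \<in> carrier T"
      then have u: "u k \<in> carrier D'" using k by (auto simp: T_simps)
      then show "g k (u k) \<in> carrier D" by (rule gc[OF k])
      fix w assume "w \<in> carrier T"
      then have "w k \<in> carrier D'" using k by (auto simp: T_simps)
      then show "g k ((u \<oplus>\<^bsub>T\<^esub> w) k) = g k (u k) \<oplus>\<^bsub>D\<^esub> g k (w k)"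
        using additive_add[OF gD(2)[OF k] u] k by (simp add: T_simps)
    qed
    then show "G \<in> additive_maps T D"
      unfolding G_def[abs_def]
      by (intro additive_finsum_maps T.M.abelian_group_axioms D.abelian_group_D) auto
    fix u x assume u: "u \<in> carrier T" and x: "x \<in> carrier A"
    have uk: "u k \<in> carrier D'" if "k < q" for k using u that by (auto simp: T_simps PiE_mem)
    have "G (u \<lhd>\<^bsub>T\<^esub> x) = (\<Oplus>\<^bsub>D\<^esub>k\<in>{..<q}. g k (u k) \<lhd>\<^bsub>D\<^esub> x)"
      unfolding G_def using x uk
      by (intro D.D.M.finsum_cong') (auto simp: T_simps gD(3) gc D.ract_closed)
    also have "\<dots> = G u \<lhd>\<^bsub>D\<^esub> x"
      unfolding G_def using x uk
      by (intro additive_finsum[OF D.abelian_group_D D.abelian_group_D D.additive_ract, symmetric])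
        (auto simp: gc)
    finally show "G (u \<lhd>\<^bsub>T\<^esub> x) = G u \<lhd>\<^bsub>D\<^esub> x" .
    have "G (x \<rhd>\<^bsub>T\<^esub> u) = (\<Oplus>\<^bsub>D\<^esub>k\<in>{..<q}. x \<rhd>\<^bsub>D\<^esub> g k (u k))"
      unfolding G_def using x uk
      by (intro D.D.M.finsum_cong') (auto simp: T_simps gD(4) gc D.lact_closed)
    also have "\<dots> = x \<rhd>\<^bsub>D\<^esub> G u"
      unfolding G_def using x uk
      by (intro additive_finsum[OF D.abelian_group_D D.abelian_group_D D.additive_lact, symmetric])
        (auto simp: gc)
    finally show "G (x \<rhd>\<^bsub>T\<^esub> u) = x \<rhd>\<^bsub>D\<^esub> G u" .
  qed
  have T_lact_closed: "x \<rhd>\<^bsub>T\<^esub> u \<in> carrier T" if "u \<in> carrier T" "x \<in> carrier A" for u x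
  proof -
    have "u k \<in> carrier D'" if "k < q" for k using \<open>u \<in> carrier T\<close> that by (auto simp: T_simps)
    then show ?thesis using that(2) by (auto simp: T_simps D'.lact_closed)
  qed
  note FD = bimod_homD[OF F] and GD = bimod_homD[OF G]
  note Fc = additive_closed[OF FD(2)] and Gc = additive_closed[OF GD(2)]
  define U where "U = F ` carrier D"
  define U' where "U' = {u \<in> carrier T. G u = \<zero>\<^bsub>D\<^esub>}"
  have "rsubmodule (carrier D) A D" by (rule D.rsubmoduleI) (auto simp: D.ract_closed)
  then have "rsubmodule U A T"
    unfolding U_def by (rule rmod_hom_image[OF D.right_module_D T FD(1)])
  then have U: "bisubmodule U A T"
    by (auto simp: bisubmodule_def U_def FD(4)[symmetric] D.lact_closed)
  have "rsubmodule U' A T"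
    unfolding U'_def by (rule rmod_hom_kernel[OF T D.right_module_D GD(1)])
  then have U': "bisubmodule U' A T"
    by (auto simp: bisubmodule_def U'_def GD(4) D.lact_zero T_lact_closed)
  have "complementary T U U'"
    unfolding complementary_def
  proof (intro conjI equalityI subsetI)
    fix u assume "u \<in> U \<inter> U'"
    then obtain d where "d \<in> carrier D" "u = F d" "G u = \<zero>\<^bsub>D\<^esub>" by (auto simp: U_def U'_def)
    then show "u \<in> {\<zero>\<^bsub>T\<^esub>}"
      using GF additive_zero[OF D.abelian_group_D T.M.abelian_group_axioms FD(2)] by auto
  next
    fix u assume "u \<in> {\<zero>\<^bsub>T\<^esub>}"
    then show "u \<in> U \<inter> U'"
      using U U' rsubmodule_zero[of _ A T] by (auto simp: bisubmodule_def)
  next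
    fix u assume u: "u \<in> carrier T"
    have FGu: "F (G u) \<in> carrier T" using u by (simp add: Fc Gc)
    have "G (u \<ominus>\<^bsub>T\<^esub> F (G u)) = G u \<ominus>\<^bsub>D\<^esub> G u"
      using u FGu GF[OF Gc[OF u]]
      by (simp add: a_minus_def additive_add[OF GD(2)]
          additive_minus[OF T.M.abelian_group_axioms D.abelian_group_D GD(2)])
    also have "\<dots> = \<zero>\<^bsub>D\<^esub>" using Gc[OF u] by (simp add: a_minus_def D.D.M.r_neg)
    finally have "u \<ominus>\<^bsub>T\<^esub> F (G u) \<in> U'" using u FGu by (simp add: U'_def)
    moreover have "u = F (G u) \<oplus>\<^bsub>T\<^esub> (u \<ominus>\<^bsub>T\<^esub> F (G u))"
      using u FGu by (simp add: a_minus_def T.M.a_comm T.M.r_neg2 T.M.a_lcomm T.M.r_neg)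
    moreover have "F (G u) \<in> U" using Gc[OF u] by (simp add: U_def)
    ultimately show "u \<in> {u \<oplus>\<^bsub>T\<^esub> u' | u u'. u \<in> U \<and> u' \<in> U'}" by blast
  next
    fix u assume "u \<in> {u \<oplus>\<^bsub>T\<^esub> u' | u u'. u \<in> U \<and> u' \<in> U'}"
    then show "u \<in> carrier T" using Fc by (auto simp: U_def U'_def)
  qed
  moreover have "bimod_iso A D (T\<lparr>carrier := U\<rparr>)"
    unfolding bimod_iso_def
  proof (rule bexI[of _ F])
    show "F \<in> bimod_hom A D (T\<lparr>carrier := U\<rparr>)"
      using F by (auto simp: bimod_hom_def rmod_hom_def hom_def U_def)
    show "bij_betw F (carrier D) (carrier (T\<lparr>carrier := U\<rparr>))"
      using GF by (auto simp: bij_betw_def U_def intro: inj_on_inverseI)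
  qed
  ultimately show ?thesis using U U' unfolding iso_to_bimod_summand_def T_def by blast
qed

text \<open>The embedding respects both actions, so it maps \<open>x D y\<close> injectively to the direct sum of copies
  of \<open>x D' y\<close>.\<close>

lemma iso_to_bimod_summand_corner_zero:
  assumes D: "complex_bimodule A D" and D': "complex_bimodule A D'"
    and iso: "iso_to_bimod_summand A D (bimod_dsum {..<q::nat} (\<lambda>_. D'))"
    and xy: "x \<in> carrier A" "y \<in> carrier A"
    and zero: "\<And>d. d \<in> carrier D' \<Longrightarrow> (x \<rhd>\<^bsub>D'\<^esub> d) \<lhd>\<^bsub>D'\<^esub> y = \<zero>\<^bsub>D'\<^esub>"
    and d: "d \<in> carrier D"
  shows "(x \<rhd>\<^bsub>D\<^esub> d) \<lhd>\<^bsub>D\<^esub> y = \<zero>\<^bsub>D\<^esub>"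
proof -
  interpret D: complex_bimodule A D by fact
  interpret D': complex_bimodule A D' by fact
  define T where "T = bimod_dsum {..<q} (\<lambda>_. D')"
  note T_simps = bimod_dsum_simps[of "{..<q}" "\<lambda>_. D'", folded T_def]
  interpret T: right_module A T
    unfolding T_def by (rule right_module_bimod_dsum[OF D.A.ring_axioms D'.right_module_D])
  obtain U h where U: "bisubmodule U A T" and h: "h \<in> bimod_hom A D (T\<lparr>carrier := U\<rparr>)"
      "bij_betw h (carrier D) U"
    using iso unfolding iso_to_bimod_summand_def bimod_iso_def T_def[symmetric] by auto
  have sub: "U \<subseteq> carrier T" using U rsubmodule_subset by (fastforce simp: bisubmodule_def)
  have hU: "h m \<in> U" if "m \<in> carrier D" for m using h(2) that by (auto simp: bij_betw_def)
  have hT: "h \<in> additive_maps D T"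
    using bimod_homD(2)[OF h(1)] sub by (auto simp: hom_def)
  have "h ((x \<rhd>\<^bsub>D\<^esub> d) \<lhd>\<^bsub>D\<^esub> y) = (x \<rhd>\<^bsub>T\<^esub> h d) \<lhd>\<^bsub>T\<^esub> y"
    using bimod_homD(3,4)[OF h(1)] d xy by (simp add: D.lact_closed)
  also have "\<dots> = (\<lambda>k\<in>{..<q}. (x \<rhd>\<^bsub>D'\<^esub> h d k) \<lhd>\<^bsub>D'\<^esub> y)"
    by (auto simp: T_simps intro!: restrict_ext)
  also have "\<dots> = \<zero>\<^bsub>T\<^esub>"
    using hU[OF d] sub by (auto simp: T_simps intro!: restrict_ext zero)
  also have "\<dots> = h \<zero>\<^bsub>D\<^esub>"
    using additive_zero[OF D.abelian_group_D T.M.abelian_group_axioms hT] by simp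
  finally have "h ((x \<rhd>\<^bsub>D\<^esub> d) \<lhd>\<^bsub>D\<^esub> y) = h \<zero>\<^bsub>D\<^esub>" .
  then show ?thesis
    using h(2) d xy by (auto simp: bij_betw_def D.lact_closed D.ract_closed dest!: inj_onD)
qed

lemma (in abelian_group) finsum_cartesian:
  assumes "finite I" "finite J" "\<And>i j. \<lbrakk>i \<in> I; j \<in> J\<rbrakk> \<Longrightarrow> f (i, j) \<in> carrier G"
  shows "(\<Oplus>k\<in>I \<times> J. f k) = (\<Oplus>i\<in>I. \<Oplus>j\<in>J. f (i, j))"
  using assms(1,3)
proof (induction I)
  case (insert i I)
  have "(\<Oplus>k\<in>insert i I \<times> J. f k) = (\<Oplus>k\<in>Pair i ` J \<union> I \<times> J. f k)"
    by (rule arg_cong[where f = "finsum G f"]) auto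
  also have "\<dots> = (\<Oplus>k\<in>Pair i ` J. f k) \<oplus> (\<Oplus>k\<in>I \<times> J. f k)"
    using insert assms(2) by (intro finsum_Un_disjoint) auto
  also have "(\<Oplus>k\<in>Pair i ` J. f k) = (\<Oplus>j\<in>J. f (i, j))"
    using insert by (intro finsum_reindex) (auto simp: inj_on_def)
  finally show ?case using insert by (simp add: Pi_iff)
qed simp

context corner_system
begin

lemma sum_corners:
  assumes "complex_bimodule A D" "d \<in> carrier D" "d \<lhd>\<^bsub>D\<^esub> \<epsilon> = d" "\<epsilon> \<rhd>\<^bsub>D\<^esub> d = d"
  shows "(\<Oplus>\<^bsub>D\<^esub>i\<in>{..<s}. \<Oplus>\<^bsub>D\<^esub>j\<in>{..<s}. (e i \<rhd>\<^bsub>D\<^esub> d) \<lhd>\<^bsub>D\<^esub> e j) = d"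
proof -
  interpret D: complex_bimodule A D by fact
  interpret L: right_module "opposite A" "left_rmodule D" by (rule D.right_module_left_rmodule)
  have ec: "e \<in> {..<s} \<rightarrow> carrier A" using e_closed by auto
  have "(\<Oplus>\<^bsub>D\<^esub>j\<in>{..<s}. (e i \<rhd>\<^bsub>D\<^esub> d) \<lhd>\<^bsub>D\<^esub> e j) = e i \<rhd>\<^bsub>D\<^esub> d" if "i < s" for i
  proof -
    have c: "e i \<rhd>\<^bsub>D\<^esub> d \<in> carrier D" using assms(2) that by (simp add: D.lact_closed e_closed)
    have "(\<Oplus>\<^bsub>D\<^esub>j\<in>{..<s}. (e i \<rhd>\<^bsub>D\<^esub> d) \<lhd>\<^bsub>D\<^esub> e j) = (e i \<rhd>\<^bsub>D\<^esub> d) \<lhd>\<^bsub>D\<^esub> \<epsilon>"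
      unfolding \<epsilon>_def using additive_finsum[OF A.abelian_group_axioms D.abelian_group_D
          D.additive_ract_scalar[OF c] ec] by simp
    also have "\<dots> = e i \<rhd>\<^bsub>D\<^esub> d"
      using assms(2,3) that by (simp add: D.lact_ract e_closed eps_closed)
    finally show ?thesis .
  qed
  then have "(\<Oplus>\<^bsub>D\<^esub>i\<in>{..<s}. \<Oplus>\<^bsub>D\<^esub>j\<in>{..<s}. (e i \<rhd>\<^bsub>D\<^esub> d) \<lhd>\<^bsub>D\<^esub> e j) = (\<Oplus>\<^bsub>D\<^esub>i\<in>{..<s}. e i \<rhd>\<^bsub>D\<^esub> d)"
    using assms(2) by (intro D.D.M.finsum_cong') (auto simp: D.lact_closed e_closed)
  also have "\<dots> = \<epsilon> \<rhd>\<^bsub>D\<^esub> d"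
    using additive_finsum[OF L.R.abelian_group_axioms L.M.abelian_group_axioms
        L.additive_ract_scalar, of d e "{..<s}"] ec assms(2)
    by (simp add: \<epsilon>_def)
  finally show ?thesis using assms(4) by simp
qed

lemma ex_separated_corner_element:
  assumes D': "complex_bimodule A D'" "finite_dim (complex_bimodule.scalar_module A D')"
    and ij: "i < s" "j < s" and d: "d \<in> carrier D'" "(e i \<rhd>\<^bsub>D'\<^esub> d) \<lhd>\<^bsub>D'\<^esub> e j \<noteq> \<zero>\<^bsub>D'\<^esub>"
  obtains y \<psi> where "y \<in> carrier D'" "e i \<rhd>\<^bsub>D'\<^esub> y = y" "y \<lhd>\<^bsub>D'\<^esub> e j = y"
    "complex_vector_space.linear_form (complex_bimodule.scalar_module A D') \<psi>" "\<psi> y = 1"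
proof -
  interpret D': complex_bimodule A D' by fact
  define y where "y = (e i \<rhd>\<^bsub>D'\<^esub> d) \<lhd>\<^bsub>D'\<^esub> e j"
  have y: "y \<in> carrier D'" using d ij by (simp add: y_def D'.lact_closed D'.ract_closed e_closed)
  have 1: "y \<lhd>\<^bsub>D'\<^esub> e j = y"
    using d ij by (simp add: y_def D'.ract_mult[symmetric] D'.lact_closed e_closed e_idem)
  have 2: "e i \<rhd>\<^bsub>D'\<^esub> y = y"
    using d ij
    by (simp add: y_def D'.lact_mult[symmetric] D'.lact_ract D'.ract_closed e_closed e_idem)
  obtain \<psi> where "D'.S.linear_form \<psi>" "\<psi> y = 1"
    using D'.S.ex_separating_linear_form[OF D'(2), of y] y d(2) by (auto simp: y_def)
  then show thesis using that y 1 2 by blast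
qed

text \<open>The corners \<open>e\<^sub>i D e\<^sub>j\<close> are the multiplicity spaces of the simple bimodules in \<open>D\<close>.  If
  every simple bimodule occurring in \<open>D\<close> occurs in \<open>D'\<close>, the identity of \<open>D\<close> is a sum of
  maps factoring through \<open>D'\<close>: project to a basis vector of a corner, send it to a nonzero vector
  \<open>y\<^sub>i\<^sub>j\<close> of the same corner of \<open>D'\<close>, and go back.\<close>

lemma ex_factorization_of_identity:
  fixes D :: "('a, 'm, 'y) bimodule_scheme" and D' :: "('a, 'n, 'z) bimodule_scheme"
  assumes D: "complex_bimodule A D" and D': "complex_bimodule A D'"
    and fd: "finite_dim (complex_bimodule.scalar_module A D)"
      "finite_dim (complex_bimodule.scalar_module A D')"
    and corners: "\<And>i j d. \<lbrakk>i < s; j < s; d \<in> carrier D; (e i \<rhd>\<^bsub>D\<^esub> d) \<lhd>\<^bsub>D\<^esub> e j \<noteq> \<zero>\<^bsub>D\<^esub>\<rbrakk> \<Longrightarrow>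
      \<exists>d'\<in>carrier D'. (e i \<rhd>\<^bsub>D'\<^esub> d') \<lhd>\<^bsub>D'\<^esub> e j \<noteq> \<zero>\<^bsub>D'\<^esub>"
  obtains I :: "(nat \<times> nat \<times> 'm) set" and f g where "finite I"
    "\<And>k. k \<in> I \<Longrightarrow> f k \<in> bimod_hom A D D'" "\<And>k. k \<in> I \<Longrightarrow> g k \<in> bimod_hom A D' D"
    "\<And>d. d \<in> carrier D \<Longrightarrow> (\<Oplus>\<^bsub>D\<^esub>k\<in>I. g k (f k d)) = d"
proof -
  interpret D: complex_bimodule A D by fact
  interpret D': complex_bimodule A D' by fact
  note cl = D.lact_closed D.ract_closed D'.lact_closed D'.ract_closed e_closed eps_closed
  define Q where "Q i j y \<psi> \<longleftrightarrow>
      y \<in> carrier D' \<and> e i \<rhd>\<^bsub>D'\<^esub> y = y \<and> y \<lhd>\<^bsub>D'\<^esub> e j = y \<and> D'.S.linear_form \<psi> \<and>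
      (\<psi> y = 1 \<or> (\<forall>d\<in>carrier D. (e i \<rhd>\<^bsub>D\<^esub> d) \<lhd>\<^bsub>D\<^esub> e j = \<zero>\<^bsub>D\<^esub>))" for i j y \<psi>
  have "\<exists>y \<psi>. Q i j y \<psi>" if ij: "i < s" "j < s" for i j
  proof (cases "\<forall>d\<in>carrier D. (e i \<rhd>\<^bsub>D\<^esub> d) \<lhd>\<^bsub>D\<^esub> e j = \<zero>\<^bsub>D\<^esub>")
    case True
    moreover have "D'.S.linear_form (\<lambda>_. 0)" by (simp add: D'.S.linear_form_def)
    ultimately show ?thesis
      unfolding Q_def using ij by (intro exI[of _ "\<zero>\<^bsub>D'\<^esub>"] exI[of _ "\<lambda>_. 0"])
        (simp add: D'.lact_zero D'.zero_ract e_closed)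
  next
    case False
    then obtain d where d: "d \<in> carrier D'" "(e i \<rhd>\<^bsub>D'\<^esub> d) \<lhd>\<^bsub>D'\<^esub> e j \<noteq> \<zero>\<^bsub>D'\<^esub>"
      using corners[OF ij] by blast
    show ?thesis
      unfolding Q_def by (rule ex_separated_corner_element[OF D' fd(2) ij d]) blast
  qed
  then have "\<exists>p. \<forall>i j. i < s \<longrightarrow> j < s \<longrightarrow> Q i j (fst (p i j)) (snd (p i j))"
    by (intro choice allI) (metis fst_conv snd_conv)
  then obtain p where p: "\<forall>i j. i < s \<longrightarrow> j < s \<longrightarrow> Q i j (fst (p i j)) (snd (p i j))" by blast
  define y where "y = (\<lambda>i j. fst (p i j))"
  define \<psi> where "\<psi> = (\<lambda>i j. snd (p i j))"
  have "Q i j (y i j) (\<psi> i j)" if "i < s" "j < s" for i j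
    using p that by (simp add: y_def \<psi>_def)
  then have y: "\<And>i j. \<lbrakk>i < s; j < s\<rbrakk> \<Longrightarrow> y i j \<in> carrier D'"
      "\<And>i j. \<lbrakk>i < s; j < s\<rbrakk> \<Longrightarrow> e i \<rhd>\<^bsub>D'\<^esub> y i j = y i j"
      "\<And>i j. \<lbrakk>i < s; j < s\<rbrakk> \<Longrightarrow> y i j \<lhd>\<^bsub>D'\<^esub> e j = y i j"
      "\<And>i j. \<lbrakk>i < s; j < s\<rbrakk> \<Longrightarrow> D'.S.linear_form (\<psi> i j)"
      "\<And>i j. \<lbrakk>i < s; j < s\<rbrakk> \<Longrightarrow>
        \<psi> i j (y i j) = 1 \<or> (\<forall>d\<in>carrier D. (e i \<rhd>\<^bsub>D\<^esub> d) \<lhd>\<^bsub>D\<^esub> e j = \<zero>\<^bsub>D\<^esub>)"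
    unfolding Q_def by blast+
  obtain X \<phi> where "D.S.basis_with_coordinates X \<phi>"
    using D.S.ex_basis_with_coordinates[OF fd(1)] by blast
  then have X: "finite X" "X \<subseteq> carrier D" "\<And>x. x \<in> X \<Longrightarrow> D.S.linear_form (\<phi> x)"
      and basis: "\<And>d. d \<in> carrier D \<Longrightarrow> d = (\<Oplus>\<^bsub>D.scalar_module\<^esub>x\<in>X. \<phi> x d \<odot>\<^bsub>D.scalar_module\<^esub> x)"
    unfolding D.S.basis_with_coordinates_def by (simp_all only: D.scalar_module_simps)
  define I where "I = {..<s} \<times> {..<s} \<times> X"
  have I: "finite I" using X by (simp add: I_def)
  define corner where "corner d \<longleftrightarrow> d \<lhd>\<^bsub>D\<^esub> \<epsilon> = d \<and> \<epsilon> \<rhd>\<^bsub>D\<^esub> d = d" for d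
  define corner' where "corner' d \<longleftrightarrow> d \<lhd>\<^bsub>D'\<^esub> \<epsilon> = d \<and> \<epsilon> \<rhd>\<^bsub>D'\<^esub> d = d" for d
  have "\<exists>f. f \<in> bimod_hom A D D' \<and> (\<forall>d\<in>carrier D. corner d \<longrightarrow>
      f d = y i j \<lhd>\<^bsub>D'\<^esub> (\<phi> x ((e i \<rhd>\<^bsub>D\<^esub> d) \<lhd>\<^bsub>D\<^esub> e j) \<odot> \<one>))"
    if "i < s" "j < s" "x \<in> X" for i j x
    by (rule ex_rank_one_bimod_hom[OF D D' that(1,2) y(1-3)[OF that(1,2)] X(3)[OF that(3)]])
      (auto simp: corner_def)
  then obtain f where f: "\<And>i j x. \<lbrakk>i < s; j < s; x \<in> X\<rbrakk> \<Longrightarrow> f i j x \<in> bimod_hom A D D'"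
      "\<And>i j x d. \<lbrakk>i < s; j < s; x \<in> X; d \<in> carrier D; corner d\<rbrakk> \<Longrightarrow>
        f i j x d = y i j \<lhd>\<^bsub>D'\<^esub> (\<phi> x ((e i \<rhd>\<^bsub>D\<^esub> d) \<lhd>\<^bsub>D\<^esub> e j) \<odot> \<one>)"
    by metis
  have "\<exists>g. g \<in> bimod_hom A D' D \<and> (\<forall>d\<in>carrier D'. corner' d \<longrightarrow>
      g d = (e i \<rhd>\<^bsub>D\<^esub> x) \<lhd>\<^bsub>D\<^esub> e j \<lhd>\<^bsub>D\<^esub> (\<psi> i j ((e i \<rhd>\<^bsub>D'\<^esub> d) \<lhd>\<^bsub>D'\<^esub> e j) \<odot> \<one>))"
    if ij: "i < s" "j < s" and x: "x \<in> X" for i j x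
  proof -
    have xc: "x \<in> carrier D" using x X by auto
    have "(e i \<rhd>\<^bsub>D\<^esub> x) \<lhd>\<^bsub>D\<^esub> e j \<in> carrier D" using xc ij by (simp add: cl)
    moreover have "e i \<rhd>\<^bsub>D\<^esub> ((e i \<rhd>\<^bsub>D\<^esub> x) \<lhd>\<^bsub>D\<^esub> e j) = (e i \<rhd>\<^bsub>D\<^esub> x) \<lhd>\<^bsub>D\<^esub> e j"
      using xc ij by (simp add: cl D.lact_ract D.lact_mult[symmetric] e_idem)
    moreover have "(e i \<rhd>\<^bsub>D\<^esub> x) \<lhd>\<^bsub>D\<^esub> e j \<lhd>\<^bsub>D\<^esub> e j = (e i \<rhd>\<^bsub>D\<^esub> x) \<lhd>\<^bsub>D\<^esub> e j"
      using xc ij by (simp add: cl D.ract_mult[symmetric] e_idem)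
    ultimately show ?thesis
      by (rule ex_rank_one_bimod_hom[OF D' D ij _ _ _ y(4)[OF ij]]) (auto simp: corner'_def)
  qed
  then obtain g where g: "\<And>i j x. \<lbrakk>i < s; j < s; x \<in> X\<rbrakk> \<Longrightarrow> g i j x \<in> bimod_hom A D' D"
      "\<And>i j x d. \<lbrakk>i < s; j < s; x \<in> X; d \<in> carrier D'; corner' d\<rbrakk> \<Longrightarrow>
        g i j x d = (e i \<rhd>\<^bsub>D\<^esub> x) \<lhd>\<^bsub>D\<^esub> e j \<lhd>\<^bsub>D\<^esub> (\<psi> i j ((e i \<rhd>\<^bsub>D'\<^esub> d) \<lhd>\<^bsub>D'\<^esub> e j) \<odot> \<one>)"
    by metis
  define f' where "f' = (\<lambda>(i, j, x). f i j x)"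
  define g' where "g' = (\<lambda>(i, j, x). g i j x)"
  have f': "f' k \<in> bimod_hom A D D'" and g': "g' k \<in> bimod_hom A D' D" if "k \<in> I" for k
    using that f(1) g(1) by (auto simp: I_def f'_def g'_def)
  note f'D = bimod_homD[OF f'] and g'D = bimod_homD[OF g']
  note gf_closed = additive_closed[OF g'D(2) additive_closed[OF f'D(2)]]
  define G where "G = (\<lambda>d. \<Oplus>\<^bsub>D\<^esub>k\<in>I. g' k (f' k d))"
  have "G \<in> bimod_hom A D D"
    unfolding bimod_hom_def rmod_hom_def mem_Collect_eq
  proof (intro conjI ballI)
    show "G \<in> additive_maps D D"
      unfolding G_def[abs_def]
      by (rule additive_finsum_maps[OF D.abelian_group_D D.abelian_group_D])
        (rule additive_comp[OF f'D(2) g'D(2)])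
    fix d x assume d: "d \<in> carrier D" and x: "x \<in> carrier A"
    have "G (d \<lhd>\<^bsub>D\<^esub> x) = (\<Oplus>\<^bsub>D\<^esub>k\<in>I. g' k (f' k d) \<lhd>\<^bsub>D\<^esub> x)"
      unfolding G_def using x d
      by (intro D.D.M.finsum_cong')
        (auto simp: f'D(3) g'D(3) gf_closed additive_closed[OF f'D(2)] D.ract_closed)
    also have "\<dots> = G d \<lhd>\<^bsub>D\<^esub> x"
      unfolding G_def using x d
      by (intro additive_finsum[OF D.abelian_group_D D.abelian_group_D D.additive_ract, symmetric])
        (auto simp: gf_closed)
    finally show "G (d \<lhd>\<^bsub>D\<^esub> x) = G d \<lhd>\<^bsub>D\<^esub> x" .
    have "G (x \<rhd>\<^bsub>D\<^esub> d) = (\<Oplus>\<^bsub>D\<^esub>k\<in>I. x \<rhd>\<^bsub>D\<^esub> g' k (f' k d))"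
      unfolding G_def using x d
      by (intro D.D.M.finsum_cong')
        (auto simp: f'D(4) g'D(4) gf_closed additive_closed[OF f'D(2)] D.lact_closed)
    also have "\<dots> = x \<rhd>\<^bsub>D\<^esub> G d"
      unfolding G_def using x d
      by (intro additive_finsum[OF D.abelian_group_D D.abelian_group_D D.additive_lact, symmetric])
        (auto simp: gf_closed)
    finally show "G (x \<rhd>\<^bsub>D\<^esub> d) = x \<rhd>\<^bsub>D\<^esub> G d" .
  qed
  moreover have "G d = d" if d: "d \<in> carrier D" "d \<lhd>\<^bsub>D\<^esub> \<epsilon> = d" "\<epsilon> \<rhd>\<^bsub>D\<^esub> d = d" for d
  proof -
    define dij where "dij = (\<lambda>i j. (e i \<rhd>\<^bsub>D\<^esub> d) \<lhd>\<^bsub>D\<^esub> e j)"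
    have gf: "g i j x (f i j x d) = (e i \<rhd>\<^bsub>D\<^esub> (x \<lhd>\<^bsub>D\<^esub> (\<phi> x (dij i j) \<odot> \<one>))) \<lhd>\<^bsub>D\<^esub> e j"
      if ij: "i < s" "j < s" and x: "x \<in> X" for i j x
    proof -
      have xc: "x \<in> carrier D" using x X by auto
      let ?c = "\<phi> x (dij i j)"
      note fD = bimod_homD[OF f(1)[OF ij x]]
      have fd_c: "f i j x d \<in> carrier D'" using additive_closed[OF fD(2) d(1)] .
      have fd_corner: "corner' (f i j x d)"
        using fD(3)[OF d(1) eps_closed] fD(4)[OF d(1) eps_closed] d(2,3) by (simp add: corner'_def)
      have fd: "f i j x d = y i j \<lhd>\<^bsub>D'\<^esub> (?c \<odot> \<one>)"
        using f(2)[OF ij x d(1)] d by (simp add: corner_def dij_def)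
      have "y i j \<lhd>\<^bsub>D'\<^esub> (?c \<odot> \<one>) \<lhd>\<^bsub>D'\<^esub> e j = y i j \<lhd>\<^bsub>D'\<^esub> e j \<lhd>\<^bsub>D'\<^esub> (?c \<odot> \<one>)"
        using y(1)[OF ij] ij by (simp add: cl D'.ract_mult[symmetric] scalar_left scalar_right)
      then have "(e i \<rhd>\<^bsub>D'\<^esub> f i j x d) \<lhd>\<^bsub>D'\<^esub> e j = y i j \<lhd>\<^bsub>D'\<^esub> (?c \<odot> \<one>)"
        using y(1-3)[OF ij] ij by (simp add: fd cl D'.lact_ract[symmetric])
      then have "g i j x (f i j x d)
          = (e i \<rhd>\<^bsub>D\<^esub> x) \<lhd>\<^bsub>D\<^esub> e j \<lhd>\<^bsub>D\<^esub> ((?c * \<psi> i j (y i j)) \<odot> \<one>)"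
        using g(2)[OF ij x fd_c fd_corner] D'.linear_form_scalar(1)[OF y(4)[OF ij] y(1)[OF ij]] by simp
      also have "\<dots> = (e i \<rhd>\<^bsub>D\<^esub> x) \<lhd>\<^bsub>D\<^esub> e j \<lhd>\<^bsub>D\<^esub> (?c \<odot> \<one>)"
        using y(5)[OF ij] xc by (auto simp: D.zero_ract)
      also have "\<dots> = (e i \<rhd>\<^bsub>D\<^esub> (x \<lhd>\<^bsub>D\<^esub> (?c \<odot> \<one>))) \<lhd>\<^bsub>D\<^esub> e j"
        using xc ij by (simp add: cl D.lact_ract D.ract_mult[symmetric] scalar_left scalar_right)
      finally show ?thesis .
    qed
    have sum_x: "(\<Oplus>\<^bsub>D\<^esub>x\<in>X. g i j x (f i j x d)) = dij i j" if ij: "i < s" "j < s" for i j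
    proof -
      have dc: "dij i j \<in> carrier D" using d ij by (simp add: dij_def cl)
      have add: "(\<lambda>m. (e i \<rhd>\<^bsub>D\<^esub> m) \<lhd>\<^bsub>D\<^esub> e j) \<in> additive_maps D D"
        using ij by (intro additive_comp[OF D.additive_lact D.additive_ract]) (auto simp: e_closed)
      have "(\<Oplus>\<^bsub>D\<^esub>x\<in>X. g i j x (f i j x d))
          = (\<Oplus>\<^bsub>D\<^esub>x\<in>X. (e i \<rhd>\<^bsub>D\<^esub> (x \<lhd>\<^bsub>D\<^esub> (\<phi> x (dij i j) \<odot> \<one>))) \<lhd>\<^bsub>D\<^esub> e j)"
        using X ij by (intro D.D.M.finsum_cong') (auto simp: gf cl subset_iff)
      also have "\<dots> = (e i \<rhd>\<^bsub>D\<^esub> (\<Oplus>\<^bsub>D\<^esub>x\<in>X. x \<lhd>\<^bsub>D\<^esub> (\<phi> x (dij i j) \<odot> \<one>))) \<lhd>\<^bsub>D\<^esub> e j"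
        by (rule additive_finsum[OF D.abelian_group_D D.abelian_group_D add, symmetric])
          (use X in \<open>auto simp: cl subset_iff\<close>)
      also have "(\<Oplus>\<^bsub>D\<^esub>x\<in>X. x \<lhd>\<^bsub>D\<^esub> (\<phi> x (dij i j) \<odot> \<one>)) = dij i j"
        using basis[OF dc] X
          D.finsum_scalar_module[of "\<lambda>x. x \<lhd>\<^bsub>D\<^esub> (\<phi> x (dij i j) \<odot> \<one>)" X]
        by (simp add: cl Pi_iff subset_iff)
      also have "(e i \<rhd>\<^bsub>D\<^esub> dij i j) \<lhd>\<^bsub>D\<^esub> e j = dij i j"
        using d ij unfolding dij_def
        by (simp add: cl D.lact_ract D.lact_mult[symmetric] D.ract_mult[symmetric] e_idem)
      finally show ?thesis .
    qed
    have gfc: "g i j x (f i j x d) \<in> carrier D" if "i < s" "j < s" "x \<in> X" for i j x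
      using additive_closed[OF bimod_homD(2)[OF g(1)[OF that]]
          additive_closed[OF bimod_homD(2)[OF f(1)[OF that]] d(1)]] .
    have "G d = (\<Oplus>\<^bsub>D\<^esub>i\<in>{..<s}. \<Oplus>\<^bsub>D\<^esub>k\<in>{..<s} \<times> X. g' (i, k) (f' (i, k) d))"
      unfolding G_def I_def
      by (rule D.D.M.finsum_cartesian) (use X gfc in \<open>auto simp: f'_def g'_def\<close>)
    also have "\<dots> = (\<Oplus>\<^bsub>D\<^esub>i\<in>{..<s}. \<Oplus>\<^bsub>D\<^esub>j\<in>{..<s}. \<Oplus>\<^bsub>D\<^esub>x\<in>X. g i j x (f i j x d))"
    proof (rule D.D.M.finsum_cong')
      fix i assume "i \<in> {..<s}"
      then show "(\<Oplus>\<^bsub>D\<^esub>k\<in>{..<s} \<times> X. g' (i, k) (f' (i, k) d))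
          = (\<Oplus>\<^bsub>D\<^esub>j\<in>{..<s}. \<Oplus>\<^bsub>D\<^esub>x\<in>X. g i j x (f i j x d))"
        by (subst D.D.M.finsum_cartesian) (use X gfc in \<open>auto simp: f'_def g'_def\<close>)
    qed (use gfc in \<open>auto intro!: D.D.M.finsum_closed\<close>)
    also have "\<dots> = (\<Oplus>\<^bsub>D\<^esub>i\<in>{..<s}. \<Oplus>\<^bsub>D\<^esub>j\<in>{..<s}. dij i j)"
      by (intro D.D.M.finsum_cong' refl Pi_I D.D.M.finsum_closed)
        (use d in \<open>auto simp: sum_x dij_def cl\<close>)
    also have "\<dots> = d" using sum_corners[OF D d] by (simp add: dij_def)
    finally show ?thesis .
  qed
  ultimately have "G d = d" if "d \<in> carrier D" for d
    using bimod_hom_eq_id_if_eq_on_corner[OF D _ _ that] by blast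
  then show thesis using that[OF I f' g'] by (simp add: G_def)
qed

theorem iso_to_bimod_summand_iff_corners:
  fixes D :: "('a, 'm, 'y) bimodule_scheme" and D' :: "('a, 'n, 'z) bimodule_scheme"
  assumes D: "complex_bimodule A D" and D': "complex_bimodule A D'"
    and fd: "finite_dim (complex_bimodule.scalar_module A D)"
      "finite_dim (complex_bimodule.scalar_module A D')"
  shows "(\<exists>q>0. iso_to_bimod_summand A D (bimod_dsum {..<q::nat} (\<lambda>_. D'))) \<longleftrightarrow>
    (\<forall>i<s. \<forall>j<s. (\<exists>d\<in>carrier D. (e i \<rhd>\<^bsub>D\<^esub> d) \<lhd>\<^bsub>D\<^esub> e j \<noteq> \<zero>\<^bsub>D\<^esub>) \<longrightarrow>
      (\<exists>d\<in>carrier D'. (e i \<rhd>\<^bsub>D'\<^esub> d) \<lhd>\<^bsub>D'\<^esub> e j \<noteq> \<zero>\<^bsub>D'\<^esub>))" (is "?L \<longleftrightarrow> ?R")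
proof
  assume ?L
  then show ?R using iso_to_bimod_summand_corner_zero[OF D D'] e_closed by blast
next
  interpret D: complex_bimodule A D by fact
  interpret D': complex_bimodule A D' by fact
  assume R: ?R
  have corners: "\<exists>d'\<in>carrier D'. (e i \<rhd>\<^bsub>D'\<^esub> d') \<lhd>\<^bsub>D'\<^esub> e j \<noteq> \<zero>\<^bsub>D'\<^esub>"
    if "i < s" "j < s" "d \<in> carrier D" "(e i \<rhd>\<^bsub>D\<^esub> d) \<lhd>\<^bsub>D\<^esub> e j \<noteq> \<zero>\<^bsub>D\<^esub>" for i j d
    using R that by blast
  obtain I :: "(nat \<times> nat \<times> 'm) set" and f g where I: "finite I"
    and fg: "\<And>k. k \<in> I \<Longrightarrow> f k \<in> bimod_hom A D D'" "\<And>k. k \<in> I \<Longrightarrow> g k \<in> bimod_hom A D' D"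
    and id: "\<And>d. d \<in> carrier D \<Longrightarrow> (\<Oplus>\<^bsub>D\<^esub>k\<in>I. g k (f k d)) = d"
    by (rule ex_factorization_of_identity[OF D D' fd], erule (3) corners, rule that)
  obtain u where u: "bij_betw u {..<card I} I"
    using I by (metis bij_betw_from_nat_into_finite)
  \<comment> \<open>Zero maps at the index \<open>card I\<close> keep the number of copies positive when \<open>I\<close> is empty.\<close>
  define f' where "f' = (\<lambda>k. if k < card I then f (u k) else (\<lambda>_. \<zero>\<^bsub>D'\<^esub>))"
  define g' where "g' = (\<lambda>k. if k < card I then g (u k) else (\<lambda>_. \<zero>\<^bsub>D\<^esub>))"
  have zero: "(\<lambda>_. \<zero>\<^bsub>D'\<^esub>) \<in> bimod_hom A D D'" "(\<lambda>_. \<zero>\<^bsub>D\<^esub>) \<in> bimod_hom A D' D"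
    by (auto simp: bimod_hom_def rmod_hom_def hom_def D.lact_zero D'.lact_zero D.zero_ract D'.zero_ract)
  have mem: "u k \<in> I" if "k < card I" for k using u that by (auto simp: bij_betw_def)
  have "iso_to_bimod_summand A D (bimod_dsum {..<Suc (card I)} (\<lambda>_. D'))"
  proof (rule iso_to_bimod_summandI[OF D D'])
    show "f' k \<in> bimod_hom A D D'" "g' k \<in> bimod_hom A D' D" for k
      using fg mem zero by (auto simp: f'_def g'_def)
    fix d assume d: "d \<in> carrier D"
    have gf: "g k (f k d) \<in> carrier D" if "k \<in> I" for k
      using additive_closed[OF bimod_homD(2)[OF fg(2)] additive_closed[OF bimod_homD(2)[OF fg(1)]]]
        that d by blast
    have "(\<Oplus>\<^bsub>D\<^esub>k\<in>{..<Suc (card I)}. g' k (f' k d)) = (\<Oplus>\<^bsub>D\<^esub>k\<in>{..<card I}. g' k (f' k d))"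
      using gf mem by (simp add: lessThan_Suc g'_def f'_def Pi_iff)
    also have "\<dots> = (\<Oplus>\<^bsub>D\<^esub>k\<in>{..<card I}. g (u k) (f (u k) d))"
      using gf mem by (intro D.D.M.finsum_cong') (auto simp: f'_def g'_def)
    also have "\<dots> = (\<Oplus>\<^bsub>D\<^esub>k\<in>I. g k (f k d))"
      using u gf D.D.M.finsum_reindex[of "\<lambda>k. g k (f k d)" u "{..<card I}"]
      by (auto simp: bij_betw_def)
    also have "\<dots> = d" using id[OF d] .
    finally show "(\<Oplus>\<^bsub>D\<^esub>k\<in>{..<Suc (card I)}. g' k (f' k d)) = d" .
  qed
  then show ?L by blast
qed

end

section \<open>Tensor powers of an algebra over a subalgebra\<close>

locale algebra_tensor_power = complex_algebra A for A :: "(complex, 'a, 'x) module_scheme" (structure) +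
  fixes B :: "'a set" and n :: nat
  assumes subalgebra: "complex_subalgebra B A" and n_pos: "n \<ge> 1"
begin

abbreviation F :: "('a list \<Rightarrow>\<^sub>0 int) monoid" where "F \<equiv> free_Abelian_group (tuples A n)"
abbreviation K :: "('a list \<Rightarrow>\<^sub>0 int) set" where "K \<equiv> tensor_kernel A B n"
abbreviation D :: "('a, ('a list \<Rightarrow>\<^sub>0 int) set) bimodule" where "D \<equiv> tensor_power A B n"

definition cls :: "('a list \<Rightarrow>\<^sub>0 int) \<Rightarrow> ('a list \<Rightarrow>\<^sub>0 int) set" where "cls x = K #>\<^bsub>F\<^esub> x"

definition pure :: "'a list \<Rightarrow> ('a list \<Rightarrow>\<^sub>0 int) set" where "pure w = cls (frag_of w)"

lemma B_subset: "b \<in> B \<Longrightarrow> b \<in> carrier A"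
  using subalgebra subringE(1) by (auto simp: complex_subalgebra_def)

lemma tuple_nth: "\<lbrakk>w \<in> tuples A n; i < n\<rbrakk> \<Longrightarrow> w ! i \<in> carrier A"
  by (auto simp: tuples_def)

lemma tuple_update: "\<lbrakk>w \<in> tuples A n; x \<in> carrier A\<rbrakk> \<Longrightarrow> w[i := x] \<in> tuples A n"
  using set_update_subset_insert[of w i x] by (auto simp: tuples_def)

lemma tuple_length: "w \<in> tuples A n \<Longrightarrow> length w = n"
  by (simp add: tuples_def)

lemma keys_diff3: "Poly_Mapping.keys (frag_of u - frag_of v - frag_of w) \<subseteq> {u, v, w}"
  using keys_diff[of "frag_of u - frag_of v" "frag_of w"] keys_diff[of "frag_of u" "frag_of v"] by auto

lemma relator_cases:
  assumes "x \<in> tensor_relators A B n"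
  obtains (add) w i y z where "w \<in> tuples A n" "i < n" "y \<in> carrier A" "z \<in> carrier A"
      "x = frag_of (w[i := y \<oplus> z]) - frag_of (w[i := y]) - frag_of (w[i := z])"
    | (bal) w i b where "w \<in> tuples A n" "Suc i < n" "b \<in> B"
      "x = frag_of (w[i := w ! i \<otimes> b]) - frag_of (w[Suc i := b \<otimes> w ! Suc i])"
  using assms unfolding tensor_relators_def by blast

lemma relators_closed: "tensor_relators A B n \<subseteq> carrier F"
proof
  fix x assume x: "x \<in> tensor_relators A B n"
  from x show "x \<in> carrier F"
  proof (cases rule: relator_cases)
    case (add w i y z)
    then have "{w[i := y \<oplus> z], w[i := y], w[i := z]} \<subseteq> tuples A n"
      by (simp add: tuple_update)
    then show ?thesis using add(5) keys_diff3 by (auto dest!: subsetD[OF keys_diff3])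
  next
    case (bal w i b)
    then have "{w[i := w ! i \<otimes> b], w[Suc i := b \<otimes> w ! Suc i]} \<subseteq> tuples A n"
      by (simp add: tuple_update tuple_nth B_subset)
    then show ?thesis using bal(4) by (auto dest!: subsetD[OF keys_diff])
  qed
qed

interpretation F: comm_group F by (rule abelian_free_Abelian_group)

lemma subgroup_K: "subgroup K F"
  unfolding tensor_kernel_def by (rule F.generate_is_subgroup[OF relators_closed])

lemma K_leastI: "\<lbrakk>subgroup H F; tensor_relators A B n \<subseteq> H\<rbrakk> \<Longrightarrow> K \<subseteq> H"
  unfolding tensor_kernel_def by (rule F.generate_subgroup_incl)

interpretation K: normal K F
  by (rule F.subgroup_imp_normal[OF subgroup_K])

lemma K_zero: "0 \<in> K" using K.one_closed by simp
lemma K_add: "\<lbrakk>x \<in> K; y \<in> K\<rbrakk> \<Longrightarrow> x + y \<in> K" using K.m_closed by simp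
lemma K_closed: "x \<in> K \<Longrightarrow> Poly_Mapping.keys x \<subseteq> tuples A n" by (drule subsetD[OF K.subset]) simp
lemma K_minus: "x \<in> K \<Longrightarrow> - x \<in> K" using K.m_inv_closed[of x] K_closed[of x] by simp

lemma cls_def': "cls x = (\<lambda>k. k + x) ` K"
  by (auto simp: cls_def r_coset_def)

lemma cls_eq_iff: "cls x = cls y \<longleftrightarrow> x - y \<in> K"
proof
  assume "cls x = cls y"
  moreover have "x \<in> cls x" using K_zero by (force simp: cls_def')
  ultimately obtain k where "k \<in> K" "x = k + y" by (auto simp: cls_def')
  then show "x - y \<in> K" by simp
next
  assume *: "x - y \<in> K"
  have "cls x \<subseteq> cls y" if "x - y \<in> K" for x y
  proof
    fix z assume "z \<in> cls x"
    then obtain k where k: "k \<in> K" "z = k + x" by (auto simp: cls_def')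
    have "z = (k + (x - y)) + y" using k by simp
    then show "z \<in> cls y" using K_add[OF k(1) that] unfolding cls_def' by blast
  qed
  from this[OF *] this[of y x] K_minus[OF *] show "cls x = cls y" by simp
qed

lemma carrier_D: "carrier D = cls ` {x. Poly_Mapping.keys x \<subseteq> tuples A n}"
  by (auto simp: tensor_power_def Let_def carrier_FactGroup cls_def free_Abelian_group_def)

lemma zero_D: "\<zero>\<^bsub>D\<^esub> = cls 0"
  by (simp add: tensor_power_def Let_def cls_def')

lemma add_D:
  assumes "Poly_Mapping.keys x \<subseteq> tuples A n" "Poly_Mapping.keys y \<subseteq> tuples A n"
  shows "cls x \<oplus>\<^bsub>D\<^esub> cls y = cls (x + y)"
  using K.rcos_sum[of x y] assms by (simp add: tensor_power_def Let_def cls_def)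

lemma cls_eq_zero_iff: "cls x = \<zero>\<^bsub>D\<^esub> \<longleftrightarrow> x \<in> K"
  by (simp add: zero_D cls_eq_iff)

lemma keys_add_tuples: "\<lbrakk>Poly_Mapping.keys x \<subseteq> S; Poly_Mapping.keys y \<subseteq> S\<rbrakk> \<Longrightarrow> Poly_Mapping.keys (x + y) \<subseteq> S"
  using keys_add[of x y] by blast

lemma cls_closed: "Poly_Mapping.keys x \<subseteq> tuples A n \<Longrightarrow> cls x \<in> carrier D"
  by (simp add: carrier_D)

lemma pure_closed: "w \<in> tuples A n \<Longrightarrow> pure w \<in> carrier D"
  by (simp add: pure_def cls_closed)

lemma abelian_group_D: "abelian_group D"
proof (rule abelian_groupI)
  fix X assume "X \<in> carrier D"
  then obtain x where x: "X = cls x" "Poly_Mapping.keys x \<subseteq> tuples A n" by (auto simp: carrier_D)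
  then show "\<exists>Y\<in>carrier D. Y \<oplus>\<^bsub>D\<^esub> X = \<zero>\<^bsub>D\<^esub>"
    by (intro bexI[of _ "cls (- x)"]) (auto simp: add_D zero_D cls_closed)
qed (auto simp: carrier_D add_D zero_D keys_add_tuples ac_simps)

sublocale D: abelian_group D by (rule abelian_group_D)

text \<open>Pure tensors generate the tensor power as an abelian group.\<close>

lemma additive_ext:
  assumes "abelian_group G" "S \<in> additive_maps D G" "T \<in> additive_maps D G"
    and eq: "\<And>w. w \<in> tuples A n \<Longrightarrow> S (pure w) = T (pure w)"
    and d: "d \<in> carrier D"
  shows "S d = T d"
proof -
  interpret G: abelian_group G by fact
  obtain x where x: "d = cls x" "Poly_Mapping.keys x \<subseteq> tuples A n" using d by (auto simp: carrier_D)
  have "S (cls x) = T (cls x)"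
    using x(2)
  proof (induction x rule: free_Abelian_group_induct[consumes 1, case_names zero diff one])
    case zero
    show ?case
      using additive_zero[OF abelian_group_D assms(1,2)] additive_zero[OF abelian_group_D assms(1,3)]
      by (simp flip: zero_D)
  next
    case (diff x y)
    have cy: "cls y \<in> carrier D" "cls x \<in> carrier D" using diff by (simp_all add: cls_closed)
    have "cls (x - y) = cls x \<oplus>\<^bsub>D\<^esub> cls (- y)"
      using diff add_D[of x "- y"] by simp
    also have "cls (- y) = \<ominus>\<^bsub>D\<^esub> cls y"
      using diff cy by (intro D.minus_equality[symmetric]) (simp_all add: add_D zero_D cls_closed)
    finally have "cls (x - y) = cls x \<oplus>\<^bsub>D\<^esub> \<ominus>\<^bsub>D\<^esub> cls y" .
    then show ?case
      using diff cy by (simp add: additive_add[OF assms(2)] additive_add[OF assms(3)]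
          additive_minus[OF abelian_group_D assms(1,2)] additive_minus[OF abelian_group_D assms(1,3)])
  next
    case (one w)
    then show ?case using eq by (simp add: pure_def)
  qed
  then show ?thesis by (simp add: x)
qed

lemma pure_add:
  assumes "w \<in> tuples A n" "i < n" "x \<in> carrier A" "y \<in> carrier A"
  shows "pure (w[i := x \<oplus> y]) = pure (w[i := x]) \<oplus>\<^bsub>D\<^esub> pure (w[i := y])"
proof -
  have "frag_of (w[i := x \<oplus> y]) - frag_of (w[i := x]) - frag_of (w[i := y]) \<in> tensor_relators A B n"
    unfolding tensor_relators_def using assms by blast
  then have "frag_of (w[i := x \<oplus> y]) - (frag_of (w[i := x]) + frag_of (w[i := y])) \<in> K"
    unfolding tensor_kernel_def by (metis diff_diff_eq generate.incl)
  then show ?thesis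
    using assms by (simp add: pure_def add_D tuple_update cls_eq_iff)
qed

lemma pure_balance:
  assumes "w \<in> tuples A n" "Suc i < n" "b \<in> B"
  shows "pure (w[i := w ! i \<otimes> b]) = pure (w[Suc i := b \<otimes> w ! Suc i])"
proof -
  have "frag_of (w[i := w ! i \<otimes> b]) - frag_of (w[Suc i := b \<otimes> w ! Suc i]) \<in> tensor_relators A B n"
    unfolding tensor_relators_def using assms by blast
  then show ?thesis
    by (simp add: pure_def cls_eq_iff tensor_kernel_def generate.incl)
qed

lemma additive_pure_update:
  assumes "w \<in> tuples A n" "i < n"
  shows "(\<lambda>x. pure (w[i := x])) \<in> additive_maps A D"
  by (rule additive_mapsI) (use assms in \<open>auto simp: pure_add pure_closed tuple_update\<close>)

lemma pure_finsum:
  assumes "w \<in> tuples A n" "i < n" "f \<in> I \<rightarrow> carrier A"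
  shows "pure (w[i := finsum A f I]) = (\<Oplus>\<^bsub>D\<^esub>k\<in>I. pure (w[i := f k]))"
  by (rule additive_finsum[OF A.abelian_group_axioms abelian_group_D additive_pure_update[OF assms(1,2)]
        assms(3)])

lemma pure_zero_entry:
  assumes "w \<in> tuples A n" "i < n" "w ! i = \<zero>"
  shows "pure w = \<zero>\<^bsub>D\<^esub>"
  using additive_zero[OF A.abelian_group_axioms abelian_group_D additive_pure_update[OF assms(1,2)]]
    assms by (metis list_update_id)

text \<open>An endomorphism \<open>g\<close> of \<open>A\<close> applied at one position descends to the tensor power, provided
  that it commutes with the actions of \<open>B\<close> used at the adjacent tensor signs.\<close>

lemma tensor_map_update:
  assumes p: "p < n" and g: "g \<in> additive_maps A A"
    and right: "\<And>x b. \<lbrakk>Suc p < n; x \<in> carrier A; b \<in> B\<rbrakk> \<Longrightarrow> g (x \<otimes> b) = g x \<otimes> b"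
    and left: "\<And>x b. \<lbrakk>p > 0; x \<in> carrier A; b \<in> B\<rbrakk> \<Longrightarrow> g (b \<otimes> x) = b \<otimes> g x"
  shows "(\<lambda>X. tensor_map A B n (\<lambda>w. w[p := g (w ! p)]) X) \<in> additive_maps D D"
    and "w \<in> tuples A n \<Longrightarrow> tensor_map A B n (\<lambda>w. w[p := g (w ! p)]) (pure w) = pure (w[p := g (w ! p)])"
proof -
  define f where "f = (\<lambda>w. w[p := g (w ! p)])"
  define \<phi> where "\<phi> = frag_extend (\<lambda>w. frag_of (f w))"
  have gc: "g x \<in> carrier A" if "x \<in> carrier A" for x using additive_closed[OF g that] .
  have f: "f w \<in> tuples A n" if "w \<in> tuples A n" for w
    using that p by (simp add: f_def tuple_update tuple_nth gc)
  have \<phi>_keys: "Poly_Mapping.keys (\<phi> x) \<subseteq> tuples A n" if "Poly_Mapping.keys x \<subseteq> tuples A n" for x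
    using keys_frag_extend[of "\<lambda>w. frag_of (f w)" x] f that by (fastforce simp: \<phi>_def)
  have \<phi>_add: "\<phi> (x + y) = \<phi> x + \<phi> y" and \<phi>_diff: "\<phi> (x - y) = \<phi> x - \<phi> y"
    and \<phi>_minus: "\<phi> (- x) = - \<phi> x" and \<phi>_of: "\<phi> (frag_of w) = frag_of (f w)" and \<phi>_0: "\<phi> 0 = 0" for x y w
    by (simp_all add: \<phi>_def frag_extend_add frag_extend_diff frag_extend_minus)
  have f_add: "f (w[i := x \<oplus> y]) = (f w)[i := (if i = p then g x else x) \<oplus> (if i = p then g y else y)]"
      "f (w[i := x]) = (f w)[i := (if i = p then g x else x)]"
    if "w \<in> tuples A n" "i < n" "x \<in> carrier A" "y \<in> carrier A" for w i x y
    using that p by (auto simp: f_def tuple_length additive_add[OF g] list_update_swap)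
  have "tensor_relators A B n \<subseteq> {x \<in> carrier F. \<phi> x \<in> K}"
  proof
    fix x assume x: "x \<in> tensor_relators A B n"
    from x have "\<phi> x \<in> tensor_relators A B n"
    proof (cases rule: relator_cases)
      case (add w i y z)
      let ?y = "if i = p then g y else y" and ?z = "if i = p then g z else z"
      have "\<phi> x = frag_of ((f w)[i := ?y \<oplus> ?z]) - frag_of ((f w)[i := ?y]) - frag_of ((f w)[i := ?z])"
        using f_add[OF add(1-4)] f_add(2)[OF add(1,2,4,4)] by (simp add: add(5) \<phi>_diff \<phi>_of)
      moreover have "f w \<in> tuples A n" "?y \<in> carrier A" "?z \<in> carrier A"
        using add f gc by auto
      ultimately show ?thesis unfolding tensor_relators_def using add(2) by blast
    next
      case (bal w i b)
      note len = tuple_length[OF bal(1)]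
      have nths: "w ! i \<in> carrier A" "w ! Suc i \<in> carrier A" using bal by (auto intro: tuple_nth)
      have "f (w[i := w ! i \<otimes> b]) = (f w)[i := f w ! i \<otimes> b]"
        using right[of "w ! i" b] nths bal(2,3) len
        by (cases "i = p") (auto simp: f_def list_update_swap)
      moreover have "f (w[Suc i := b \<otimes> w ! Suc i]) = (f w)[Suc i := b \<otimes> f w ! Suc i]"
        using left[of "w ! Suc i" b] nths bal(2,3) len
        by (cases "Suc i = p") (auto simp: f_def list_update_swap)
      ultimately have "\<phi> x = frag_of ((f w)[i := f w ! i \<otimes> b])
          - frag_of ((f w)[Suc i := b \<otimes> f w ! Suc i])"
        by (simp add: bal(4) \<phi>_diff \<phi>_of)
      then show ?thesis unfolding tensor_relators_def using bal(2,3) f[OF bal(1)] by blast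
    qed
    then have "\<phi> x \<in> K" by (simp add: tensor_kernel_def generate.incl)
    with x show "x \<in> {x \<in> carrier F. \<phi> x \<in> K}" using relators_closed by blast
  qed
  moreover have "subgroup {x \<in> carrier F. \<phi> x \<in> K} F"
    by (rule F.subgroupI)
      (auto simp: \<phi>_add \<phi>_minus K_add K_minus intro!: exI[of _ 0] dest: subsetD[OF keys_add],
        simp add: \<phi>_0 K_zero)
  ultimately have \<phi>_K: "\<phi> x \<in> K" if "x \<in> K" for x
    using K_leastI[of "{x \<in> carrier F. \<phi> x \<in> K}"] that by blast
  have map: "tensor_map A B n f (cls x) = cls (\<phi> x)" for x
  proof -
    have "tensor_map A B n f (cls x) = {k + \<phi> (k' + x) | k k'. k \<in> K \<and> k' \<in> K}"
      by (auto simp: tensor_map_def set_mult_def cls_def' \<phi>_def)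
    also have "\<dots> = cls (\<phi> x)"
    proof (intro equalityI subsetI)
      fix z assume "z \<in> {k + \<phi> (k' + x) | k k'. k \<in> K \<and> k' \<in> K}"
      then obtain k k' where "k \<in> K" "k' \<in> K" "z = (k + \<phi> k') + \<phi> x" by (auto simp: \<phi>_add)
      then show "z \<in> cls (\<phi> x)" unfolding cls_def' using K_add \<phi>_K by blast
    next
      fix z assume "z \<in> cls (\<phi> x)"
      then obtain k where "k \<in> K" "z = k + \<phi> (0 + x)" by (auto simp: cls_def')
      then show "z \<in> {k + \<phi> (k' + x) | k k'. k \<in> K \<and> k' \<in> K}" using K_zero by blast
    qed
    finally show ?thesis .
  qed
  have "(\<lambda>X. tensor_map A B n f X) \<in> additive_maps D D"
    by (rule additive_mapsI) (auto simp: carrier_D map add_D keys_add_tuples \<phi>_keys \<phi>_add)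
  then show "(\<lambda>X. tensor_map A B n (\<lambda>w. w[p := g (w ! p)]) X) \<in> additive_maps D D"
    by (simp add: f_def)
  show "tensor_map A B n (\<lambda>w. w[p := g (w ! p)]) (pure w) = pure (w[p := g (w ! p)])"
    if "w \<in> tuples A n"
    using map[of "frag_of w"] by (simp add: pure_def \<phi>_of f_def)
qed

lemma ract_D: "X \<lhd>\<^bsub>D\<^esub> a = tensor_map A B n (\<lambda>w. w[n - 1 := w ! (n - 1) \<otimes> a]) X"
  by (simp add: tensor_power_def Let_def)

lemma lact_D: "a \<rhd>\<^bsub>D\<^esub> X = tensor_map A B n (\<lambda>w. w[0 := a \<otimes> w ! 0]) X"
  by (simp add: tensor_power_def Let_def)

lemma additive_ract: "a \<in> carrier A \<Longrightarrow> (\<lambda>X. X \<lhd>\<^bsub>D\<^esub> a) \<in> additive_maps D D"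
  unfolding ract_D
  by (rule tensor_map_update(1))
    (use n_pos in \<open>auto simp: B_subset A.m_assoc A.l_distr intro!: additive_mapsI\<close>)

lemma additive_lact: "a \<in> carrier A \<Longrightarrow> (\<lambda>X. a \<rhd>\<^bsub>D\<^esub> X) \<in> additive_maps D D"
  unfolding lact_D
  by (rule tensor_map_update(1))
    (use n_pos in \<open>auto simp: B_subset A.m_assoc A.r_distr intro!: additive_mapsI\<close>)

lemma pure_ract:
  "\<lbrakk>a \<in> carrier A; w \<in> tuples A n\<rbrakk> \<Longrightarrow> pure w \<lhd>\<^bsub>D\<^esub> a = pure (w[n - 1 := w ! (n - 1) \<otimes> a])"
  unfolding ract_D
  by (rule tensor_map_update(2))
    (use n_pos in \<open>auto simp: B_subset A.m_assoc A.l_distr intro!: additive_mapsI\<close>)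

lemma pure_lact:
  "\<lbrakk>a \<in> carrier A; w \<in> tuples A n\<rbrakk> \<Longrightarrow> a \<rhd>\<^bsub>D\<^esub> pure w = pure (w[0 := a \<otimes> w ! 0])"
  unfolding lact_D
  by (rule tensor_map_update(2))
    (use n_pos in \<open>auto simp: B_subset A.m_assoc A.r_distr intro!: additive_mapsI\<close>)

lemma scalar_in_B: "c \<odot> \<one> \<in> B"
  using subalgebra subringE(3) by (auto simp: complex_subalgebra_def)

text \<open>Scalars belong to \<open>B\<close>, so they move through every tensor sign.\<close>

lemma pure_scalar_position:
  assumes "w \<in> tuples A n" "k < n"
  shows "pure (w[k := c \<odot> w ! k]) = pure (w[n - 1 := c \<odot> w ! (n - 1)])"
  using assms(2)
proof (induction "n - 1 - k" arbitrary: k)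
  case 0
  then have "k = n - 1" by simp
  then show ?case by simp
next
  case (Suc m)
  then have k: "Suc k < n" "m = n - 1 - Suc k" by simp_all
  have "pure (w[k := w ! k \<otimes> (c \<odot> \<one>)]) = pure (w[Suc k := (c \<odot> \<one>) \<otimes> w ! Suc k])"
    by (rule pure_balance[OF assms(1) k(1) scalar_in_B])
  then have "pure (w[k := c \<odot> w ! k]) = pure (w[Suc k := c \<odot> w ! Suc k])"
    using k tuple_nth[OF assms(1)] by (simp add: scalar_left scalar_right)
  then show ?case using Suc.hyps(1)[OF k(2,1)] by simp
qed

lemma additive_D: "S \<in> additive_maps D D \<Longrightarrow> T \<in> additive_maps D D \<Longrightarrow>
    (\<lambda>x. S x \<oplus>\<^bsub>D\<^esub> T x) \<in> additive_maps D D"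
  by (rule additive_mapsI)
    (auto simp: additive_closed additive_add D.a_ac)

lemma complex_bimodule_tensor_power: "complex_bimodule A D"
proof -
  note ext = additive_ext[OF abelian_group_D]
  have last: "n - 1 < n" "0 < n" using n_pos by auto
  have id: "(\<lambda>x. x) \<in> additive_maps D D" by (rule additive_mapsI) auto
  have "right_module A D"
  proof (intro right_module.intro right_module_axioms.intro A.ring_axioms abelian_group_D)
    fix x a assume x: "x \<in> carrier D" and a: "a \<in> carrier A"
    show "x \<lhd>\<^bsub>D\<^esub> a \<in> carrier D" using additive_closed[OF additive_ract[OF a] x] .
    show "(x \<oplus>\<^bsub>D\<^esub> y) \<lhd>\<^bsub>D\<^esub> a = x \<lhd>\<^bsub>D\<^esub> a \<oplus>\<^bsub>D\<^esub> y \<lhd>\<^bsub>D\<^esub> a" if "y \<in> carrier D" for y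
      using additive_add[OF additive_ract[OF a] x that] .
    fix b assume b: "b \<in> carrier A"
    show "x \<lhd>\<^bsub>D\<^esub> (a \<oplus> b) = x \<lhd>\<^bsub>D\<^esub> a \<oplus>\<^bsub>D\<^esub> x \<lhd>\<^bsub>D\<^esub> b"
      by (rule ext[OF additive_ract additive_D[OF additive_ract additive_ract] _ x])
        (use a b last in \<open>auto simp: pure_ract tuple_nth A.r_distr pure_add\<close>)
    show "x \<lhd>\<^bsub>D\<^esub> (a \<otimes> b) = x \<lhd>\<^bsub>D\<^esub> a \<lhd>\<^bsub>D\<^esub> b"
      by (rule ext[OF additive_ract additive_comp[OF additive_ract additive_ract] _ x])
        (use a b last in \<open>auto simp: pure_ract tuple_nth A.m_assoc tuple_update tuple_length\<close>)
  next
    fix x assume x: "x \<in> carrier D"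
    show "x \<lhd>\<^bsub>D\<^esub> \<one> = x"
      by (rule ext[OF additive_ract id _ x]) (use last in \<open>auto simp: pure_ract tuple_nth\<close>)
  qed
  then show ?thesis
  proof (intro complex_bimodule.intro complex_bimodule_axioms.intro complex_algebra_axioms)
    fix x a assume x: "x \<in> carrier D" and a: "a \<in> carrier A"
    show "a \<rhd>\<^bsub>D\<^esub> x \<in> carrier D" using additive_closed[OF additive_lact[OF a] x] .
    show "a \<rhd>\<^bsub>D\<^esub> (x \<oplus>\<^bsub>D\<^esub> y) = a \<rhd>\<^bsub>D\<^esub> x \<oplus>\<^bsub>D\<^esub> a \<rhd>\<^bsub>D\<^esub> y" if "y \<in> carrier D" for y
      using additive_add[OF additive_lact[OF a] x that] .
    fix b assume b: "b \<in> carrier A"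
    show "(a \<oplus> b) \<rhd>\<^bsub>D\<^esub> x = a \<rhd>\<^bsub>D\<^esub> x \<oplus>\<^bsub>D\<^esub> b \<rhd>\<^bsub>D\<^esub> x"
      by (rule ext[OF additive_lact additive_D[OF additive_lact additive_lact] _ x])
        (use a b last in \<open>auto simp: pure_lact tuple_nth A.l_distr pure_add\<close>)
    show "(a \<otimes> b) \<rhd>\<^bsub>D\<^esub> x = a \<rhd>\<^bsub>D\<^esub> (b \<rhd>\<^bsub>D\<^esub> x)"
      by (rule ext[OF additive_lact additive_comp[OF additive_lact additive_lact] _ x])
        (use a b last in \<open>auto simp: pure_lact tuple_nth A.m_assoc tuple_update tuple_length\<close>)
    show "(a \<rhd>\<^bsub>D\<^esub> x) \<lhd>\<^bsub>D\<^esub> b = a \<rhd>\<^bsub>D\<^esub> (x \<lhd>\<^bsub>D\<^esub> b)"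
    proof (rule ext[OF additive_comp[OF additive_lact[OF a] additive_ract[OF b]]
          additive_comp[OF additive_ract[OF b] additive_lact[OF a]] _ x])
      fix w assume w: "w \<in> tuples A n"
      show "(a \<rhd>\<^bsub>D\<^esub> pure w) \<lhd>\<^bsub>D\<^esub> b = a \<rhd>\<^bsub>D\<^esub> (pure w \<lhd>\<^bsub>D\<^esub> b)"
        using a b w last
        by (cases "n - 1 = 0")
          (auto simp: pure_lact pure_ract tuple_nth A.m_assoc tuple_update tuple_length list_update_swap)
    qed
  next
    fix x assume x: "x \<in> carrier D"
    show "\<one> \<rhd>\<^bsub>D\<^esub> x = x"
      by (rule ext[OF additive_lact id _ x]) (use last in \<open>auto simp: pure_lact tuple_nth\<close>)
    show "(c \<odot> \<one>) \<rhd>\<^bsub>D\<^esub> x = x \<lhd>\<^bsub>D\<^esub> (c \<odot> \<one>)" for c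
      by (rule ext[OF additive_lact additive_ract _ x])
        (use last pure_scalar_position[OF _ last(2)] in
          \<open>auto simp: pure_lact pure_ract tuple_nth scalar_left scalar_right\<close>)
  qed
qed

sublocale bimod: complex_bimodule A D
  by (rule complex_bimodule_tensor_power)

text \<open>Expand the entries of a pure tensor one after the other in a spanning set \<open>X\<close> of \<open>A\<close>; the
  coefficients move through the tensor signs to the last entry, where they act as scalars.\<close>

lemma finite_dim_tensor_power:
  assumes "finite_dim A"
  shows "finite_dim bimod.scalar_module"
proof -
  obtain X where X: "finite X" "X \<subseteq> carrier A" "\<forall>y\<in>carrier A. \<exists>c. y = (\<Oplus>x\<in>X. c x \<odot> x)"
    using assms by (auto simp: finite_dim_def)
  define P where "P = pure ` {w. set w \<subseteq> X \<and> length w = n}"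
  have P: "finite P" "P \<subseteq> carrier bimod.scalar_module"
    using X by (auto simp: P_def finite_lists_length_eq tuples_def intro!: pure_closed)
  have span: "pure (us @ vs) \<in> bimod.S.lin_span P"
    if "set us \<subseteq> X" "set vs \<subseteq> carrier A" "length us + length vs = n" for us vs
    using that
  proof (induction vs arbitrary: us)
    case Nil
    then have "pure us \<in> P" by (simp add: P_def)
    then show ?case using bimod.S.lin_span_base[OF P] by simp
  next
    case (Cons v vs)
    obtain c where c: "v = (\<Oplus>x\<in>X. c x \<odot> x)" using Cons.prems X by auto
    let ?k = "length us"
    have w: "us @ v # vs \<in> tuples A n" using Cons.prems X by (auto simp: tuples_def)
    have k: "?k < n" using Cons.prems by simp
    have upd: "(us @ v # vs)[?k := x] = us @ x # vs" for x by simp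
    have "pure (us @ v # vs) = (\<Oplus>\<^bsub>D\<^esub>x\<in>X. pure (us @ (c x \<odot> x) # vs))"
    proof -
      have "(\<lambda>x. c x \<odot> x) \<in> X \<rightarrow> carrier A" using X(2) by auto
      from pure_finsum[OF w k this] show ?thesis unfolding upd c[symmetric] .
    qed
    also have "\<dots> = (\<Oplus>\<^bsub>bimod.scalar_module\<^esub>x\<in>X. pure (us @ (c x \<odot> x) # vs))"
      using Cons.prems X(2)
      by (intro bimod.finsum_scalar_module[symmetric] Pi_I pure_closed) (auto simp: tuples_def)
    also have "\<dots> \<in> bimod.S.lin_span P"
    proof (rule bimod.S.lin_span_finsum[OF P(2)], rule Pi_I)
      fix x assume x: "x \<in> X"
      have w': "us @ x # vs \<in> tuples A n" using Cons.prems X x by (auto simp: tuples_def)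
      have "pure (us @ (c x \<odot> x) # vs) = pure ((us @ x # vs)[?k := c x \<odot> (us @ x # vs) ! ?k])"
        by simp
      also have "\<dots> = pure ((us @ x # vs)[n - 1 := c x \<odot> (us @ x # vs) ! (n - 1)])"
        by (rule pure_scalar_position[OF w' k])
      also have "\<dots> = pure (us @ x # vs) \<lhd>\<^bsub>D\<^esub> (c x \<odot> \<one>)"
        using n_pos w' by (simp add: pure_ract scalar_right tuple_nth)
      finally have "pure (us @ (c x \<odot> x) # vs) = c x \<odot>\<^bsub>bimod.scalar_module\<^esub> pure (us @ x # vs)"
        by simp
      moreover have "pure ((us @ [x]) @ vs) \<in> bimod.S.lin_span P"
        by (rule Cons.IH) (use Cons.prems x in auto)
      ultimately show "pure (us @ (c x \<odot> x) # vs) \<in> bimod.S.lin_span P"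
        using bimod.S.lin_span_smult[OF P(2)] by simp
    qed
    finally show ?case .
  qed
  have gens: "pure w \<in> bimod.S.lin_span P" if "w \<in> tuples A n" for w
    using span[of "[]" w] that by (simp add: tuples_def)
  have "cls x \<in> bimod.S.lin_span P" if "Poly_Mapping.keys x \<subseteq> tuples A n" for x
    using that
  proof (induction x rule: free_Abelian_group_induct[consumes 1, case_names zero diff one])
    case zero
    show ?case using bimod.S.lin_span_zero[OF P(2)] by (simp add: zero_D)
  next
    case (diff x y)
    have c: "cls y \<in> carrier bimod.scalar_module" using diff by (simp add: cls_closed)
    have "cls (- y) = \<ominus>\<^bsub>bimod.scalar_module\<^esub> cls y"
      using diff by (intro bimod.S.M.minus_equality[symmetric]) (simp_all add: add_D zero_D cls_closed)
    also have "\<dots> = (-1) \<odot>\<^bsub>bimod.scalar_module\<^esub> cls y"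
      using bimod.S.smult_minus_one[OF c] by simp
    finally have "cls (- y) = (-1) \<odot>\<^bsub>bimod.scalar_module\<^esub> cls y" .
    then have "cls (- y) \<in> bimod.S.lin_span P" using bimod.S.lin_span_smult[OF P(2) diff(4)] by simp
    from bimod.S.lin_span_add[OF P(2) diff(3) this] show ?case using diff add_D[of x "- y"] by simp
  next
    case (one w)
    then show ?case using gens by (simp add: pure_def)
  qed
  then have "carrier bimod.scalar_module \<subseteq> bimod.S.lin_span P" by (auto simp: carrier_D)
  then show ?thesis by (rule bimod.S.finite_dimI[OF P])
qed

text \<open>By the universal property of the free abelian group, \<open>\<Psi>\<close> extends to a homomorphism.  It
  kills all relators, so it factors through the tensor power.\<close>

lemma pure_nonzero:
  assumes G: "abelian_group G" and closed: "\<And>w. w \<in> tuples A n \<Longrightarrow> \<Psi> w \<in> carrier G"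
    and add: "\<And>w i x y. \<lbrakk>w \<in> tuples A n; i < n; x \<in> carrier A; y \<in> carrier A\<rbrakk> \<Longrightarrow>
      \<Psi> (w[i := x \<oplus> y]) = \<Psi> (w[i := x]) \<oplus>\<^bsub>G\<^esub> \<Psi> (w[i := y])"
    and balanced: "\<And>w i b. \<lbrakk>w \<in> tuples A n; Suc i < n; b \<in> B\<rbrakk> \<Longrightarrow>
      \<Psi> (w[i := w ! i \<otimes> b]) = \<Psi> (w[Suc i := b \<otimes> w ! Suc i])"
    and w: "w \<in> tuples A n" "\<Psi> w \<noteq> \<zero>\<^bsub>G\<^esub>"
  shows "pure w \<noteq> \<zero>\<^bsub>D\<^esub>"
proof
  assume "pure w = \<zero>\<^bsub>D\<^esub>"
  then have wK: "frag_of w \<in> K" by (simp add: pure_def cls_eq_zero_iff)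
  interpret G: abelian_group G by fact
  obtain h where h: "h \<in> hom F (add_monoid G)" "\<And>w. w \<in> tuples A n \<Longrightarrow> h (frag_of w) = \<Psi> w"
    using comm_group.free_Abelian_group_universal[OF G.a_comm_group, of \<Psi> "tuples A n"] closed by auto
  interpret h: group_hom F "add_monoid G" h
    by (rule group_hom.intro[OF F.group_axioms G.a_group]) (simp add: group_hom_axioms_def h(1))
  have h_add: "h (x + y) = h x \<oplus>\<^bsub>G\<^esub> h y"
    if "Poly_Mapping.keys x \<subseteq> tuples A n" "Poly_Mapping.keys y \<subseteq> tuples A n" for x y
    using h.hom_mult[of x y] that by simp
  have h_minus: "h (- x) = \<ominus>\<^bsub>G\<^esub> h x" if "Poly_Mapping.keys x \<subseteq> tuples A n" for x
    using h.hom_inv[of x] that by (simp add: a_inv_def)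
  have hc: "h x \<in> carrier G" if "Poly_Mapping.keys x \<subseteq> tuples A n" for x
    using h.hom_closed[of x] that by simp
  have h_diff: "h (x - y) = h x \<ominus>\<^bsub>G\<^esub> h y"
    if "Poly_Mapping.keys x \<subseteq> tuples A n" "Poly_Mapping.keys y \<subseteq> tuples A n" for x y
    using h_add[of x "- y"] h_minus[of y] that by (simp add: a_minus_def)
  have "tensor_relators A B n \<subseteq> kernel F (add_monoid G) h"
  proof
    fix x assume x: "x \<in> tensor_relators A B n"
    from x have "h x = \<zero>\<^bsub>G\<^esub>"
    proof (cases rule: relator_cases)
      case (add w i y z)
      have t: "w[i := y \<oplus> z] \<in> tuples A n" "w[i := y] \<in> tuples A n" "w[i := z] \<in> tuples A n"
        using add by (simp_all add: tuple_update)
      have x': "x = frag_of (w[i := y \<oplus> z]) - (frag_of (w[i := y]) + frag_of (w[i := z]))"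
        using add(5) by simp
      have "h x = \<Psi> (w[i := y \<oplus> z]) \<ominus>\<^bsub>G\<^esub> (\<Psi> (w[i := y]) \<oplus>\<^bsub>G\<^esub> \<Psi> (w[i := z]))"
      proof -
        have "Poly_Mapping.keys (frag_of (w[i := y]) + frag_of (w[i := z])) \<subseteq> tuples A n"
          by (rule keys_add_tuples) (use t in simp_all)
        then show ?thesis unfolding x' using t by (simp add: h_diff h_add h(2))
      qed
      then show ?thesis
        using add assms(3)[OF add(1-4)] t closed by (simp add: a_minus_def G.r_neg)
    next
      case (bal w i b)
      have t: "w[i := w ! i \<otimes> b] \<in> tuples A n" "w[Suc i := b \<otimes> w ! Suc i] \<in> tuples A n"
        using bal by (simp_all add: tuple_update tuple_nth B_subset)
      then show ?thesis
        using balanced[OF bal(1-3)] closed by (simp add: bal(4) h_diff h(2) a_minus_def G.r_neg)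
    qed
    then show "x \<in> kernel F (add_monoid G) h" using subsetD[OF relators_closed x] by (simp add: kernel_def)
  qed
  then have "K \<subseteq> kernel F (add_monoid G) h"
    by (rule K_leastI[OF h.subgroup_kernel])
  then have "h (frag_of w) = \<zero>\<^bsub>G\<^esub>" using wK by (auto simp: kernel_def)
  then show False using h(2)[OF w(1)] w(2) by simp
qed

end

section \<open>Corners of tensor powers\<close>

lemma tuples_SucE:
  assumes "w \<in> tuples A (Suc m)"
  obtains x us where "w = x # us" "x \<in> carrier A" "us \<in> tuples A m"
  using assms by (cases w) (auto simp: tuples_def)

lemma Cons_tuples [simp]: "x # us \<in> tuples A (Suc m) \<longleftrightarrow> x \<in> carrier A \<and> us \<in> tuples A m"
  by (auto simp: tuples_def)

definition balanced_map :: "('a, 'x) ring_scheme \<Rightarrow> 'a set \<Rightarrow> nat \<Rightarrow> ('a list \<Rightarrow> 'a) \<Rightarrow> bool" where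
  "balanced_map A B n \<Psi> \<longleftrightarrow> (\<forall>w\<in>tuples A n. \<Psi> w \<in> carrier A) \<and>
     (\<forall>w\<in>tuples A n. \<forall>i<n. \<forall>x\<in>carrier A. \<forall>y\<in>carrier A.
        \<Psi> (w[i := x \<oplus>\<^bsub>A\<^esub> y]) = \<Psi> (w[i := x]) \<oplus>\<^bsub>A\<^esub> \<Psi> (w[i := y])) \<and>
     (\<forall>w\<in>tuples A n. \<forall>i. Suc i < n \<longrightarrow> (\<forall>b\<in>B.
        \<Psi> (w[i := w ! i \<otimes>\<^bsub>A\<^esub> b]) = \<Psi> (w[Suc i := b \<otimes>\<^bsub>A\<^esub> w ! Suc i])))"

lemma balanced_mapD:
  assumes "balanced_map A B n \<Psi>" "w \<in> tuples A n"
  shows "\<Psi> w \<in> carrier A"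
    and "\<lbrakk>i < n; x \<in> carrier A; y \<in> carrier A\<rbrakk> \<Longrightarrow>
      \<Psi> (w[i := x \<oplus>\<^bsub>A\<^esub> y]) = \<Psi> (w[i := x]) \<oplus>\<^bsub>A\<^esub> \<Psi> (w[i := y])"
    and "\<lbrakk>Suc i < n; b \<in> B\<rbrakk> \<Longrightarrow> \<Psi> (w[i := w ! i \<otimes>\<^bsub>A\<^esub> b]) = \<Psi> (w[Suc i := b \<otimes>\<^bsub>A\<^esub> w ! Suc i])"
  using assms unfolding balanced_map_def by blast+

text \<open>Replacing the first two entries \<open>x\<close>, \<open>y\<close> by \<open>\<theta> x \<otimes> y\<close> respects the first tensor sign because
  \<open>\<theta>\<close> is right \<open>B\<close>-linear.\<close>

lemma (in ring) balanced_map_contract: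
  assumes \<Psi>: "balanced_map R B (Suc m) \<Psi>" and B: "B \<subseteq> carrier R"
    and \<theta>: "\<theta> \<in> additive_maps R R" "\<And>x b. \<lbrakk>x \<in> carrier R; b \<in> B\<rbrakk> \<Longrightarrow> \<theta> (x \<otimes> b) = \<theta> x \<otimes> b"
  shows "balanced_map R B (Suc (Suc m)) (\<lambda>w. \<Psi> ((\<theta> (w ! 0) \<otimes> w ! 1) # drop 2 w))"
  unfolding balanced_map_def
proof (intro conjI ballI allI impI)
  note \<theta>c = additive_closed[OF \<theta>(1)]
  fix w assume "w \<in> tuples R (Suc (Suc m))"
  then obtain x y us where w: "w = x # y # us" "x \<in> carrier R" "y \<in> carrier R" "us \<in> tuples R m"
    by (elim tuples_SucE) blast
  have t: "(\<theta> x \<otimes> y) # us \<in> tuples R (Suc m)" using w \<theta>c by simp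
  note \<Psi>t = balanced_mapD[OF \<Psi> t]
  show "\<Psi> ((\<theta> (w ! 0) \<otimes> w ! 1) # drop 2 w) \<in> carrier R" using \<Psi>t(1) w by simp
  fix i
  show "\<Psi> ((\<theta> (w[i := u \<oplus> v] ! 0) \<otimes> w[i := u \<oplus> v] ! 1) # drop 2 (w[i := u \<oplus> v]))
      = \<Psi> ((\<theta> (w[i := u] ! 0) \<otimes> w[i := u] ! 1) # drop 2 (w[i := u]))
      \<oplus> \<Psi> ((\<theta> (w[i := v] ! 0) \<otimes> w[i := v] ! 1) # drop 2 (w[i := v]))"
    if "i < Suc (Suc m)" "u \<in> carrier R" "v \<in> carrier R" for u v
  proof -
    consider "i = 0" | "i = 1" | k where "i = Suc (Suc k)"
      by (metis One_nat_def not0_implies_Suc)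
    then show ?thesis
    proof cases
      case 1
      then show ?thesis
        using \<Psi>t(2)[of 0 "\<theta> u \<otimes> y" "\<theta> v \<otimes> y"] that w \<theta>c
        by (simp add: additive_add[OF \<theta>(1)] l_distr)
    next
      case 2
      then show ?thesis
        using \<Psi>t(2)[of 0 "\<theta> x \<otimes> u" "\<theta> x \<otimes> v"] that w \<theta>c by (simp add: r_distr)
    next
      case 3
      then show ?thesis using \<Psi>t(2)[of "Suc k" u v] that w by simp
    qed
  qed
  show "\<Psi> ((\<theta> (w[i := w ! i \<otimes> b] ! 0) \<otimes> w[i := w ! i \<otimes> b] ! 1) # drop 2 (w[i := w ! i \<otimes> b]))
      = \<Psi> ((\<theta> (w[Suc i := b \<otimes> w ! Suc i] ! 0) \<otimes> w[Suc i := b \<otimes> w ! Suc i] ! 1)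
          # drop 2 (w[Suc i := b \<otimes> w ! Suc i]))"
    if "Suc i < Suc (Suc m)" "b \<in> B" for b
  proof -
    have b: "b \<in> carrier R" using that B by blast
    consider "i = 0" | "i = 1" | k where "i = Suc (Suc k)"
      by (metis One_nat_def not0_implies_Suc)
    then show ?thesis
    proof cases
      case 1
      then show ?thesis using w b that(2) \<theta>c by (simp add: \<theta>(2) m_assoc)
    next
      case 2
      then show ?thesis using \<Psi>t(3)[of 0 b] w b that \<theta>c by (simp add: m_assoc)
    next
      case 3
      then show ?thesis using \<Psi>t(3)[of "Suc k" b] w that by simp
    qed
  qed
qed

locale subalgebra_pair =
  A?: corner_system A s e P a b + B: corner_system "A\<lparr>carrier := B\<rparr>" r p P' c d
  for A :: "(complex, 'a, 'x) module_scheme" (structure) and s e and P :: "'p set" and a b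
    and B :: "'a set" and r p and P' :: "'q set" and c d +
  assumes subalgebra: "complex_subalgebra B A"
    and semisimple: "semisimple_ring A"
    and fd: "finite_dim A"
    and right_inverse: "\<lbrakk>i < s; x \<in> carrier A; e i \<otimes> x \<noteq> \<zero>\<rbrakk> \<Longrightarrow> \<exists>y\<in>carrier A. e i \<otimes> x \<otimes> y = e i"
begin

lemma B_subset: "x \<in> B \<Longrightarrow> x \<in> carrier A"
  using subalgebra subringE(1) by (auto simp: complex_subalgebra_def)

lemma p_closed: "k < r \<Longrightarrow> p k \<in> carrier A"
  using B.e_closed B_subset by simp

lemma c_closed: "q \<in> P' \<Longrightarrow> c q \<in> B" and d_closed: "q \<in> P' \<Longrightarrow> d q \<in> B"
  using B.a_closed B.b_closed by simp_all

lemma right_module_B: "right_module (A\<lparr>carrier := B\<rparr>) (regular_rmodule A)"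
proof -
  interpret reg: right_module A "regular_rmodule A" by (rule A.A.right_module_regular)
  show ?thesis
    by (intro right_module.intro right_module_axioms.intro B.A.ring_axioms reg.M.abelian_group_axioms)
      (auto simp: A.A.m_assoc A.A.l_distr A.A.r_distr B_subset)
qed

lemma sum_cd: "x \<in> carrier A \<Longrightarrow> x = (\<Oplus>q\<in>P'. x \<otimes> c q \<otimes> d q)"
proof -
  assume x: "x \<in> carrier A"
  interpret B': right_module "A\<lparr>carrier := B\<rparr>" "regular_rmodule A" by (rule right_module_B)
  have "x = (\<Oplus>\<^bsub>regular_rmodule A\<^esub>q\<in>P'. x \<otimes> c q \<otimes> d q)"
    using B.sum_ab_ract[OF right_module_B, of x] x by simp
  also have "\<dots> = (\<Oplus>q\<in>P'. x \<otimes> c q \<otimes> d q)"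
  proof -
    have "(\<lambda>q. x \<otimes> c q \<otimes> d q) \<in> P' \<rightarrow> carrier (regular_rmodule A)"
      using x c_closed d_closed B_subset by auto
    from additive_finsum[OF B'.M.abelian_group_axioms A.A.abelian_group_axioms _ this, of "\<lambda>x. x"]
    show ?thesis by (simp add: hom_def)
  qed
  finally show ?thesis .
qed

definition linked :: "'a \<Rightarrow> 'a \<Rightarrow> bool" where
  "linked g h \<longleftrightarrow> (\<exists>x\<in>carrier A. g \<otimes> x \<otimes> h \<noteq> \<zero>)"

text \<open>By regularity of \<open>A\<close>, a nonzero \<open>x \<in> g A h\<close> satisfies \<open>x = x y x = x (h y g) x\<close> for some
  \<open>y\<close>.\<close>

lemma linked_sym:
  assumes "linked g h" "g \<in> carrier A" "h \<in> carrier A"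
  shows "linked h g"
proof -
  obtain x where x: "x \<in> carrier A" "g \<otimes> x \<otimes> h \<noteq> \<zero>" using assms(1) by (auto simp: linked_def)
  have c: "g \<otimes> x \<otimes> h \<in> carrier A" using x assms by simp
  obtain y where y: "y \<in> carrier A" "g \<otimes> x \<otimes> h \<otimes> y \<otimes> (g \<otimes> x \<otimes> h) = g \<otimes> x \<otimes> h"
    by (rule semisimple_ring_regular_element[OF semisimple c])
  have "g \<otimes> x \<otimes> (h \<otimes> y \<otimes> g) \<otimes> (x \<otimes> h) = g \<otimes> x \<otimes> h"
    using y x assms(2,3) by (simp add: A.A.m_assoc)
  then have "h \<otimes> y \<otimes> g \<noteq> \<zero>" using x assms(2,3) by auto
  then show ?thesis using y(1) by (auto simp: linked_def)
qed

lemma linked_e_e: "\<lbrakk>i < s; j < s\<rbrakk> \<Longrightarrow> linked (e i) (e j) \<longleftrightarrow> i = j"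
proof
  assume ij: "i < s" "j < s" "i = j"
  then have "e i \<otimes> \<one> \<otimes> e j \<noteq> \<zero>" by (simp add: e_closed e_idem e_nonzero)
  then show "linked (e i) (e j)" by (auto simp: linked_def)
qed (use e_orth in \<open>auto simp: linked_def\<close>)

text \<open>Expand \<open>\<one> = \<Sum>\<^sub>q a\<^sub>q b\<^sub>q\<close> in the middle of \<open>p\<^sub>k x p\<^sub>k\<^sub>'\<close>.  Conversely, nonzero elements
  \<open>x' \<in> p\<^sub>k A e\<^sub>i\<close> and \<open>y' \<in> e\<^sub>i A p\<^sub>k\<^sub>'\<close> have a nonzero product, since \<open>y' z = e\<^sub>i\<close> for some \<open>z\<close>.\<close>

lemma linked_p_p:
  assumes "k < r" "k' < r"
  shows "linked (p k) (p k') \<longleftrightarrow> (\<exists>i<s. linked (p k) (e i) \<and> linked (e i) (p k'))"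
proof
  note pc = p_closed[OF assms(1)] p_closed[OF assms(2)]
  assume "linked (p k) (p k')"
  then obtain x where x: "x \<in> carrier A" "p k \<otimes> x \<otimes> p k' \<noteq> \<zero>" by (auto simp: linked_def)
  have kx: "p k \<otimes> x \<in> carrier A" using x pc by simp
  have "(\<Oplus>q\<in>P. p k \<otimes> x \<otimes> a q \<otimes> b q \<otimes> p k') = p k \<otimes> x \<otimes> p k'"
    using sum_ab_right[OF kx] kx pc(2)
    by (subst A.A.finsum_ldistr[symmetric]) (auto simp: finite_P a_closed b_closed)
  then have "(\<Oplus>q\<in>P. p k \<otimes> x \<otimes> a q \<otimes> b q \<otimes> p k') \<noteq> \<zero>" using x(2) by simp
  then obtain q where q: "q \<in> P" "p k \<otimes> x \<otimes> a q \<otimes> b q \<otimes> p k' \<noteq> \<zero>"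
    by (rule A.A.finsum_nonzero)
  obtain i where i: "i < s" "a q \<otimes> e i = a q" "e i \<otimes> b q = b q" using ab_corner[OF q(1)] by blast
  note cl = a_closed[OF q(1)] b_closed[OF q(1)] e_closed[OF i(1)] x(1) pc
  have "p k \<otimes> (x \<otimes> a q) \<otimes> e i \<otimes> (b q \<otimes> p k') = p k \<otimes> x \<otimes> a q \<otimes> b q \<otimes> p k'"
  proof -
    have "p k \<otimes> (x \<otimes> a q) \<otimes> e i \<otimes> (b q \<otimes> p k') = p k \<otimes> x \<otimes> (a q \<otimes> e i) \<otimes> b q \<otimes> p k'"
      using cl by (simp add: A.A.m_assoc)
    then show ?thesis by (simp add: i(2))
  qed
  then have "p k \<otimes> (x \<otimes> a q) \<otimes> e i \<noteq> \<zero>" using q(2) cl by auto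
  moreover have "(p k \<otimes> x \<otimes> a q) \<otimes> (e i \<otimes> b q \<otimes> p k') = p k \<otimes> x \<otimes> a q \<otimes> b q \<otimes> p k'"
    using cl i(3) by (simp add: A.A.m_assoc)
  then have "e i \<otimes> b q \<otimes> p k' \<noteq> \<zero>" using q(2) cl by auto
  ultimately show "\<exists>i<s. linked (p k) (e i) \<and> linked (e i) (p k')"
    using i(1) cl unfolding linked_def by (metis A.A.m_closed)
next
  note pc = p_closed[OF assms(1)] p_closed[OF assms(2)]
  assume "\<exists>i<s. linked (p k) (e i) \<and> linked (e i) (p k')"
  then obtain i x y where i: "i < s" and x: "x \<in> carrier A" "p k \<otimes> x \<otimes> e i \<noteq> \<zero>"
    and y: "y \<in> carrier A" "e i \<otimes> y \<otimes> p k' \<noteq> \<zero>" by (auto simp: linked_def)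
  note ei = e_closed[OF i]
  obtain z where z: "z \<in> carrier A" "e i \<otimes> (y \<otimes> p k') \<otimes> z = e i"
    using right_inverse[OF i, of "y \<otimes> p k'"] y pc ei by (auto simp: A.A.m_assoc)
  have "p k \<otimes> x \<otimes> (e i \<otimes> (y \<otimes> p k') \<otimes> z) = p k \<otimes> (x \<otimes> e i \<otimes> y) \<otimes> p k' \<otimes> z"
    using x(1) y(1) z(1) pc ei by (simp add: A.A.m_assoc)
  then have "p k \<otimes> (x \<otimes> e i \<otimes> y) \<otimes> p k' \<otimes> z \<noteq> \<zero>" using x(2) z(2) by simp
  then have "p k \<otimes> (x \<otimes> e i \<otimes> y) \<otimes> p k' \<noteq> \<zero>" using z(1) by auto
  then show "linked (p k) (p k')" using x(1) y(1) ei unfolding linked_def by blast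
qed

text \<open>\<open>reaches j m g\<close> holds if some \<open>p\<^sub>k\<^sub>1, \<dots>, p\<^sub>k\<^sub>m\<close> form a chain from \<open>g\<close> to \<open>e\<^sub>j\<close> in which neighbours
  are linked.\<close>

fun reaches :: "nat \<Rightarrow> nat \<Rightarrow> 'a \<Rightarrow> bool" where
  "reaches j 0 g \<longleftrightarrow> linked g (e j)"
| "reaches j (Suc m) g \<longleftrightarrow> (\<exists>k<r. linked g (p k) \<and> reaches j m (p k))"

lemma algebra_tensor_power: "n \<ge> 1 \<Longrightarrow> algebra_tensor_power A B n"
  by (intro algebra_tensor_power.intro algebra_tensor_power_axioms.intro complex_algebra_axioms subalgebra)

text \<open>Inserting \<open>\<one> = \<Sum>\<^sub>q c\<^sub>q d\<^sub>q\<close> at the first tensor sign and moving \<open>d\<^sub>q \<in> p\<^sub>k B\<close> across it confines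
  the first entry to \<open>g A p\<^sub>k\<close> and the second to \<open>p\<^sub>k A\<close>.\<close>

lemma reaches_if_pure_nonzero:
  assumes "j < s" "n \<ge> 1"
    and "algebra_tensor_power.pure A B n (us @ x # ws) \<noteq> \<zero>\<^bsub>tensor_power A B n\<^esub>"
    and "us @ x # ws \<in> tuples A n" "g \<in> carrier A" "g \<otimes> x = x"
    and "last (x # ws) \<otimes> e j = last (x # ws)"
  shows "reaches j (length ws) g"
proof -
  interpret T: algebra_tensor_power A B n by (rule algebra_tensor_power[OF assms(2)])
  show ?thesis
    using assms(3-)
  proof (induction ws arbitrary: us x g)
    case Nil
    have k: "length us < n" using Nil.prems(2) by (auto simp: tuples_def)
    have "x \<noteq> \<zero>" using T.pure_zero_entry[OF Nil.prems(2) k] Nil.prems(1) by auto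
    then have "g \<otimes> x \<otimes> e j \<noteq> \<zero>" using Nil.prems by simp
    then show ?case using Nil.prems(2) by (auto simp: linked_def tuples_def)
  next
    case (Cons y ws)
    let ?k = "length us"
    have x: "x \<in> carrier A" and y: "y \<in> carrier A" and k: "Suc ?k < n"
      using Cons.prems(2) by (auto simp: tuples_def)
    have upd: "(us @ x # y # ws)[?k := z] = us @ z # y # ws" for z by simp
    have cl: "c q \<in> carrier A" "d q \<in> carrier A" if "q \<in> P'" for q
      using c_closed d_closed B_subset that by auto
    have "T.pure (us @ x # y # ws) = T.pure (us @ (\<Oplus>q\<in>P'. x \<otimes> c q \<otimes> d q) # y # ws)"
      using sum_cd[OF x] by simp
    also have "\<dots> = (\<Oplus>\<^bsub>T.D\<^esub>q\<in>P'. T.pure (us @ (x \<otimes> c q \<otimes> d q) # y # ws))"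
    proof -
      have "(\<lambda>q. x \<otimes> c q \<otimes> d q) \<in> P' \<rightarrow> carrier A" using x cl by auto
      from T.pure_finsum[OF Cons.prems(2) _ this, of ?k] k show ?thesis unfolding upd by simp
    qed
    finally have "(\<Oplus>\<^bsub>T.D\<^esub>q\<in>P'. T.pure (us @ (x \<otimes> c q \<otimes> d q) # y # ws)) \<noteq> \<zero>\<^bsub>T.D\<^esub>"
      using Cons.prems(1) by simp
    then obtain q where q: "q \<in> P'" "T.pure (us @ (x \<otimes> c q \<otimes> d q) # y # ws) \<noteq> \<zero>\<^bsub>T.D\<^esub>"
      by (rule T.D.finsum_nonzero)
    have w: "us @ (x \<otimes> c q) # y # ws \<in> tuples A n"
      using Cons.prems(2) x cl(1)[OF q(1)] by (auto simp: tuples_def)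
    have "T.pure (us @ (x \<otimes> c q \<otimes> d q) # y # ws) = T.pure (us @ (x \<otimes> c q) # (d q \<otimes> y) # ws)"
      using T.pure_balance[OF w k d_closed[OF q(1)]] by (simp add: nth_append list_update_append)
    then have nz: "T.pure ((us @ [x \<otimes> c q]) @ (d q \<otimes> y) # ws) \<noteq> \<zero>\<^bsub>T.D\<^esub>" using q(2) by simp
    obtain l where l: "l < r" "c q \<otimes> p l = c q" "p l \<otimes> d q = d q" using B.ab_corner[OF q(1)] by auto
    have w': "(us @ [x \<otimes> c q]) @ (d q \<otimes> y) # ws \<in> tuples A n"
      using w y cl(2)[OF q(1)] by (auto simp: tuples_def)
    have "reaches j (length ws) (p l)"
    proof (rule Cons.IH[OF nz w'])
      show "p l \<otimes> (d q \<otimes> y) = d q \<otimes> y"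
        using l(1,3) y cl(2)[OF q(1)] p_closed by (simp add: A.A.m_assoc[symmetric])
      show "last ((d q \<otimes> y) # ws) \<otimes> e j = last ((d q \<otimes> y) # ws)"
        using Cons.prems(5) y cl(2)[OF q(1)] e_closed[OF assms(1)] by (cases ws) (auto simp: A.A.m_assoc)
    qed (rule p_closed[OF l(1)])
    moreover have "linked g (p l)"
    proof -
      have "(us @ (x \<otimes> c q) # (d q \<otimes> y) # ws) ! ?k = x \<otimes> c q" by simp
      then have "x \<otimes> c q \<noteq> \<zero>"
        using T.pure_zero_entry[of "us @ (x \<otimes> c q) # (d q \<otimes> y) # ws" ?k] nz w' k by auto
      moreover have "g \<otimes> (x \<otimes> c q) \<otimes> p l = x \<otimes> c q"
      proof -
        have "g \<otimes> (x \<otimes> c q) \<otimes> p l = (g \<otimes> x) \<otimes> (c q \<otimes> p l)"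
          using Cons.prems(3) x cl(1)[OF q(1)] p_closed[OF l(1)] by (simp add: A.A.m_assoc)
        then show ?thesis by (simp add: Cons.prems(4) l(2))
      qed
      ultimately show ?thesis using x cl(1)[OF q(1)] unfolding linked_def by (metis A.A.m_closed)
    qed
    ultimately show ?case using l(1) by auto
  qed
qed

text \<open>A linear form on \<open>A\<close> separating \<open>x\<close> from \<open>0\<close> gives a \<open>p\<^sub>k B p\<^sub>k\<close>-linear map \<open>A p\<^sub>k \<rightarrow> \<complex> p\<^sub>k\<close>,
  which extends to a \<open>B\<close>-linear map on \<open>A\<close>.\<close>

lemma ex_B_linear_map:
  assumes k: "k < r" and x: "x \<in> carrier A" "x \<otimes> p k = x" "x \<noteq> \<zero>"
  obtains \<theta> where "\<theta> \<in> additive_maps A A"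
    "\<And>y b. \<lbrakk>y \<in> carrier A; b \<in> B\<rbrakk> \<Longrightarrow> \<theta> (y \<otimes> b) = \<theta> y \<otimes> b" "\<theta> x = p k"
proof -
  note pk = p_closed[OF k]
  obtain \<phi> where \<phi>: "linear_form \<phi>" "\<phi> x = 1" by (rule ex_separating_linear_form[OF fd x(1,3)])
  define h where "h = (\<lambda>y. \<phi> (y \<otimes> p k) \<odot> p k)"
  define \<theta> where "\<theta> = B.extension h (regular_rmodule A) (regular_rmodule A)"
  have h: "h \<in> additive_maps (regular_rmodule A) (regular_rmodule A)"
    by (rule additive_mapsI)
      (use pk smult_l_distr in \<open>auto simp: h_def A.A.l_distr linear_formD(1)[OF \<phi>(1)]\<close>)
  have corner: "h (y \<lhd>\<^bsub>regular_rmodule A\<^esub> t) = h y \<lhd>\<^bsub>regular_rmodule A\<^esub> t"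
    if "y \<in> carrier (regular_rmodule A)" "z \<in> carrier (A\<lparr>carrier := B\<rparr>)"
      and t: "t = B.\<epsilon> \<otimes>\<^bsub>A\<lparr>carrier := B\<rparr>\<^esub> z \<otimes>\<^bsub>A\<lparr>carrier := B\<rparr>\<^esub> B.\<epsilon>" for y z t
  proof -
    have y: "y \<in> carrier A" and z: "z \<in> B" using that by simp_all
    obtain \<gamma> where \<gamma>: "p k \<otimes> z \<otimes> p k = \<gamma> \<odot> p k" using B.e_scalar[OF k, of z] z by auto
    have tp: "t \<otimes> p k = \<gamma> \<odot> p k" "p k \<otimes> t = \<gamma> \<odot> p k"
      using B.e_corner[OF k, of z] B.corner_e[OF k, of z] z \<gamma> t by simp_all
    have tc: "t \<in> carrier A"
      using B.eps_closed z B.A.m_closed[OF B.A.m_closed] B_subset unfolding t by simp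
    have "h (y \<otimes> t) = (\<gamma> * \<phi> (y \<otimes> p k)) \<odot> p k"
      using y tc pk by (simp add: h_def A.A.m_assoc tp smult_mult_right linear_formD(2)[OF \<phi>(1)])
    also have "\<dots> = h y \<otimes> t"
      using y tc pk smult_assoc1[of "\<phi> (y \<otimes> p k)" \<gamma> "p k"]
      by (simp add: h_def smult_mult_left tp mult.commute)
    finally show ?thesis by simp
  qed
  note ext = right_module_B right_module_B h corner[OF _ _ refl]
  have hom: "\<theta> \<in> rmod_hom (A\<lparr>carrier := B\<rparr>) (regular_rmodule A) (regular_rmodule A)"
    unfolding \<theta>_def by (rule B.extension_hom[OF ext])
  have "\<theta> \<in> additive_maps A A"
    using rmod_homD(1)[OF hom] by (simp add: hom_def)
  moreover have "\<theta> (y \<otimes> b) = \<theta> y \<otimes> b" if "y \<in> carrier A" "b \<in> B" for y b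
    using rmod_homD(2)[OF hom, of y b] that by simp
  moreover have "\<theta> x = p k"
  proof -
    have "p k \<otimes> B.\<epsilon> = p k" using B.e_eps[OF k] by simp
    moreover have "x \<otimes> (p k \<otimes> B.\<epsilon>) = (x \<otimes> p k) \<otimes> B.\<epsilon>"
      using x(1) pk B.eps_closed B_subset by (simp add: A.A.m_assoc)
    ultimately have xe: "x \<otimes> B.\<epsilon> = x" using x(2) by simp
    have "\<theta> x = h x \<otimes> B.\<epsilon>"
      unfolding \<theta>_def using B.extension_corner[OF ext, of x] x(1) xe by simp
    also have "h x = p k" using x(2) \<phi>(2) pk smult_one by (simp add: h_def)
    finally show ?thesis using B.e_eps[OF k] by simp
  qed
  ultimately show thesis using that by blast
qed

text \<open>Let \<open>y \<in> g A p\<^sub>k\<close> be the first entry and \<open>\<theta>\<close> a right \<open>B\<close>-linear map with \<open>\<theta> y = p\<^sub>k\<close>.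
  Contracting the first tensor sign by \<open>\<theta>\<close> removes \<open>y\<close> and leaves the remaining entries unchanged,
  because the next one lies in \<open>p\<^sub>k A\<close>.\<close>

lemma ex_balanced_map_if_reaches:
  assumes "j < s" "reaches j m g" "g \<in> carrier A" "g \<otimes> g = g"
  shows "\<exists>w \<Psi>. w \<in> tuples A (Suc m) \<and> g \<otimes> w ! 0 = w ! 0 \<and> w ! m \<otimes> e j = w ! m \<and>
    balanced_map A B (Suc m) \<Psi> \<and> \<Psi> w \<noteq> \<zero>"
  using assms(2-4)
proof (induction m arbitrary: g)
  case 0
  note ej = e_closed[OF assms(1)] e_idem[OF assms(1)]
  obtain x where x: "x \<in> carrier A" "g \<otimes> x \<otimes> e j \<noteq> \<zero>" using 0 by (auto simp: linked_def)
  have "balanced_map A B (Suc 0) (\<lambda>w. w ! 0)"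
    unfolding balanced_map_def by (auto elim!: tuples_SucE)
  moreover have "g \<otimes> (g \<otimes> x \<otimes> e j) = g \<otimes> x \<otimes> e j"
    using x ej 0(2) by (simp add: A.A.m_assoc[symmetric] 0(3))
  moreover have "g \<otimes> x \<otimes> e j \<otimes> e j = g \<otimes> x \<otimes> e j"
    using x ej 0(2) by (simp add: A.A.m_assoc)
  ultimately show ?case
    using x ej 0(2) by (intro exI[of _ "[g \<otimes> x \<otimes> e j]"] exI[of _ "\<lambda>w. w ! 0"]) (simp add: tuples_def)
next
  case (Suc m)
  then obtain k where k: "k < r" "linked g (p k)" "reaches j m (p k)" by auto
  note pk = p_closed[OF k(1)]
  have pk_idem: "p k \<otimes> p k = p k" using B.e_idem[OF k(1)] by simp
  obtain w \<Psi> where w: "w \<in> tuples A (Suc m)" "p k \<otimes> w ! 0 = w ! 0" "w ! m \<otimes> e j = w ! m"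
    and \<Psi>: "balanced_map A B (Suc m) \<Psi>" "\<Psi> w \<noteq> \<zero>"
    using Suc.IH[OF k(3) pk pk_idem] by blast
  obtain x where x: "x \<in> carrier A" "g \<otimes> x \<otimes> p k \<noteq> \<zero>" using k(2) by (auto simp: linked_def)
  define y where "y = g \<otimes> x \<otimes> p k"
  have y: "y \<in> carrier A" "y \<otimes> p k = y" "g \<otimes> y = y" "y \<noteq> \<zero>"
    using x pk pk_idem Suc.prems(2,3) by (auto simp: y_def A.A.m_assoc) (simp add: A.A.m_assoc[symmetric])
  obtain \<theta> where \<theta>: "\<theta> \<in> additive_maps A A"
      "\<And>y b. \<lbrakk>y \<in> carrier A; b \<in> B\<rbrakk> \<Longrightarrow> \<theta> (y \<otimes> b) = \<theta> y \<otimes> b" "\<theta> y = p k"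
    using ex_B_linear_map[OF k(1) y(1,2,4)] by blast
  obtain w0 ws where ws: "w = w0 # ws" using w(1) by (elim tuples_SucE)
  have "balanced_map A B (Suc (Suc m)) (\<lambda>w. \<Psi> ((\<theta> (w ! 0) \<otimes> w ! 1) # drop 2 w))"
    by (rule A.A.balanced_map_contract[OF \<Psi>(1) _ \<theta>(1,2)]) (auto simp: B_subset)
  moreover have "\<Psi> ((\<theta> ((y # w) ! 0) \<otimes> (y # w) ! 1) # drop 2 (y # w)) \<noteq> \<zero>"
    using \<Psi>(2) w(2) by (simp add: \<theta>(3) ws)
  ultimately show ?case
    using w y by (intro exI[of _ "y # w"] exI[of _ "\<lambda>w. \<Psi> ((\<theta> (w ! 0) \<otimes> w ! 1) # drop 2 w)"]) auto
qed

theorem tensor_power_corner_nonzero_iff: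
  assumes n: "n \<ge> 1" and ij: "i < s" "j < s"
  shows "(\<exists>d\<in>carrier (tensor_power A B n).
      (e i \<rhd>\<^bsub>tensor_power A B n\<^esub> d) \<lhd>\<^bsub>tensor_power A B n\<^esub> e j \<noteq> \<zero>\<^bsub>tensor_power A B n\<^esub>) \<longleftrightarrow>
    reaches j (n - 1) (e i)"
proof -
  interpret T: algebra_tensor_power A B n by (rule algebra_tensor_power[OF n])
  note ec = e_closed[OF ij(1)] e_closed[OF ij(2)]
  have last: "n - 1 < n" "0 < n" using n by auto
  define corner where "corner w = w[0 := e i \<otimes> w ! 0, n - 1 := w[0 := e i \<otimes> w ! 0] ! (n - 1) \<otimes> e j]" for w
  have corner: "corner w \<in> tuples A n"
      "(e i \<rhd>\<^bsub>T.D\<^esub> T.pure w) \<lhd>\<^bsub>T.D\<^esub> e j = T.pure (corner w)" if w: "w \<in> tuples A n" for w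
  proof -
    have w': "w[0 := e i \<otimes> w ! 0] \<in> tuples A n"
      using w ec T.tuple_nth[OF w last(2)] by (simp add: T.tuple_update)
    then show "corner w \<in> tuples A n"
      using ec T.tuple_nth[OF w' last(1)] by (simp add: corner_def T.tuple_update)
    show "(e i \<rhd>\<^bsub>T.D\<^esub> T.pure w) \<lhd>\<^bsub>T.D\<^esub> e j = T.pure (corner w)"
      using w w' ec by (simp add: T.pure_lact T.pure_ract corner_def)
  qed
  show ?thesis
  proof
    assume "reaches j (n - 1) (e i)"
    then obtain w \<Psi> where w: "w \<in> tuples A n" "e i \<otimes> w ! 0 = w ! 0" "w ! (n - 1) \<otimes> e j = w ! (n - 1)"
        and \<Psi>: "balanced_map A B n \<Psi>" "\<Psi> w \<noteq> \<zero>"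
      using ex_balanced_map_if_reaches[OF ij(2) _ ec(1) e_idem[OF ij(1)], of "n - 1"] n by auto
    have "corner w = w" using w by (simp add: corner_def)
    moreover have "T.pure w \<noteq> \<zero>\<^bsub>T.D\<^esub>"
      by (rule T.pure_nonzero[where G = A and \<Psi> = \<Psi>, OF A.A.abelian_group_axioms _ _ _ w(1) \<Psi>(2)];
          rule balanced_mapD[OF \<Psi>(1)]; assumption)
    ultimately show "\<exists>d\<in>carrier T.D. (e i \<rhd>\<^bsub>T.D\<^esub> d) \<lhd>\<^bsub>T.D\<^esub> e j \<noteq> \<zero>\<^bsub>T.D\<^esub>"
      using corner(2)[OF w(1)] T.pure_closed[OF w(1)] by metis
  next
    assume "\<exists>d\<in>carrier T.D. (e i \<rhd>\<^bsub>T.D\<^esub> d) \<lhd>\<^bsub>T.D\<^esub> e j \<noteq> \<zero>\<^bsub>T.D\<^esub>"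
    then obtain d where d: "d \<in> carrier T.D" "(e i \<rhd>\<^bsub>T.D\<^esub> d) \<lhd>\<^bsub>T.D\<^esub> e j \<noteq> \<zero>\<^bsub>T.D\<^esub>" by blast
    have "\<exists>w\<in>tuples A n. (e i \<rhd>\<^bsub>T.D\<^esub> T.pure w) \<lhd>\<^bsub>T.D\<^esub> e j \<noteq> \<zero>\<^bsub>T.D\<^esub>"
    proof (rule ccontr)
      assume "\<not> ?thesis"
      then have zero: "(e i \<rhd>\<^bsub>T.D\<^esub> T.pure w) \<lhd>\<^bsub>T.D\<^esub> e j = \<zero>\<^bsub>T.D\<^esub>" if "w \<in> tuples A n" for w
        using that by blast
      have "(\<lambda>_. \<zero>\<^bsub>T.D\<^esub>) \<in> additive_maps T.D T.D" by (rule additive_mapsI) simp_all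
      from T.additive_ext[OF T.abelian_group_D
          additive_comp[OF T.additive_lact[OF ec(1)] T.additive_ract[OF ec(2)]] this zero d(1)]
      have "(e i \<rhd>\<^bsub>T.D\<^esub> d) \<lhd>\<^bsub>T.D\<^esub> e j = \<zero>\<^bsub>T.D\<^esub>" .
      with d(2) show False ..
    qed
    then obtain w where w: "w \<in> tuples A n" "T.pure (corner w) \<noteq> \<zero>\<^bsub>T.D\<^esub>" using corner(2) by metis
    note cw = corner(1)[OF w(1)]
    obtain x ws where x: "corner w = x # ws" "x \<in> carrier A" "ws \<in> tuples A (n - 1)"
      using cw n tuples_SucE[of "corner w" A "n - 1"] by auto
    have w0: "w ! 0 \<in> carrier A" using T.tuple_nth[OF w(1) last(2)] .
    have len: "length w = n" using T.tuple_length[OF w(1)] .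
    have "x = corner w ! 0" by (simp add: x)
    also have "e i \<otimes> \<dots> = \<dots>"
      using w0 ec n len e_idem[OF ij(1)]
      by (cases "n - 1 = 0") (auto simp: corner_def A.A.m_assoc[symmetric])
    finally have ex: "e i \<otimes> x = x" by (simp add: x)
    have "corner w \<noteq> []" using T.tuple_length[OF cw] n by auto
    then have last_corner: "last (corner w) = corner w ! (n - 1)"
      using T.tuple_length[OF cw] by (simp add: last_conv_nth)
    have "corner w ! (n - 1) \<otimes> e j = corner w ! (n - 1)"
      using ec n len T.tuple_nth[OF w(1) last(1)] w0 e_idem[OF ij(2)]
      by (cases "n - 1 = 0") (auto simp: corner_def A.A.m_assoc)
    then have "last (x # ws) \<otimes> e j = last (x # ws)" using last_corner by (simp only: x(1))
    then have "reaches j (length ws) (e i)"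
      using reaches_if_pure_nonzero[OF ij(2) n, of "[]" x ws "e i"] w(2) cw ec(1) ex by (simp add: x)
    then show "reaches j (n - 1) (e i)" using x(3) by (simp add: tuples_def)
  qed
qed

end

section \<open>The inclusion matrix\<close>

lemma transpose_mult_entry_pos:
  assumes "(M :: nat mat) \<in> carrier_mat r s" "i < s" "j < s"
  shows "(transpose_mat M * M) $$ (i, j) \<noteq> 0 \<longleftrightarrow> (\<exists>k<r. M $$ (k, i) \<noteq> 0 \<and> M $$ (k, j) \<noteq> 0)"
  using assms by (auto simp: scalar_prod_def)

lemma mult_entry_pos:
  assumes "(X :: nat mat) \<in> carrier_mat s s" "Y \<in> carrier_mat s s" "i < s" "j < s"
  shows "(X * Y) $$ (i, j) \<noteq> 0 \<longleftrightarrow> (\<exists>l<s. X $$ (i, l) \<noteq> 0 \<and> Y $$ (l, j) \<noteq> 0)"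
  using assms by (auto simp: scalar_prod_def)

text \<open>Over the natural numbers, a bound by a multiple only compares the supports.\<close>

lemma ex_multiple_bound_iff:
  assumes "(X :: nat mat) \<in> carrier_mat s s" "Y \<in> carrier_mat s s"
  shows "(\<exists>q>0. X \<le> q \<cdot>\<^sub>m Y) \<longleftrightarrow> (\<forall>i<s. \<forall>j<s. X $$ (i, j) \<noteq> 0 \<longrightarrow> Y $$ (i, j) \<noteq> 0)"
proof
  assume "\<exists>q>0. X \<le> q \<cdot>\<^sub>m Y"
  then obtain q where "X \<le> q \<cdot>\<^sub>m Y" by blast
  then have "X $$ (i, j) \<le> q * Y $$ (i, j)" if "i < s" "j < s" for i j
    using assms that by (auto simp: less_eq_mat_def)
  then show "\<forall>i<s. \<forall>j<s. X $$ (i, j) \<noteq> 0 \<longrightarrow> Y $$ (i, j) \<noteq> 0"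
    by (metis le_zero_eq mult_0_right)
next
  assume supp: "\<forall>i<s. \<forall>j<s. X $$ (i, j) \<noteq> 0 \<longrightarrow> Y $$ (i, j) \<noteq> 0"
  define q where "q = Suc (\<Sum>i<s. \<Sum>j<s. X $$ (i, j))"
  have "X $$ (i, j) \<le> q * Y $$ (i, j)" if ij: "i < s" "j < s" for i j
  proof (cases "X $$ (i, j) = 0")
    case False
    have "X $$ (i, j) \<le> (\<Sum>j<s. X $$ (i, j))" using ij by (intro member_le_sum) auto
    also have "\<dots> \<le> (\<Sum>i<s. \<Sum>j<s. X $$ (i, j))"
      using ij by (intro member_le_sum[of i _ "\<lambda>i. \<Sum>j<s. X $$ (i, j)"]) auto
    also have "\<dots> \<le> q * 1" by (simp add: q_def)
    also have "\<dots> \<le> q * Y $$ (i, j)" using supp ij False by (intro mult_le_mono2) (simp add: Suc_leI)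
    finally show ?thesis .
  qed simp
  then have "X \<le> q \<cdot>\<^sub>m Y" using assms by (auto simp: less_eq_mat_def)
  then show "\<exists>q>0. X \<le> q \<cdot>\<^sub>m Y" by (intro exI[of _ q]) (simp add: q_def)
qed

lemma pow_mat_Suc_left:
  assumes "(X :: nat mat) \<in> carrier_mat s s"
  shows "X ^\<^sub>m Suc m = X * X ^\<^sub>m m"
proof (induction m)
  case (Suc m)
  have "X ^\<^sub>m Suc (Suc m) = (X * X ^\<^sub>m m) * X" using Suc by simp
  also have "\<dots> = X * (X ^\<^sub>m m * X)"
    using assms pow_carrier_mat[OF assms, of m] by (intro assoc_mult_mat) auto
  finally show ?case by simp
qed (use assms in simp)

context subalgebra_pair
begin

theorem reaches_iff_power_entry:
  assumes M: "M \<in> carrier_mat r s"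
    and entries: "\<And>k i. \<lbrakk>k < r; i < s\<rbrakk> \<Longrightarrow> linked (e i) (p k) \<longleftrightarrow> M $$ (k, i) \<noteq> 0"
    and ij: "i < s" "j < s"
  shows "reaches j m (e i) \<longleftrightarrow> ((transpose_mat M * M) ^\<^sub>m m) $$ (i, j) \<noteq> (0 :: nat)"
proof -
  define S where "S = transpose_mat M * M"
  have S: "S \<in> carrier_mat s s" using M by (simp add: S_def)
  have Sm: "S ^\<^sub>m m \<in> carrier_mat s s" for m using pow_carrier_mat[OF S] .
  have sym: "linked (p k) (e i) \<longleftrightarrow> M $$ (k, i) \<noteq> 0" if "k < r" "i < s" for k i
    using linked_sym entries[OF that] e_closed[OF that(2)] p_closed[OF that(1)] by blast
  have step: "(S ^\<^sub>m Suc m) $$ (i, j) \<noteq> 0 \<longleftrightarrow>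
      (\<exists>k<r. M $$ (k, i) \<noteq> 0 \<and> (\<exists>l<s. M $$ (k, l) \<noteq> 0 \<and> (S ^\<^sub>m m) $$ (l, j) \<noteq> 0))"
    if "i < s" for i m
    unfolding pow_mat_Suc_left[OF S] mult_entry_pos[OF S Sm that ij(2)]
    using transpose_mult_entry_pos[OF M that] unfolding S_def by blast
  have from_p: "reaches j m (p k) \<longleftrightarrow> (\<exists>l<s. M $$ (k, l) \<noteq> 0 \<and> (S ^\<^sub>m m) $$ (l, j) \<noteq> 0)"
    if "k < r" for k m
    using that
  proof (induction m arbitrary: k)
    case 0
    have "(S ^\<^sub>m 0) $$ (l, j) \<noteq> 0 \<longleftrightarrow> l = j" if "l < s" for l using S ij that by simp
    then show ?case using sym[OF 0 ij(2)] ij(2) by auto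
  next
    case (Suc m)
    have "linked (p k) (p k') \<longleftrightarrow> (\<exists>l<s. M $$ (k, l) \<noteq> 0 \<and> M $$ (k', l) \<noteq> 0)" if "k' < r" for k'
      unfolding linked_p_p[OF Suc.prems that] using sym[OF Suc.prems] entries[OF that] by blast
    then have "reaches j (Suc m) (p k) \<longleftrightarrow> (\<exists>k'<r. (\<exists>l<s. M $$ (k, l) \<noteq> 0 \<and> M $$ (k', l) \<noteq> 0) \<and>
        (\<exists>l'<s. M $$ (k', l') \<noteq> 0 \<and> (S ^\<^sub>m m) $$ (l', j) \<noteq> 0))"
      using Suc.IH by (simp cong: conj_cong)
    also have "\<dots> \<longleftrightarrow> (\<exists>l<s. M $$ (k, l) \<noteq> 0 \<and> (S ^\<^sub>m Suc m) $$ (l, j) \<noteq> 0)"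
      using step by blast
    finally show ?case .
  qed
  have "reaches j m (e i) \<longleftrightarrow> (S ^\<^sub>m m) $$ (i, j) \<noteq> 0"
  proof (cases m)
    case 0
    then show ?thesis using S ij by (simp add: linked_e_e)
  next
    case (Suc m')
    have "reaches j m (e i) \<longleftrightarrow> (\<exists>k<r. M $$ (k, i) \<noteq> 0 \<and> reaches j m' (p k))"
      using entries ij(1) by (auto simp: Suc)
    then show ?thesis using from_p step[OF ij(1), of m'] by (auto simp: Suc)
  qed
  then show ?thesis by (simp add: S_def)
qed

end

text \<open>By the last assumption \<open>p\<close> acts as zero on \<open>W l\<close> iff \<open>l \<noteq> k\<close>, so its action on \<open>V\<close> detects
  whether \<open>W k\<close> occurs in \<open>V\<close>.\<close>

lemma multiplicity_nonzero_iff: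
  fixes V :: "('a, 'v) rmodule" and W :: "nat \<Rightarrow> ('a, 'w) rmodule"
  assumes V: "right_module R V" and W: "\<And>l. l < r \<Longrightarrow> right_module R (W l)"
    and iso: "rmod_iso R V (rmod_dsum (SIGMA l:{..<r}. {..<m l}) (\<lambda>(l, _). W l))"
    and p: "p \<in> carrier R" and k: "k < r"
    and detect: "\<And>l. l < r \<Longrightarrow> (\<exists>w\<in>carrier (W l). w \<lhd>\<^bsub>W l\<^esub> p \<noteq> \<zero>\<^bsub>W l\<^esub>) \<longleftrightarrow> l = k"
  shows "(\<exists>v\<in>carrier V. v \<lhd>\<^bsub>V\<^esub> p \<noteq> \<zero>\<^bsub>V\<^esub>) \<longleftrightarrow> m k \<noteq> (0 :: nat)"
proof -
  define I where "I = (SIGMA l:{..<r}. {..<m l})"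
  define N where "N = (\<lambda>(l, _ :: nat). W l)"
  define T where "T = rmod_dsum I N"
  have T_simps: "carrier T = (\<Pi>\<^sub>E i\<in>I. carrier (N i))" "\<zero>\<^bsub>T\<^esub> = (\<lambda>i\<in>I. \<zero>\<^bsub>N i\<^esub>)"
      "u \<lhd>\<^bsub>T\<^esub> x = (\<lambda>i\<in>I. u i \<lhd>\<^bsub>N i\<^esub> x)" for u x
    by (simp_all add: T_def rmod_dsum_def)
  interpret V: right_module R V by (fact V)
  obtain h where h: "h \<in> rmod_hom R V T" "bij_betw h (carrier V) (carrier T)"
    using iso unfolding rmod_iso_def T_def I_def N_def by blast
  note hD = rmod_homD[OF h(1)]
  have NI: "right_module R (N i)" if "i \<in> I" for i using that W by (auto simp: I_def N_def)
  have N_zero: "\<zero>\<^bsub>N i\<^esub> \<in> carrier (N i)" "\<zero>\<^bsub>N i\<^esub> \<oplus>\<^bsub>N i\<^esub> \<zero>\<^bsub>N i\<^esub> = \<zero>\<^bsub>N i\<^esub>" if "i \<in> I" for i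
  proof -
    interpret Ni: right_module R "N i" by (rule NI[OF that])
    show "\<zero>\<^bsub>N i\<^esub> \<in> carrier (N i)" "\<zero>\<^bsub>N i\<^esub> \<oplus>\<^bsub>N i\<^esub> \<zero>\<^bsub>N i\<^esub> = \<zero>\<^bsub>N i\<^esub>" by simp_all
  qed
  have h0: "h \<zero>\<^bsub>V\<^esub> = \<zero>\<^bsub>T\<^esub>"
  proof -
    have "h \<zero>\<^bsub>V\<^esub> = h (\<zero>\<^bsub>V\<^esub> \<lhd>\<^bsub>V\<^esub> \<zero>\<^bsub>R\<^esub>)" by (simp add: V.ract_zero)
    also have "\<dots> = h \<zero>\<^bsub>V\<^esub> \<lhd>\<^bsub>T\<^esub> \<zero>\<^bsub>R\<^esub>" by (simp add: hD(2))
    also have "\<dots> = \<zero>\<^bsub>T\<^esub>"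
      using additive_closed[OF hD(1), of "\<zero>\<^bsub>V\<^esub>"] right_module.ract_zero[OF NI]
      by (auto simp: T_simps intro!: restrict_ext dest: PiE_mem)
    finally show ?thesis .
  qed
  show ?thesis
  proof
    assume "\<exists>v\<in>carrier V. v \<lhd>\<^bsub>V\<^esub> p \<noteq> \<zero>\<^bsub>V\<^esub>"
    then obtain v where v: "v \<in> carrier V" "v \<lhd>\<^bsub>V\<^esub> p \<noteq> \<zero>\<^bsub>V\<^esub>" by blast
    have "h (v \<lhd>\<^bsub>V\<^esub> p) \<noteq> h \<zero>\<^bsub>V\<^esub>"
      using h(2) v p V.ract_closed[OF v(1) p] by (auto simp: bij_betw_def dest: inj_onD)
    then have ne: "(\<lambda>i\<in>I. h v i \<lhd>\<^bsub>N i\<^esub> p) \<noteq> (\<lambda>i\<in>I. \<zero>\<^bsub>N i\<^esub>)"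
      using v p by (simp add: hD(2) h0 T_simps)
    have "\<exists>i\<in>I. h v i \<lhd>\<^bsub>N i\<^esub> p \<noteq> \<zero>\<^bsub>N i\<^esub>"
    proof (rule ccontr)
      assume "\<not> ?thesis"
      then have "(\<lambda>i\<in>I. h v i \<lhd>\<^bsub>N i\<^esub> p) = (\<lambda>i\<in>I. \<zero>\<^bsub>N i\<^esub>)" by (intro restrict_ext) auto
      with ne show False ..
    qed
    then obtain l t where lt: "l < r" "t < m l" "h v (l, t) \<lhd>\<^bsub>W l\<^esub> p \<noteq> \<zero>\<^bsub>W l\<^esub>"
      by (auto simp: I_def N_def)
    have "(l, t) \<in> I" using lt by (simp add: I_def)
    then have "h v (l, t) \<in> carrier (N (l, t))"
      using additive_closed[OF hD(1) v(1)] unfolding T_simps by (rule PiE_mem[rotated])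
    then have "l = k" using detect[OF lt(1)] lt(3) by (auto simp: N_def)
    then show "m k \<noteq> 0" using lt(2) by auto
  next
    assume mk: "m k \<noteq> 0"
    obtain w where w: "w \<in> carrier (W k)" "w \<lhd>\<^bsub>W k\<^esub> p \<noteq> \<zero>\<^bsub>W k\<^esub>" using detect[OF k] by blast
    define u where "u = (\<lambda>i\<in>I. if i = (k, 0) then w else \<zero>\<^bsub>N i\<^esub>)"
    have k0: "(k, 0) \<in> I" using k mk by (simp add: I_def)
    have "u \<in> carrier T" using w N_zero(1) by (auto simp: T_simps u_def N_def)
    then have "u \<in> h ` carrier V" using h(2) by (simp add: bij_betw_def)
    then obtain v where v: "v \<in> carrier V" "h v = u" by blast
    have "v \<lhd>\<^bsub>V\<^esub> p \<noteq> \<zero>\<^bsub>V\<^esub>"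
    proof
      assume "v \<lhd>\<^bsub>V\<^esub> p = \<zero>\<^bsub>V\<^esub>"
      then have "(u \<lhd>\<^bsub>T\<^esub> p) (k, 0) = \<zero>\<^bsub>T\<^esub> (k, 0)"
        using hD(2)[OF v(1) p] v(2) h0 by simp
      then show False using w(2) k0 by (simp add: T_simps u_def N_def)
    qed
    then show "\<exists>v\<in>carrier V. v \<lhd>\<^bsub>V\<^esub> p \<noteq> \<zero>\<^bsub>V\<^esub>" using v(1) by blast
  qed
qed

theorem theorem3p2:
  fixes A :: "(complex, 'a, 'x) module_scheme" and B :: "'a set"
    and V :: "nat \<Rightarrow> ('a, 'v) rmodule" and W :: "nat \<Rightarrow> ('a, 'w) rmodule"
    and r s n :: nat and M S :: "nat mat"
  assumes "fd_semisimple_algebra A"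
    and "complex_subalgebra B A"
    and "fd_semisimple_algebra (A\<lparr>carrier := B\<rparr>)"
    and "inclusion_matrix A B r W s V M"
    and "S = transpose_mat M * M"
    and "n \<ge> 1"
  shows "has_H_depth_odd A B n \<longleftrightarrow>
    (\<exists>q>0. S ^\<^sub>m n \<le> q \<cdot>\<^sub>m (S ^\<^sub>m (n - 1)))"
proof -
  have reps: "simple_reps A s V" "simple_reps (A\<lparr>carrier := B\<rparr>) r W" and M: "M \<in> carrier_mat r s"
    and restr: "\<And>i. i < s \<Longrightarrow> rmod_iso (A\<lparr>carrier := B\<rparr>) (V i)
        (rmod_dsum (SIGMA l:{..<r}. {..<M $$ (l, i)}) (\<lambda>(l, _). W l))"
    using assms(4) by (auto simp: inclusion_matrix_def)
  obtain e v and P :: "(nat \<times> 'a) set" and a b where e: "corner_system A s e P a b"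
      "\<And>i. i < s \<Longrightarrow> presents A (V i) (e i) (v i)"
    by (rule ex_corner_system[OF assms(1) reps(1)]) (rule that)
  obtain p w and P' :: "(nat \<times> 'a) set" and c d where p: "corner_system (A\<lparr>carrier := B\<rparr>) r p P' c d"
      "\<And>k. k < r \<Longrightarrow> presents (A\<lparr>carrier := B\<rparr>) (W k) (p k) (w k)"
    by (rule ex_corner_system[OF assms(3) reps(2)]) (rule that)
  have V: "simple_rmodule A (V i)" if "i < s" for i using reps(1) that by (simp add: simple_reps_def)
  have W: "simple_rmodule (A\<lparr>carrier := B\<rparr>) (W k)" if "k < r" for k
    using reps(2) that by (simp add: simple_reps_def)
  interpret subalgebra_pair A s e P a b B r p P' c d
  proof (intro subalgebra_pair.intro subalgebra_pair_axioms.intro e(1) p(1) assms(2))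
    show "semisimple_ring A" "finite_dim A" using assms(1) by (simp_all add: fd_semisimple_algebra_def)
    show "\<exists>y\<in>carrier A. e i \<otimes>\<^bsub>A\<^esub> x \<otimes>\<^bsub>A\<^esub> y = e i"
      if "i < s" "x \<in> carrier A" "e i \<otimes>\<^bsub>A\<^esub> x \<noteq> \<zero>\<^bsub>A\<^esub>" for i x
      using simple_right_inverse[OF e(2)[OF that(1)] V[OF that(1)] that(2,3)] by blast
  qed
  have entries: "linked (e i) (p k) \<longleftrightarrow> M $$ (k, i) \<noteq> 0" if k: "k < r" and i: "i < s" for k i
  proof -
    have Vi: "right_module A (V i)" using simple_rmoduleD(1)[OF V[OF i]] .
    interpret Vi: right_module A "V i" by (fact Vi)
    have VB: "right_module (A\<lparr>carrier := B\<rparr>) (V i)"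
      by (intro right_module.intro right_module_axioms.intro B.A.ring_axioms Vi.M.abelian_group_axioms)
        (auto simp: B_subset Vi.ract_closed Vi.ract_add Vi.ract_add_scalar Vi.ract_mult Vi.ract_one)
    have detect: "(\<exists>x\<in>carrier (W l). x \<lhd>\<^bsub>W l\<^esub> p k \<noteq> \<zero>\<^bsub>W l\<^esub>) \<longleftrightarrow> l = k" if l: "l < r" for l
    proof -
      have "(\<exists>x\<in>carrier (W l). x \<lhd>\<^bsub>W l\<^esub> p k \<noteq> \<zero>\<^bsub>W l\<^esub>) \<longleftrightarrow>
          (\<exists>x\<in>B. p l \<otimes>\<^bsub>A\<^esub> x \<otimes>\<^bsub>A\<^esub> p k \<noteq> \<zero>\<^bsub>A\<^esub>)"
        using presents_ract_nonzero[OF p(2)[OF l] simple_rmoduleD(1)[OF W[OF l]], of "p k"]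
          B.e_closed[OF k] by simp
      also have "\<dots> \<longleftrightarrow> l = k"
      proof
        assume "l = k"
        then have "p l \<otimes>\<^bsub>A\<^esub> p l \<otimes>\<^bsub>A\<^esub> p k \<noteq> \<zero>\<^bsub>A\<^esub>" "p l \<in> B"
          using B.e_idem[OF k] B.e_nonzero[OF k] B.e_closed[OF k] by simp_all
        then show "\<exists>x\<in>B. p l \<otimes>\<^bsub>A\<^esub> x \<otimes>\<^bsub>A\<^esub> p k \<noteq> \<zero>\<^bsub>A\<^esub>" by blast
      qed (use B.e_orth[OF l k] in auto)
      finally show ?thesis .
    qed
    have "linked (e i) (p k) \<longleftrightarrow> (\<exists>x\<in>carrier (V i). x \<lhd>\<^bsub>V i\<^esub> p k \<noteq> \<zero>\<^bsub>V i\<^esub>)"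
      unfolding linked_def using presents_ract_nonzero[OF e(2)[OF i] Vi p_closed[OF k]] by simp
    also have "\<dots> \<longleftrightarrow> M $$ (k, i) \<noteq> 0"
      by (rule multiplicity_nonzero_iff[OF VB simple_rmoduleD(1)[OF W] restr[OF i] _ k detect])
        (use B.e_closed[OF k] in simp_all)
    finally show ?thesis .
  qed
  have corners: "(\<exists>d\<in>carrier (tensor_power A B m). (e i \<rhd>\<^bsub>tensor_power A B m\<^esub> d)
        \<lhd>\<^bsub>tensor_power A B m\<^esub> e j \<noteq> \<zero>\<^bsub>tensor_power A B m\<^esub>) \<longleftrightarrow> (S ^\<^sub>m (m - 1)) $$ (i, j) \<noteq> 0"
    if "m \<ge> 1" "i < s" "j < s" for m i j
    using tensor_power_corner_nonzero_iff[OF that] reaches_iff_power_entry[OF M entries that(2,3)]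
    by (simp add: assms(5))
  interpret T: algebra_tensor_power A B n by (rule algebra_tensor_power[OF assms(6)])
  interpret T': algebra_tensor_power A B "n + 1" by (rule algebra_tensor_power) simp
  have S: "S \<in> carrier_mat s s" using M by (simp add: assms(5))
  have "has_H_depth_odd A B n \<longleftrightarrow>
      (\<forall>i<s. \<forall>j<s. (S ^\<^sub>m n) $$ (i, j) \<noteq> 0 \<longrightarrow> (S ^\<^sub>m (n - 1)) $$ (i, j) \<noteq> 0)"
    unfolding has_H_depth_odd_def
      iso_to_bimod_summand_iff_corners[OF T'.complex_bimodule_tensor_power T.complex_bimodule_tensor_power
        T'.finite_dim_tensor_power[OF fd] T.finite_dim_tensor_power[OF fd]]
    using corners[of "n + 1"] corners[OF assms(6)] by simp
  also have "\<dots> \<longleftrightarrow> (\<exists>q>0. S ^\<^sub>m n \<le> q \<cdot>\<^sub>m (S ^\<^sub>m (n - 1)))"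
    using ex_multiple_bound_iff[OF pow_carrier_mat[OF S] pow_carrier_mat[OF S]] by simp
  finally show ?thesis .
qed

end
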